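(* For every finite-dimensional quantum state $\rho$, the coherence cost under PIO equals the uniform coherence of formation: \[ C_{c,\mathrm{PIO}}(\rho)=C_f^{\mathcal U}(\rho):=\inf\Big\{\sum_\alpha p_\alpha\log k_\alpha:\ \rho=\sum_\alpha p_\alpha\Psi_\alpha,\ |\Psi_\alpha\rangle\in\mathcal U_{k_\alpha}\Big\}, \] where the infimum is over finite convex decompositions of $\rho$ into uniformly coherent pure states, and is $+\infty$ if no such decomposition exists.
   Context: Fix the computational basis $\{|i\rangle\}_{i=1}^d$; logarithms base 2. For $1\le k\le d$, $\mathcal U_k$ is the set of uniformly coherent states of size $k$: $|\Psi\rangle=k^{-1/2}\sum_{j\in J}e^{i\theta_j}|j\rangle$ with $J\subseteq[d]$, $|J|=k$, $\theta_j\in\mathbb R$; $\Psi=|\Psi\rangle\langle\Psi|$. Incoherent unitaries are products of a permutation matrix and a diagonal unitary; incoherent projectors are $\Pi_I=\sum_{i\in I}|i\rangle\langle i|$. A physically incoherent operation (PIO) is a channel $\Lambda(X)=\sum_{\alpha,\beta}p_\alpha U_{\alpha,\beta}\Pi_{\beta|\alpha}X\Pi_{\beta|\alpha}U_{\alpha,\beta}^\dagger$, with $p$ a probability distribution, $U_{\alpha,\beta}$ incoherent unitaries, and for each $\alpha$ the $\Pi_{\beta|\alpha}$ incoherent projectors summing to the identity; when input and output dimensions differ, spaces are identified with spans of subsets of basis vectors of a common space (appending incoherent states, relabelling basis vectors and discarding subsystems are allowed). $\Psi_{2^m}$ is the maximally coherent state $2^{-m/2}\sum_{i=1}^{2^m}|i\rangle$.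 For a class $\mathcal O$, the coherence cost is $C_{c,\mathcal O}(\rho)=\inf\{r:\lim_{n\to\infty}\inf_{\Lambda\in\mathcal O}\|\Lambda(\Psi_{2^{\lfloor rn\rfloor}})-\rho^{\otimes n}\|_1=0\}$ (infimum of the empty set is $+\infty$). *)

theory Defs
  imports "HOL-Analysis.Analysis" "Jordan_Normal_Form.Matrix"
begin

definition dagger :: "complex mat \<Rightarrow> complex mat" where
  "dagger A = mat (dim_col A) (dim_row A) (\<lambda>(i,j). cnj (A $$ (j,i)))"

definition mtrace :: "complex mat \<Rightarrow> complex" where
  "mtrace A = (\<Sum>i<dim_row A. A $$ (i,i))"

definition psd :: "nat \<Rightarrow> complex mat \<Rightarrow> bool" where
  "psd n A \<longleftrightarrow> A \<in> carrier_mat n n \<and>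
     (\<forall>v \<in> carrier_vec n. Im ((A *\<^sub>v v) \<bullet>c v) = 0 \<and> Re ((A *\<^sub>v v) \<bullet>c v) \<ge> 0)"

definition density :: "nat \<Rightarrow> complex mat \<Rightarrow> bool" where
  "density d \<rho> \<longleftrightarrow> psd d \<rho> \<and> mtrace \<rho> = 1"

definition psd_sqrt :: "complex mat \<Rightarrow> complex mat" where
  "psd_sqrt A = (THE B. psd (dim_row A) B \<and> B * B = A)"

definition trace_norm :: "complex mat \<Rightarrow> real" where
  "trace_norm X = Re (mtrace (psd_sqrt (dagger X * X)))"

definition kron :: "complex mat \<Rightarrow> complex mat \<Rightarrow> complex mat" where
  "kron A B = mat (dim_row A * dim_row B) (dim_col A * dim_col B)
     (\<lambda>(i,j). A $$ (i div dim_row B, j div dim_col B) * B $$ (i mod dim_row B, j mod dim_col B))"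

fun tensor_pow :: "complex mat \<Rightarrow> nat \<Rightarrow> complex mat" where
  "tensor_pow A 0 = 1\<^sub>m 1"
| "tensor_pow A (Suc n) = kron (tensor_pow A n) A"

definition proj_vec :: "complex vec \<Rightarrow> complex mat" where
  "proj_vec v = mat (dim_vec v) (dim_vec v) (\<lambda>(i,j). v $ i * cnj (v $ j))"

definition unif_coherent :: "nat \<Rightarrow> nat \<Rightarrow> complex vec \<Rightarrow> bool" where
  "unif_coherent d k v \<longleftrightarrow> 1 \<le> k \<and> k \<le> d \<and>
     (\<exists>J \<theta>. J \<subseteq> {..<d} \<and> card J = k \<and>
        v = vec d (\<lambda>j. if j \<in> J then exp (\<i> * complex_of_real (\<theta> j)) / complex_of_real (sqrt (real k)) else 0))"

definition max_coh :: "nat \<Rightarrow> complex mat" where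
  "max_coh m = proj_vec (vec (2^m) (\<lambda>_. complex_of_real (1 / sqrt (2^m))))"

definition perm_mat :: "nat \<Rightarrow> (nat \<Rightarrow> nat) \<Rightarrow> complex mat" where
  "perm_mat D \<sigma> = mat D D (\<lambda>(i,j). if i = \<sigma> j then 1 else 0)"

definition diag_of :: "nat \<Rightarrow> (nat \<Rightarrow> complex) \<Rightarrow> complex mat" where
  "diag_of D c = mat D D (\<lambda>(i,j). if i = j then c i else 0)"

definition incoh_unitary :: "nat \<Rightarrow> complex mat \<Rightarrow> bool" where
  "incoh_unitary D U \<longleftrightarrow> (\<exists>\<sigma> c. \<sigma> permutes {..<D} \<and> (\<forall>i<D. cmod (c i) = 1) \<and>
       U = perm_mat D \<sigma> * diag_of D c)"

definition incoh_proj :: "nat \<Rightarrow> nat set \<Rightarrow> complex mat" where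
  "incoh_proj D I = mat D D (\<lambda>(i,j). if i = j \<and> i \<in> I then 1 else 0)"

definition PIO_square :: "nat \<Rightarrow> (complex mat \<Rightarrow> complex mat) \<Rightarrow> bool" where
  "PIO_square D \<Phi> \<longleftrightarrow> (\<exists>(N::nat) (M::nat) (p::nat \<Rightarrow> real) U I.
      (\<forall>\<alpha><N. p \<alpha> \<ge> 0) \<and> (\<Sum>\<alpha><N. p \<alpha>) = 1 \<and>
      (\<forall>\<alpha><N. \<forall>\<beta><M. incoh_unitary D (U \<alpha> \<beta>) \<and> I \<alpha> \<beta> \<subseteq> {..<D}) \<and>
      (\<forall>\<alpha><N. mat D D (\<lambda>(i,j). \<Sum>\<beta><M. incoh_proj D (I \<alpha> \<beta>) $$ (i,j)) = 1\<^sub>m D) \<and>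
      (\<forall>X \<in> carrier_mat D D. \<Phi> X = mat D D (\<lambda>(i,j). \<Sum>\<alpha><N. complex_of_real (p \<alpha>) *
          (\<Sum>\<beta><M. (U \<alpha> \<beta> * incoh_proj D (I \<alpha> \<beta>) * X * incoh_proj D (I \<alpha> \<beta>)
                     * dagger (U \<alpha> \<beta>)) $$ (i,j)))))"

text \<open>Embedding an a x a matrix into a D x D matrix along an injection of basis labels,
  and the PIO class between dimensions a and b: both spaces are identified with spans of
  subsets of basis vectors of a common D-dimensional space, on which a PIO acts.\<close>
definition embed :: "nat \<Rightarrow> (nat \<Rightarrow> nat) \<Rightarrow> complex mat \<Rightarrow> complex mat" where
  "embed D \<iota> X = mat D D (\<lambda>(i,j).
     if i \<in> \<iota> ` {..<dim_row X} \<and> j \<in> \<iota> ` {..<dim_col X}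
     then X $$ (inv_into {..<dim_row X} \<iota> i, inv_into {..<dim_col X} \<iota> j) else 0)"

definition PIO :: "nat \<Rightarrow> nat \<Rightarrow> (complex mat \<Rightarrow> complex mat) \<Rightarrow> bool" where
  "PIO a b \<Lambda> \<longleftrightarrow> (\<exists>D \<iota> \<kappa> \<Phi>. a \<le> D \<and> b \<le> D \<and>
      inj_on \<iota> {..<a} \<and> \<iota> ` {..<a} \<subseteq> {..<D} \<and>
      inj_on \<kappa> {..<b} \<and> \<kappa> ` {..<b} \<subseteq> {..<D} \<and>
      PIO_square D \<Phi> \<and>
      (\<forall>X \<in> carrier_mat a a. \<Lambda> X \<in> carrier_mat b b \<and> \<Phi> (embed D \<iota> X) = embed D \<kappa> (\<Lambda> X)))"

text \<open>Coherence cost under PIO (value in extended reals; Inf {} = \<infinity>).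
  Rates r are nonnegative reals; m = floor(r n).\<close>
definition coh_cost_PIO :: "nat \<Rightarrow> complex mat \<Rightarrow> ereal" where
  "coh_cost_PIO d \<rho> = Inf (ereal ` {r::real. r \<ge> 0 \<and>
     (\<lambda>n. Inf {trace_norm (\<Lambda> (max_coh (nat \<lfloor>r * real n\<rfloor>)) - tensor_pow \<rho> n) | \<Lambda>.
               PIO (2 ^ nat \<lfloor>r * real n\<rfloor>) (d ^ n) \<Lambda>}) \<longlonglongrightarrow> 0})"

definition unif_cof :: "nat \<Rightarrow> complex mat \<Rightarrow> ereal" where
  "unif_cof d \<rho> = Inf {ereal (\<Sum>\<alpha><(N::nat). p \<alpha> * log 2 (real (k \<alpha>))) | N p k \<psi>.
      (\<forall>\<alpha><N. p \<alpha> \<ge> 0) \<and> (\<Sum>\<alpha><N. p \<alpha>) = 1 \<and>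
      (\<forall>\<alpha><N. unif_coherent d (k \<alpha>) (\<psi> \<alpha>)) \<and>
      \<rho> = mat d d (\<lambda>(i,j). \<Sum>\<alpha><N. complex_of_real (p \<alpha>) * proj_vec (\<psi> \<alpha>) $$ (i,j))}"

end

theory Submission
  imports Defs "Jordan_Normal_Form.Determinant" "HOL-Computational_Algebra.Fundamental_Theorem_Algebra" "HOL-Real_Asymp.Real_Asymp"
begin

text \<open>
  Lower bound. A PIO turns a maximally coherent state of size \<open>2^m\<close> into a mixture of uniformly coherent
  states of size at most \<open>2^m\<close>. The one-site marginals of a uniformly coherent state on \<open>n\<close> sites are
  mixtures of uniformly coherent states whose average \<open>log k\<close>, summed over the sites, is at most that of
  the whole state, by subadditivity of the entropy. The site-averaged marginal of the output therefore has a
  decomposition of cost at most \<open>m/n\<close>, and it converges to \<open>\<rho>\<close>. By Caratheodory's theorem the number of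
  terms can be bounded independently of \<open>n\<close>, so compactness gives a decomposition of \<open>\<rho>\<close> itself.

  Upper bound. The \<open>n\<close>-th power of an optimal decomposition expresses the \<open>n\<close>-fold tensor power of \<open>\<rho>\<close> through
  uniformly coherent states of size \<open>K\<close>, where \<open>log K\<close> concentrates at \<open>n\<close> times the cost. With \<open>M = 2^m\<close>,
  measuring the blocks of \<open>K\<close> consecutive basis labels converts the maximally coherent state of size \<open>M\<close>
  into one of size \<open>K\<close> except with probability \<open>(M mod K) / M\<close>.
\<close>

section \<open>Hermitian kernels and the trace norm\<close>

text \<open>The converse must end in an exact decomposition of \<open>\<rho>\<close>, although the
  outputs only approximate its tensor power. Summed marginals differ entrywise by at most
  \<open>n\<close> times the trace-norm error, and averaging over the \<open>n\<close> sites cancels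
  that factor, so the error of the whole block controls the one-site error. Vectors stay
  unnormalised throughout: "zero or unimodular" is inherited by slices, so partial traces remain
  mixtures of flat vectors, and it is a closed condition, so limits remain flat. A vector of weight
  \<open>k\<close> then carries trace \<open>k\<close> and entropy contribution
  \<open>k * ln k\<close>, the form in which entropies appear below. The length
  \<open>2 * d * d + 2\<close> counts the real quantities to be preserved: real and imaginary parts
  of all entries, total probability and cost. The trace norm refers to a square root given by a
  definite description, so a spectral theorem and the uniqueness of positive roots precede every
  estimate. In the direct part the gap between rate and cost is halved: one half absorbs the
  fluctuation of \<open>log K\<close>, the other makes \<open>2 ^ m\<close> exponentially larger
  than \<open>K\<close>.\<close>

definition mv :: "nat \<Rightarrow> (nat \<Rightarrow> nat \<Rightarrow> complex) \<Rightarrow> (nat \<Rightarrow> complex) \<Rightarrow> nat \<Rightarrow> complex" where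
  "mv n X v i = (\<Sum>j<n. X i j * v j)"

definition ip :: "nat \<Rightarrow> (nat \<Rightarrow> complex) \<Rightarrow> (nat \<Rightarrow> complex) \<Rightarrow> complex" where
  "ip n u v = (\<Sum>i<n. u i * cnj (v i))"

definition hermitian :: "nat \<Rightarrow> (nat \<Rightarrow> nat \<Rightarrow> complex) \<Rightarrow> bool" where
  "hermitian n X \<longleftrightarrow> (\<forall>i<n. \<forall>j<n. X i j = cnj (X j i))"

definition orthonormal :: "nat \<Rightarrow> nat \<Rightarrow> (nat \<Rightarrow> nat \<Rightarrow> complex) \<Rightarrow> bool" where
  "orthonormal n m v \<longleftrightarrow> (\<forall>k<m. \<forall>l<m. ip n (v k) (v l) = (if k = l then 1 else 0))"

section \<open>Linear systems and the spectral theorem for Hermitian kernels\<close>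

lemma homogeneous_system_nontrivial:
  fixes A :: "nat \<Rightarrow> 'i \<Rightarrow> 'a::field"
  assumes "finite S" "L < card S"
  shows "\<exists>x. (\<exists>j\<in>S. x j \<noteq> 0) \<and> (\<forall>i<L. (\<Sum>j\<in>S. A i j * x j) = 0)"
  using assms
proof (induction L arbitrary: S A)
  case 0
  then obtain j where "j \<in> S" by fastforce
  then show ?case by (intro exI[of _ "\<lambda>_. 1"]) auto
next
  case (Suc L)
  show ?case
  proof (cases "\<forall>j\<in>S. A L j = 0")
    case True
    from Suc.IH[of S A] Suc.prems obtain x where
      x: "\<exists>j\<in>S. x j \<noteq> 0" "\<forall>i<L. (\<Sum>j\<in>S. A i j * x j) = 0" by auto
    have "(\<Sum>j\<in>S. A L j * x j) = 0" using True by simp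
    with x show ?thesis using less_Suc_eq by auto
  next
    case False
    then obtain t where t: "t \<in> S" "A L t \<noteq> 0" by blast
    define S' where "S' = S - {t}"
    have S': "finite S'" "L < card S'" "t \<notin> S'" "S = insert t S'"
      using t Suc.prems by (auto simp: S'_def)
    \<comment> \<open>Gaussian elimination: subtracting a multiple of row \<open>L\<close> clears
      column \<open>t\<close>, so the other equations live on \<open>S'\<close>, and
      \<open>y t\<close> is chosen to satisfy row \<open>L\<close>. The field is general because
      both complex eigenvectors and real convex weights rely on this.\<close>
    define A' where "A' = (\<lambda>i j. A i j - A i t * A L j / A L t)"
    from Suc.IH[OF S'(1,2), of A'] obtain x where
      x: "\<exists>j\<in>S'. x j \<noteq> 0" "\<forall>i<L. (\<Sum>j\<in>S'. A' i j * x j) = 0" by blast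
    define y where "y = x(t := - (\<Sum>j\<in>S'. A L j * x j) / A L t)"
    have yx: "y j = x j" if "j \<in> S'" for j using that S'(3) by (auto simp: y_def)
    have sum_y: "(\<Sum>j\<in>S. A i j * y j) = A i t * y t + (\<Sum>j\<in>S'. A i j * x j)" for i
      unfolding S'(4) using S'(1,3) by (simp add: yx)
    have "(\<Sum>j\<in>S. A i j * y j) = 0" if i: "i < Suc L" for i
    proof (cases "i = L")
      case True
      then show ?thesis using sum_y t by (simp add: y_def)
    next
      case False
      with i have "i < L" by simp
      with x have "0 = (\<Sum>j\<in>S'. A' i j * x j)" by simp
      also have "\<dots> = (\<Sum>j\<in>S'. A i j * x j - A i t / A L t * (A L j * x j))"
        by (simp add: A'_def algebra_simps)
      also have "\<dots> = (\<Sum>j\<in>S'. A i j * x j) - A i t / A L t * (\<Sum>j\<in>S'. A L j * x j)"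
        by (simp add: sum_subtractf sum_distrib_left)
      also have "\<dots> = (\<Sum>j\<in>S. A i j * y j)"
        unfolding sum_y by (simp add: y_def)
      finally show ?thesis by simp
    qed
    moreover have "\<exists>j\<in>S. y j \<noteq> 0" using x(1) yx S'(4) by auto
    ultimately show ?thesis by blast
  qed
qed

definition poly_mv :: "nat \<Rightarrow> (nat \<Rightarrow> nat \<Rightarrow> complex) \<Rightarrow> complex poly \<Rightarrow> (nat \<Rightarrow> complex) \<Rightarrow> nat \<Rightarrow> complex" where
  "poly_mv n X p w i = (\<Sum>j\<le>degree p. coeff p j * (mv n X ^^ j) w i)"

lemma poly_mv_bound:
  assumes "degree p \<le> N"
  shows "poly_mv n X p w i = (\<Sum>j\<le>N. coeff p j * (mv n X ^^ j) w i)"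
  unfolding poly_mv_def using assms
  by (intro sum.mono_neutral_left) (auto simp: coeff_eq_0)

lemma mv_diff: "mv n X (\<lambda>i. a i - z * b i) = (\<lambda>i. mv n X a i - z * mv n X b i)"
  by (rule ext) (simp add: mv_def algebra_simps sum_subtractf sum_distrib_left)

lemma mv_pow_diff:
  "(mv n X ^^ j) (\<lambda>i. mv n X w i - z * w i) = (\<lambda>i. (mv n X ^^ Suc j) w i - z * (mv n X ^^ j) w i)"
  by (induction j) (auto simp: mv_diff)

text \<open>A linear factor in \<open>X\<close> may be applied to the vector first, since
  polynomials in \<open>X\<close> commute. This lowers the degree in the search for an
  eigenvector.\<close>

lemma poly_mv_root_factor:
  "poly_mv n X ([:-z, 1:] * q) w i = poly_mv n X q (\<lambda>i. mv n X w i - z * w i) i"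
proof -
  let ?N = "degree q"
  let ?P = "\<lambda>j. (mv n X ^^ j) w i"
  have deg: "degree ([:-z, 1:] * q) \<le> Suc ?N"
    by (rule order_trans[OF degree_mult_le]) auto
  have eq: "[:-z, 1:] * q = pCons 0 q - Polynomial.smult z q" by simp
  have "poly_mv n X ([:-z, 1:] * q) w i = (\<Sum>j\<le>Suc ?N. coeff ([:-z, 1:] * q) j * ?P j)"
    by (rule poly_mv_bound[OF deg])
  also have "\<dots> = (\<Sum>j\<le>Suc ?N. coeff (pCons 0 q) j * ?P j) - (\<Sum>j\<le>Suc ?N. z * coeff q j * ?P j)"
    unfolding eq by (simp only: coeff_diff coeff_smult left_diff_distrib sum_subtractf)
  also have "(\<Sum>j\<le>Suc ?N. coeff (pCons 0 q) j * ?P j) = (\<Sum>j\<le>?N. coeff q j * ?P (Suc j))"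
    by (subst sum.atMost_Suc_shift) simp
  also have "(\<Sum>j\<le>Suc ?N. z * coeff q j * ?P j) = (\<Sum>j\<le>?N. z * coeff q j * ?P j)"
    by (simp add: coeff_eq_0)
  also have "(\<Sum>j\<le>?N. coeff q j * ?P (Suc j)) - (\<Sum>j\<le>?N. z * coeff q j * ?P j)
      = poly_mv n X q (\<lambda>i. mv n X w i - z * w i) i"
    unfolding poly_mv_def mv_pow_diff sum_subtractf[symmetric]
    by (intro sum.cong) (auto simp: algebra_simps)
  finally show ?thesis .
qed

text \<open>The vectors \<open>w, X w, ..., X^n w\<close> are linearly dependent, so \<open>p(X) w = 0\<close> for some \<open>p \<noteq> 0\<close>; splitting
  off the linear factors of \<open>p\<close> one by one, the last nonzero vector is an eigenvector.\<close>

lemma eigenvector_in_invariant_set: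
  assumes inv: "\<And>w z. W w \<Longrightarrow> W (\<lambda>i. mv n X w i - z * w i)"
    and w: "W w" "\<exists>i<n. w i \<noteq> 0"
  shows "\<exists>u z. W u \<and> (\<exists>i<n. u i \<noteq> 0) \<and> (\<forall>i<n. mv n X u i = z * u i)"
proof -
  have *: "\<exists>u z. W u \<and> (\<exists>i<n. u i \<noteq> 0) \<and> (\<forall>i<n. mv n X u i = z * u i)"
    if "p \<noteq> 0" "W w" "\<exists>i<n. w i \<noteq> 0" "\<forall>i<n. poly_mv n X p w i = 0" for p w
    using that
  proof (induction "degree p" arbitrary: p w)
    case 0
    then obtain c where c: "p = [:c:]" by (metis degree_eq_zeroE)
    with 0 show ?case by (auto simp: poly_mv_def)
  next
    case (Suc m)
    then have "\<not> constant (poly p)" by (simp add: constant_degree)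
    then obtain z where "poly p z = 0" using fundamental_theorem_of_algebra by blast
    then obtain q where q: "p = [:-z, 1:] * q" by (auto simp: poly_eq_0_iff_dvd dvd_def)
    with Suc.prems have q0: "q \<noteq> 0" by auto
    have "degree p = Suc (degree q)" unfolding q using q0 by (subst degree_mult_eq) auto
    with Suc(2) have dq: "m = degree q" by simp
    let ?u = "\<lambda>i. mv n X w i - z * w i"
    show ?case
    proof (cases "\<exists>i<n. ?u i \<noteq> 0")
      case True
      show ?thesis
        using Suc.hyps(1)[OF dq q0 inv[OF Suc.prems(2)] True] Suc.prems(4)
        unfolding q poly_mv_root_factor by blast
    next
      case False
      then have "\<forall>i<n. mv n X w i = z * w i" by auto
      with Suc.prems show ?thesis by blast
    qed
  qed
  from homogeneous_system_nontrivial[of "{..n}" n "\<lambda>i j. (mv n X ^^ j) w i"]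
  obtain a where a: "\<exists>j\<le>n. a j \<noteq> 0" "\<forall>i<n. (\<Sum>j\<le>n. (mv n X ^^ j) w i * a j) = 0" by auto
  define p where "p = Abs_poly (\<lambda>j. if j \<le> n then a j else 0)"
  have cp: "coeff p j = (if j \<le> n then a j else 0)" for j
    unfolding p_def by (subst coeff_Abs_poly[of n]) auto
  have p0: "p \<noteq> 0" using a(1) cp by (metis coeff_0)
  have "degree p \<le> n" by (rule degree_le) (auto simp: cp)
  then have "\<forall>i<n. poly_mv n X p w i = 0"
    using a(2) by (simp add: poly_mv_bound cp mult.commute)
  from *[OF p0 w this] show ?thesis .
qed

lemma ip_cnj: "cnj (ip n u v) = ip n v u"
  by (simp add: ip_def mult.commute)

lemma ip_self: "ip n u u = complex_of_real (\<Sum>i<n. (cmod (u i))\<^sup>2)"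
  unfolding ip_def of_real_sum complex_norm_square ..

lemma ip_mult_swap: "ip n u v * ip n v u = complex_of_real ((cmod (ip n u v))\<^sup>2)"
  unfolding ip_cnj[of n u v, symmetric] complex_norm_square ..

lemma ip_cong: "(\<And>i. i < n \<Longrightarrow> u i = u' i) \<Longrightarrow> (\<And>i. i < n \<Longrightarrow> v i = v' i) \<Longrightarrow> ip n u v = ip n u' v'"
  by (simp add: ip_def)

lemma ip_scale_left: "ip n (\<lambda>i. c * u i) v = c * ip n u v"
  by (simp add: ip_def sum_distrib_left mult.assoc)

lemma ip_scale_right: "ip n u (\<lambda>i. c * v i) = cnj c * ip n u v"
  by (simp add: ip_def sum_distrib_left algebra_simps)

lemma ip_diff_left: "ip n (\<lambda>i. a i - b i) v = ip n a v - ip n b v"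
  by (simp add: ip_def sum_subtractf algebra_simps)

lemma ip_sum_left: "ip n (\<lambda>i. \<Sum>k\<in>S. a k i) v = (\<Sum>k\<in>S. ip n (a k) v)"
  unfolding ip_def sum_distrib_right by (rule sum.swap)

lemma ip_mv_hermitian:
  assumes "hermitian n X"
  shows "ip n (mv n X u) v = ip n u (mv n X v)"
proof -
  have "ip n (mv n X u) v = (\<Sum>i<n. \<Sum>j<n. X i j * u j * cnj (v i))"
    by (simp add: ip_def mv_def sum_distrib_right)
  also have "\<dots> = (\<Sum>j<n. \<Sum>i<n. X i j * u j * cnj (v i))" by (rule sum.swap)
  also have "\<dots> = (\<Sum>j<n. \<Sum>i<n. u j * cnj (X j i * v i))"
  proof (intro sum.cong refl)
    fix j i assume "j \<in> {..<n}" "i \<in> {..<n}"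
    then have "X i j = cnj (X j i)" using assms unfolding hermitian_def by blast
    then show "X i j * u j * cnj (v i) = u j * cnj (X j i * v i)" by simp
  qed
  also have "\<dots> = ip n u (mv n X v)"
    by (simp add: ip_def mv_def sum_distrib_left)
  finally show ?thesis .
qed

lemma ip_self_eq_0: "ip n u u = 0 \<longleftrightarrow> (\<forall>i<n. u i = 0)"
  unfolding ip_self by (auto simp: sum_nonneg_eq_0_iff simp flip: of_real_sum)

text \<open>The orthogonal complement of the eigenvectors found so far is invariant because
  \<open>X\<close> is Hermitian, and fewer than \<open>n\<close> orthogonality conditions leave it
  nonzero. Hence it contains a further eigenvector.\<close>

lemma orthonormal_eigenvectors:
  assumes H: "hermitian n X" and "m \<le> n"
  shows "\<exists>v \<mu>. orthonormal n m v \<and> (\<forall>k<m. \<forall>i<n. mv n X (v k) i = complex_of_real (\<mu> k) * v k i)"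
  using \<open>m \<le> n\<close>
proof (induction m)
  case 0
  then show ?case by (auto simp: orthonormal_def)
next
  case (Suc m)
  then obtain v \<mu> where v: "orthonormal n m v"
    and ev: "\<And>k i. k < m \<Longrightarrow> i < n \<Longrightarrow> mv n X (v k) i = complex_of_real (\<mu> k) * v k i" by auto
  define W where "W = (\<lambda>w. \<forall>k<m. ip n w (v k) = 0)"
  from homogeneous_system_nontrivial[of "{..<n}" m "\<lambda>k j. cnj (v k j)"] Suc.prems
  obtain w where w: "\<exists>j<n. w j \<noteq> 0" "\<forall>k<m. (\<Sum>j<n. cnj (v k j) * w j) = 0" by auto
  have "W w" using w(2) by (simp add: W_def ip_def mult.commute)
  have inv: "W (\<lambda>i. mv n X w i - z * w i)" if "W w" for w z
    unfolding W_def
  proof (intro allI impI)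
    fix k assume k: "k < m"
    have "ip n (\<lambda>i. mv n X w i - z * w i) (v k) = ip n w (mv n X (v k)) - z * ip n w (v k)"
      by (simp add: ip_diff_left ip_scale_left ip_mv_hermitian[OF H])
    also have "ip n w (mv n X (v k)) = ip n w (\<lambda>i. complex_of_real (\<mu> k) * v k i)"
      using ev[OF k] by (intro ip_cong) auto
    also have "\<dots> - z * ip n w (v k) = 0" using that k by (simp add: ip_scale_right W_def)
    finally show "ip n (\<lambda>i. mv n X w i - z * w i) (v k) = 0" .
  qed
  from eigenvector_in_invariant_set[of W n X w, OF inv \<open>W w\<close> w(1)] obtain u z where
    u: "W u" "\<exists>i<n. u i \<noteq> 0" "\<And>i. i < n \<Longrightarrow> mv n X u i = z * u i" by auto
  define r where "r = (\<Sum>i<n. (cmod (u i))\<^sup>2)"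
  have uu: "ip n u u = complex_of_real r" by (simp add: ip_self r_def)
  have "r \<noteq> 0" using u(2) uu ip_self_eq_0[of n u] by auto
  moreover have "r \<ge> 0" by (simp add: r_def sum_nonneg)
  ultimately have r: "r > 0" by simp
  \<comment> \<open>Moving \<open>X\<close> across the inner product gives \<open>z = cnj z\<close>,
    so the eigenvalue is real.\<close>
  have "z * ip n u u = ip n (mv n X u) u"
    using u(3) by (simp add: ip_scale_left[symmetric] cong: ip_cong)
  also have "\<dots> = ip n u (mv n X u)" by (rule ip_mv_hermitian[OF H])
  also have "\<dots> = cnj z * ip n u u"
    using u(3) by (simp add: ip_scale_right[symmetric] cong: ip_cong)
  finally have "z = cnj z" using uu r by simp
  then have z: "z = complex_of_real (Re z)" by (simp add: complex_eq_iff)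
  define u' where "u' = (\<lambda>i. complex_of_real (1 / sqrt r) * u i)"
  have "ip n u' u' = complex_of_real (1 / sqrt r * (1 / sqrt r) * r)"
    unfolding u'_def ip_scale_left ip_scale_right uu of_real_mult complex_cnj_complex_of_real by (simp only: mult.assoc)
  also have "1 / sqrt r * (1 / sqrt r) * r = 1" using r by simp
  finally have u'1: "ip n u' u' = 1" by simp
  have u'0: "ip n u' (v k) = 0" if "k < m" for k
    using u(1) that unfolding u'_def ip_scale_left W_def by simp
  then have u'0': "ip n (v k) u' = 0" if "k < m" for k
    using that by (metis ip_cnj complex_cnj_zero)
  have ev': "mv n X u' i = complex_of_real (Re z) * u' i" if "i < n" for i
  proof -
    have "mv n X u' i = complex_of_real (1 / sqrt r) * mv n X u i"
      by (simp add: mv_def u'_def sum_distrib_left algebra_simps)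
    then show ?thesis using u(3)[OF that] z by (simp add: u'_def)
  qed
  show ?case
  proof (intro exI[of _ "v(m := u')"] exI[of _ "\<mu>(m := Re z)"] conjI)
    show "orthonormal n (Suc m) (v(m := u'))"
      using v u'0 u'0' u'1 unfolding orthonormal_def by (auto simp: less_Suc_eq)
  qed (use ev ev' in \<open>auto simp: less_Suc_eq\<close>)
qed

text \<open>A one-sided inverse of a square matrix is two-sided: orthonormality says
  \<open>A * B = 1\<close>, and completeness is an entry of \<open>B * A = 1\<close>.\<close>

lemma orthonormal_complete:
  assumes "orthonormal n n v" "i < n" "j < n"
  shows "(\<Sum>k<n. v k i * cnj (v k j)) = (if i = j then 1 else 0)"
proof -
  define A where "A = mat n n (\<lambda>(k, i). v k i)"
  define B where "B = mat n n (\<lambda>(i, k). cnj (v k i))"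
  have A: "A \<in> carrier_mat n n" and B: "B \<in> carrier_mat n n" by (auto simp: A_def B_def)
  have "A * B = 1\<^sub>m n"
    using assms(1) by (intro eq_matI)
      (auto simp: A_def B_def orthonormal_def ip_def scalar_prod_def lessThan_atLeast0)
  with A B have BA: "B * A = 1\<^sub>m n" by (metis mat_mult_left_right_inverse)
  have "(\<Sum>k<n. v k i * cnj (v k j)) = (B * A) $$ (j, i)"
    using assms by (simp add: A_def B_def scalar_prod_def lessThan_atLeast0 mult.commute)
  also have "\<dots> = (if i = j then 1 else 0)" using assms by (simp add: BA)
  finally show ?thesis .
qed

lemma orthonormal_expand:
  assumes "orthonormal n n v" "i < n"
  shows "(\<Sum>k<n. ip n f (v k) * v k i) = f i"
proof -
  have "(\<Sum>k<n. ip n f (v k) * v k i) = (\<Sum>k<n. \<Sum>j<n. f j * (v k i * cnj (v k j)))"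
    by (simp add: ip_def sum_distrib_right sum_distrib_left algebra_simps)
  also have "\<dots> = (\<Sum>j<n. f j * (\<Sum>k<n. v k i * cnj (v k j)))"
    unfolding sum_distrib_left by (rule sum.swap)
  also have "\<dots> = (\<Sum>j<n. f j * (if i = j then 1 else 0))"
    using assms by (intro sum.cong) (auto simp: orthonormal_complete)
  also have "\<dots> = (\<Sum>j<n. if j = i then f j else 0)" by (intro sum.cong) auto
  also have "\<dots> = f i" using assms(2) by simp
  finally show ?thesis .
qed

lemma parseval:
  assumes "orthonormal n n v"
  shows "(\<Sum>k<n. (cmod (ip n f (v k)))\<^sup>2) = (\<Sum>i<n. (cmod (f i))\<^sup>2)"
proof -
  have "complex_of_real (\<Sum>k<n. (cmod (ip n f (v k)))\<^sup>2) = (\<Sum>k<n. ip n f (v k) * ip n (v k) f)"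
    by (simp only: ip_mult_swap of_real_sum)
  also have "\<dots> = ip n (\<lambda>i. \<Sum>k<n. ip n f (v k) * v k i) f"
    by (simp add: ip_sum_left ip_scale_left)
  also have "\<dots> = ip n f f" by (intro ip_cong) (auto simp: orthonormal_expand[OF assms])
  finally show ?thesis unfolding ip_self by (simp only: of_real_eq_iff)
qed

definition eigensystem ::
    "nat \<Rightarrow> (nat \<Rightarrow> nat \<Rightarrow> complex) \<Rightarrow> (nat \<Rightarrow> nat \<Rightarrow> complex) \<Rightarrow> (nat \<Rightarrow> real) \<Rightarrow> bool" where
  "eigensystem n X v \<mu> \<longleftrightarrow> orthonormal n n v \<and>
     (\<forall>k<n. \<forall>i<n. mv n X (v k) i = complex_of_real (\<mu> k) * v k i) \<and>
     (\<forall>i<n. \<forall>j<n. X i j = (\<Sum>k<n. complex_of_real (\<mu> k) * v k i * cnj (v k j)))"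

lemma eigensystemD:
  assumes "eigensystem n X v \<mu>"
  shows "orthonormal n n v"
    and "k < n \<Longrightarrow> i < n \<Longrightarrow> mv n X (v k) i = complex_of_real (\<mu> k) * v k i"
    and "i < n \<Longrightarrow> j < n \<Longrightarrow> X i j = (\<Sum>k<n. complex_of_real (\<mu> k) * v k i * cnj (v k j))"
  using assms by (simp_all only: eigensystem_def)

text \<open>Apply \<open>X\<close> to the completeness relation of an orthonormal
  eigenbasis.\<close>

theorem spectral_decomposition:
  assumes "hermitian n X"
  shows "\<exists>v \<mu>. eigensystem n X v \<mu>"
proof -
  from orthonormal_eigenvectors[OF assms order_refl] obtain v \<mu> where v: "orthonormal n n v"
    and ev: "\<And>k i. k < n \<Longrightarrow> i < n \<Longrightarrow> mv n X (v k) i = complex_of_real (\<mu> k) * v k i" by blast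
  have "X i j = (\<Sum>k<n. complex_of_real (\<mu> k) * v k i * cnj (v k j))" if "i < n" "j < n" for i j
  proof -
    have "(\<Sum>k<n. complex_of_real (\<mu> k) * v k i * cnj (v k j)) = (\<Sum>k<n. mv n X (v k) i * cnj (v k j))"
      using that by (simp add: ev)
    also have "\<dots> = (\<Sum>l<n. X i l * (\<Sum>k<n. v k l * cnj (v k j)))"
      unfolding mv_def sum_distrib_left sum_distrib_right mult.assoc by (rule sum.swap)
    also have "\<dots> = (\<Sum>l<n. X i l * (if l = j then 1 else 0))"
      using that by (intro sum.cong) (auto simp: orthonormal_complete[OF v])
    also have "\<dots> = (\<Sum>l<n. if l = j then X i l else 0)" by (intro sum.cong) auto
    also have "\<dots> = X i j" using that by simp
    finally show ?thesis by simp
  qed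
  with v ev show ?thesis unfolding eigensystem_def by blast
qed

section \<open>Positive square roots and the trace norm of Hermitian matrices\<close>

definition psdf :: "nat \<Rightarrow> (nat \<Rightarrow> nat \<Rightarrow> complex) \<Rightarrow> bool" where
  "psdf n B \<longleftrightarrow> (\<forall>f. Im (ip n (mv n B f) f) = 0 \<and> Re (ip n (mv n B f) f) \<ge> 0)"

lemma psd_iff_psdf: "psd n A \<longleftrightarrow> A \<in> carrier_mat n n \<and> psdf n (\<lambda>i j. A $$ (i, j))"
proof -
  have eq: "(A *\<^sub>v v) \<bullet>c v = ip n (mv n (\<lambda>i j. A $$ (i, j)) (\<lambda>i. v $ i)) (\<lambda>i. v $ i)"
    if "A \<in> carrier_mat n n" "v \<in> carrier_vec n" for v
    using that by (auto simp: ip_def mv_def scalar_prod_def lessThan_atLeast0 intro!: sum.cong)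
  have vec: "ip n (mv n (\<lambda>i j. A $$ (i, j)) f) f =
      ip n (mv n (\<lambda>i j. A $$ (i, j)) (\<lambda>i. vec n f $ i)) (\<lambda>i. vec n f $ i)" for f
    by (intro ip_cong) (auto simp: mv_def)
  show ?thesis
  proof (intro iffI conjI)
    assume A: "psd n A"
    then show Ac: "A \<in> carrier_mat n n" by (simp add: psd_def)
    show "psdf n (\<lambda>i j. A $$ (i, j))"
      unfolding psdf_def
    proof
      fix f
      show "Im (ip n (mv n (\<lambda>i j. A $$ (i, j)) f) f) = 0 \<and> Re (ip n (mv n (\<lambda>i j. A $$ (i, j)) f) f) \<ge> 0"
        using A unfolding psd_def vec[of f] eq[OF Ac vec_carrier[of n f], symmetric] by simp
    qed
  next
    assume A: "A \<in> carrier_mat n n \<and> psdf n (\<lambda>i j. A $$ (i, j))"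
    then show "psd n A" using eq by (simp add: psd_def psdf_def)
  qed
qed

text \<open>Polarisation: the quadratic form at \<open>e i + z * e j\<close> is real for
  \<open>z = 1\<close> and for \<open>z = \<i>\<close>, which makes the imaginary and the real part
  of \<open>B i j - cnj (B j i)\<close> vanish.\<close>

lemma psdf_hermitian:
  assumes "psdf n B"
  shows "hermitian n B"
  unfolding hermitian_def
proof (intro allI impI)
  fix i j assume ij: "i < n" "j < n"
  have im: "Im (ip n (mv n B f) f) = 0" for f using assms by (simp add: psdf_def)
  define e where "e = (\<lambda>(k::nat) l. if k = l then 1 else (0::complex))"
  have one: "Im (B k k) = 0" if "k < n" for k
  proof -
    have "ip n (mv n B (e k)) (e k) = B k k"
      using that by (simp add: ip_def mv_def e_def if_distrib cong: if_cong)
    then show ?thesis using im[of "e k"] by simp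
  qed
  have two: "ip n (mv n B (\<lambda>l. e i l + z * e j l)) (\<lambda>l. e i l + z * e j l)
     = B i i + z * cnj z * B j j + z * B i j + cnj z * B j i" for z
  proof -
    have "mv n B (\<lambda>l. e i l + z * e j l) = (\<lambda>l. B l i + z * B l j)"
      using ij by (simp add: mv_def e_def fun_eq_iff ring_distribs sum.distrib mult_delta_right mult.left_commute[of _ z]
          flip: sum_distrib_left)
    then show ?thesis
      using ij by (simp add: ip_def e_def ring_distribs sum.distrib mult_delta_right mult.left_commute[of _ "cnj z"]
          if_distrib[of cnj] flip: sum_distrib_left cong: if_cong)
  qed
  have "Im (B i i + z * cnj z * B j j + z * B i j + cnj z * B j i) = 0" for z
    using im[of "\<lambda>l. e i l + z * e j l"] unfolding two .
  from this[of 1] this[of \<i>] one[OF ij(1)] one[OF ij(2)] show "B i j = cnj (B j i)"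
    by (simp add: complex_eq_iff)
qed

text \<open>Needed because \<open>psd_sqrt\<close> is a definite description. On an eigenvector of
  \<open>B\<close> with eigenvalue \<open>\<mu> k\<close>, the product
  \<open>(C + \<mu> k) (C - \<mu> k)\<close> vanishes, and positivity of \<open>C\<close> leaves
  only the second factor. So \<open>C\<close> agrees with \<open>B\<close> on an orthonormal
  basis.\<close>

lemma psdf_sqrt_unique:
  assumes B: "psdf n B" and C: "psdf n C"
    and eq: "\<And>f i. i < n \<Longrightarrow> mv n B (mv n B f) i = mv n C (mv n C f) i"
    and ij: "i < n" "j < n"
  shows "B i j = C i j"
proof -
  note HC = psdf_hermitian[OF C]
  obtain v \<mu> where es: "eigensystem n B v \<mu>"
    using spectral_decomposition[OF psdf_hermitian[OF B]] by blast
  note v = eigensystemD(1)[OF es] and ev = eigensystemD(2)[OF es] and Bv = eigensystemD(3)[OF es]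
  have mu: "\<mu> k \<ge> 0" if k: "k < n" for k
  proof -
    have "ip n (mv n B (v k)) (v k) = complex_of_real (\<mu> k) * ip n (v k) (v k)"
      using ev[OF k] by (simp add: ip_scale_left[symmetric] cong: ip_cong)
    also have "\<dots> = complex_of_real (\<mu> k)" using v k by (simp add: orthonormal_def)
    finally show ?thesis using B unfolding psdf_def by (metis Re_complex_of_real)
  qed
  have mv_cong: "mv n D f i = mv n D g i" if "\<And>j. j < n \<Longrightarrow> f j = g j" for D f g i
    using that by (simp add: mv_def)
  have mv_scale: "mv n D (\<lambda>j. c * f j) i = c * mv n D f i" for D c f i
    by (simp add: mv_def sum_distrib_left algebra_simps)
  have Cv: "mv n C (v k) i = complex_of_real (\<mu> k) * v k i" if k: "k < n" and i: "i < n" for k i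
  proof -
    let ?m = "complex_of_real (\<mu> k)"
    have CC: "mv n C (mv n C (v k)) i = ?m * (?m * v k i)" if "i < n" for i
    proof -
      have "mv n B (mv n B (v k)) i = mv n B (\<lambda>j. ?m * v k j) i"
        by (rule mv_cong) (simp add: ev k)
      with eq[OF that, of "v k"] show ?thesis by (simp add: mv_scale ev k that)
    qed
    define u where "u = (\<lambda>i. mv n C (v k) i - ?m * v k i)"
    show ?thesis
    proof (cases "\<mu> k = 0")
      case True
      \<comment> \<open>For eigenvalue 0 the squared norm of \<open>C v\<close> is the form of the
        square of \<open>C\<close> at \<open>v\<close>, hence 0.\<close>
      have "ip n (mv n C (v k)) (mv n C (v k)) = ip n (v k) (mv n C (mv n C (v k)))"
        by (rule ip_mv_hermitian[OF HC])
      also have "\<dots> = 0" using CC True by (simp add: ip_def)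
      finally show ?thesis using i True ip_self_eq_0 by fastforce
    next
      case False
      with mu[OF k] have m: "\<mu> k > 0" by simp
      \<comment> \<open>If nonzero, \<open>u\<close> would be an eigenvector of the positive
        \<open>C\<close> for the negative value \<open>- \<mu> k\<close>.\<close>
      have "mv n C u i = - ?m * u i" if "i < n" for i
        unfolding u_def mv_diff using CC[OF that] by (simp add: algebra_simps)
      then have "ip n (mv n C u) u = - ?m * ip n u u"
        by (simp add: ip_scale_left[symmetric] cong: ip_cong)
      also have "\<dots> = complex_of_real (- \<mu> k * (\<Sum>i<n. (cmod (u i))\<^sup>2))"
        by (simp add: ip_self)
      finally have "Re (ip n (mv n C u) u) = - \<mu> k * (\<Sum>i<n. (cmod (u i))\<^sup>2)" by simp
      moreover have "Re (ip n (mv n C u) u) \<ge> 0" using C by (simp add: psdf_def)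
      ultimately have "\<mu> k * (\<Sum>i<n. (cmod (u i))\<^sup>2) \<le> 0" by simp
      then have "(\<Sum>i<n. (cmod (u i))\<^sup>2) \<le> 0" using m by (simp add: mult_le_0_iff)
      then have "(\<Sum>i<n. (cmod (u i))\<^sup>2) = 0" by (meson antisym sum_nonneg zero_le_power2)
      then have "ip n u u = 0" by (simp add: ip_self)
      then have "u i = 0" using i ip_self_eq_0 by blast
      then show ?thesis by (simp add: u_def)
    qed
  qed
  have "B i j = (\<Sum>k<n. mv n C (v k) i * cnj (v k j))"
    using Bv[OF ij] Cv ij by simp
  also have "\<dots> = (\<Sum>l<n. C i l * (\<Sum>k<n. v k l * cnj (v k j)))"
    unfolding mv_def sum_distrib_left sum_distrib_right mult.assoc by (rule sum.swap)
  also have "\<dots> = (\<Sum>l<n. C i l * (if l = j then 1 else 0))"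
    using ij by (intro sum.cong) (auto simp: orthonormal_complete[OF v])
  also have "\<dots> = (\<Sum>l<n. if l = j then C i l else 0)" by (intro sum.cong) auto
  also have "\<dots> = C i j" using ij by simp
  finally show ?thesis .
qed

lemma psdf_sum_rank_one:
  assumes "\<And>k. k \<in> S \<Longrightarrow> c k \<ge> 0"
    and B: "\<And>i j. i < n \<Longrightarrow> j < n \<Longrightarrow> B i j = (\<Sum>k\<in>S. complex_of_real (c k) * v k i * cnj (v k j))"
  shows "psdf n B"
  unfolding psdf_def
proof (intro allI)
  fix f
  have "mv n B f i = (\<Sum>k\<in>S. complex_of_real (c k) * ip n f (v k) * v k i)" if "i < n" for i
  proof -
    have "mv n B f i = (\<Sum>j<n. \<Sum>k\<in>S. complex_of_real (c k) * v k i * cnj (v k j) * f j)"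
      unfolding mv_def using B that by (simp add: sum_distrib_right)
    also have "\<dots> = (\<Sum>k\<in>S. \<Sum>j<n. complex_of_real (c k) * v k i * cnj (v k j) * f j)" by (rule sum.swap)
    finally show ?thesis by (simp add: ip_def sum_distrib_left sum_distrib_right algebra_simps)
  qed
  then have "ip n (mv n B f) f = ip n (\<lambda>i. \<Sum>k\<in>S. complex_of_real (c k) * ip n f (v k) * v k i) f"
    by (intro ip_cong) auto
  also have "\<dots> = (\<Sum>k\<in>S. complex_of_real (c k) * (ip n f (v k) * ip n (v k) f))"
    by (simp add: ip_sum_left ip_scale_left mult.assoc)
  also have "\<dots> = complex_of_real (\<Sum>k\<in>S. c k * (cmod (ip n f (v k)))\<^sup>2)"
    by (simp only: ip_mult_swap of_real_sum of_real_mult)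
  finally have eq: "ip n (mv n B f) f = complex_of_real (\<Sum>k\<in>S. c k * (cmod (ip n f (v k)))\<^sup>2)" .
  have "(\<Sum>k\<in>S. c k * (cmod (ip n f (v k)))\<^sup>2) \<ge> 0"
    using assms(1) by (intro sum_nonneg mult_nonneg_nonneg) auto
  then show "Im (ip n (mv n B f) f) = 0 \<and> Re (ip n (mv n B f) f) \<ge> 0"
    unfolding eq by simp
qed

lemma mat_mult_entries:
  assumes "A \<in> carrier_mat n m" "B \<in> carrier_mat m l" "i < n" "j < l"
  shows "(A * B) $$ (i, j) = (\<Sum>k<m. A $$ (i, k) * B $$ (k, j))"
  using assms by (auto simp: scalar_prod_def lessThan_atLeast0)

text \<open>Replacing each \<open>\<mu> k\<close> by its modulus gives a positive matrix with the
  same square as \<open>X\<close>. Uniqueness identifies it with the root in the definition, and its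
  trace is the sum of the moduli.\<close>

theorem trace_norm_hermitian:
  assumes X: "X \<in> carrier_mat n n" and v: "orthonormal n n v"
    and Xv: "\<And>i j. i < n \<Longrightarrow> j < n \<Longrightarrow> X $$ (i, j) = (\<Sum>k<n. complex_of_real (\<mu> k) * v k i * cnj (v k j))"
  shows "trace_norm X = (\<Sum>k<n. \<bar>\<mu> k\<bar>)"
proof -
  define B where "B = mat n n (\<lambda>(i, j). \<Sum>k<n. complex_of_real \<bar>\<mu> k\<bar> * v k i * cnj (v k j))"
  have Bc: "B \<in> carrier_mat n n" by (simp add: B_def)
  have Bij: "B $$ (i, j) = (\<Sum>k<n. complex_of_real \<bar>\<mu> k\<bar> * v k i * cnj (v k j))" if "i < n" "j < n" for i j
    using that by (simp add: B_def)
  \<comment> \<open>The coefficients \<open>a\<close> are arbitrary because the squares of both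
    \<open>X\<close> and \<open>B\<close> are computed this way.\<close>
  have sq: "(\<Sum>l<n. (\<Sum>k<n. complex_of_real (a k) * v k i * cnj (v k l)) *
       (\<Sum>k<n. complex_of_real (a k) * v k l * cnj (v k j))) =
      (\<Sum>k<n. complex_of_real ((a k)\<^sup>2) * v k i * cnj (v k j))" (is "?L = ?R") for a i j
  proof -
    have "?L = (\<Sum>l<n. \<Sum>k<n. \<Sum>k'<n. complex_of_real (a k) * v k i * cnj (v k l) *
        (complex_of_real (a k') * v k' l * cnj (v k' j)))"
      by (simp only: sum_product)
    also have "\<dots> = (\<Sum>k<n. \<Sum>l<n. \<Sum>k'<n. complex_of_real (a k) * v k i * cnj (v k l) *
        (complex_of_real (a k') * v k' l * cnj (v k' j)))" by (rule sum.swap)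
    also have "\<dots> = (\<Sum>k<n. \<Sum>k'<n. \<Sum>l<n. complex_of_real (a k) * v k i * cnj (v k l) *
        (complex_of_real (a k') * v k' l * cnj (v k' j)))" by (intro sum.cong refl sum.swap)
    also have "\<dots> = (\<Sum>k<n. \<Sum>k'<n. complex_of_real (a k) * complex_of_real (a k') * v k i * cnj (v k' j) *
        ip n (v k') (v k))"
      by (simp add: ip_def sum_distrib_left algebra_simps)
    also have "\<dots> = (\<Sum>k<n. \<Sum>k'<n. if k' = k then complex_of_real (a k) * complex_of_real (a k') * v k i * cnj (v k' j) else 0)"
      using v by (intro sum.cong) (auto simp: orthonormal_def)
    also have "\<dots> = ?R" by (simp add: power2_eq_square)
    finally show ?thesis .
  qed
  have herm: "dagger X = X"
    using X Xv by (intro eq_matI) (auto simp: dagger_def algebra_simps)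
  have XX: "dagger X * X = B * B"
  proof (rule eq_matI)
    fix i j assume "i < dim_row (B * B)" "j < dim_col (B * B)"
    then have ij: "i < n" "j < n" using Bc by auto
    have "(X * X) $$ (i, j) = (\<Sum>k<n. complex_of_real ((\<mu> k)\<^sup>2) * v k i * cnj (v k j))"
      unfolding mat_mult_entries[OF X X ij] sq[symmetric] using ij by (simp add: Xv)
    also have "\<dots> = (\<Sum>k<n. complex_of_real (\<bar>\<mu> k\<bar>\<^sup>2) * v k i * cnj (v k j))" by simp
    also have "\<dots> = (B * B) $$ (i, j)"
      unfolding mat_mult_entries[OF Bc Bc ij] sq[symmetric] using ij by (simp add: Bij)
    finally show "(dagger X * X) $$ (i, j) = (B * B) $$ (i, j)" by (simp add: herm)
  qed (use X Bc herm in auto)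
  have psdB: "psd n B"
    unfolding psd_iff_psdf using Bc psdf_sum_rank_one[of "{..<n}" "\<lambda>k. \<bar>\<mu> k\<bar>" n "\<lambda>i j. B $$ (i, j)" v] Bij
    by auto
  have mvmv: "mv n (\<lambda>i j. A $$ (i, j)) (mv n (\<lambda>i j. A $$ (i, j)) f) i = mv n (\<lambda>i j. (A * A) $$ (i, j)) f i"
    if "A \<in> carrier_mat n n" "i < n" for A f i
  proof -
    have "mv n (\<lambda>i j. (A * A) $$ (i, j)) f i = (\<Sum>j<n. (\<Sum>k<n. A $$ (i, k) * A $$ (k, j)) * f j)"
      unfolding mv_def by (intro sum.cong refl) (simp only: mat_mult_entries[OF that(1,1) that(2)] lessThan_iff)
    also have "\<dots> = (\<Sum>k<n. A $$ (i, k) * (\<Sum>j<n. A $$ (k, j) * f j))"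
      unfolding sum_distrib_left sum_distrib_right mult.assoc by (rule sum.swap)
    finally show ?thesis by (simp add: mv_def)
  qed
  have "psd_sqrt (dagger X * X) = B"
    unfolding psd_sqrt_def
  proof (rule the_equality)
    show "psd (dim_row (dagger X * X)) B \<and> B * B = dagger X * X"
      using psdB XX Bc by simp
  next
    fix C assume C: "psd (dim_row (dagger X * X)) C \<and> C * C = dagger X * X"
    then have psdC: "psd n C" using XX Bc by simp
    then have Cc: "C \<in> carrier_mat n n" by (simp add: psd_def)
    have "C * C = B * B" using C XX by simp
    then have "C $$ (i, j) = B $$ (i, j)" if "i < n" "j < n" for i j
      using psdC psdB that mvmv[OF Cc] mvmv[OF Bc]
      by (intro psdf_sqrt_unique[of n "\<lambda>i j. C $$ (i, j)" "\<lambda>i j. B $$ (i, j)"]) (auto simp: psd_iff_psdf)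
    then show "C = B" using Cc Bc by (intro eq_matI) auto
  qed
  then have "trace_norm X = Re (\<Sum>i<n. B $$ (i, i))"
    using Bc by (simp add: trace_norm_def mtrace_def)
  also have "(\<Sum>i<n. B $$ (i, i)) = (\<Sum>i<n. \<Sum>k<n. complex_of_real \<bar>\<mu> k\<bar> * (v k i * cnj (v k i)))"
    by (simp add: Bij mult.assoc)
  also have "\<dots> = (\<Sum>k<n. \<Sum>i<n. complex_of_real \<bar>\<mu> k\<bar> * (v k i * cnj (v k i)))" by (rule sum.swap)
  also have "\<dots> = (\<Sum>k<n. complex_of_real \<bar>\<mu> k\<bar> * ip n (v k) (v k))"
    by (simp add: ip_def sum_distrib_left)
  also have "\<dots> = complex_of_real (\<Sum>k<n. \<bar>\<mu> k\<bar>)"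
    using v by (simp add: orthonormal_def)
  finally show ?thesis by simp
qed

lemma trace_norm_spectral:
  assumes "X \<in> carrier_mat n n" "hermitian n (\<lambda>i j. X $$ (i, j))"
  shows "\<exists>v \<mu>. eigensystem n (\<lambda>i j. X $$ (i, j)) v \<mu> \<and> trace_norm X = (\<Sum>k<n. \<bar>\<mu> k\<bar>)"
proof -
  obtain v \<mu> where es: "eigensystem n (\<lambda>i j. X $$ (i, j)) v \<mu>"
    using spectral_decomposition[OF assms(2)] by blast
  with trace_norm_hermitian[OF assms(1) eigensystemD(1)[OF es] eigensystemD(3)[OF es]]
  show ?thesis by blast
qed

lemma trace_norm_nonneg:
  assumes "X \<in> carrier_mat n n" "hermitian n (\<lambda>i j. X $$ (i, j))"
  shows "trace_norm X \<ge> 0"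
  using trace_norm_spectral[OF assms] by (auto simp: sum_nonneg)

text \<open>A triangle inequality for rank-one terms: each eigenvalue is the diagonal value of
  \<open>X\<close> at its eigenvector, expanded over the terms, and Parseval's identity sums the
  overlaps to squared norms.\<close>

lemma trace_norm_sum_rank_one_le:
  assumes X: "X \<in> carrier_mat n n"
    and Xw: "\<And>i j. i < n \<Longrightarrow> j < n \<Longrightarrow> X $$ (i, j) = (\<Sum>s\<in>S. complex_of_real (c s) * w s i * cnj (w s j))"
  shows "trace_norm X \<le> (\<Sum>s\<in>S. \<bar>c s\<bar> * (\<Sum>i<n. (cmod (w s i))\<^sup>2))"
proof -
  have H: "hermitian n (\<lambda>i j. X $$ (i, j))"
    unfolding hermitian_def by (auto simp: Xw algebra_simps)
  obtain v \<mu> where es: "eigensystem n (\<lambda>i j. X $$ (i, j)) v \<mu>"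
    and tn: "trace_norm X = (\<Sum>k<n. \<bar>\<mu> k\<bar>)"
    using trace_norm_spectral[OF X H] by blast
  note v = eigensystemD(1)[OF es] and ev = eigensystemD(2)[OF es]
  have mu: "\<mu> k = (\<Sum>s\<in>S. c s * (cmod (ip n (w s) (v k)))\<^sup>2)" if k: "k < n" for k
  proof -
    have m: "mv n (\<lambda>i j. X $$ (i, j)) (v k) i = (\<Sum>s\<in>S. complex_of_real (c s) * ip n (v k) (w s) * w s i)"
      if i: "i < n" for i
    proof -
      have "mv n (\<lambda>i j. X $$ (i, j)) (v k) i =
          (\<Sum>j<n. \<Sum>s\<in>S. complex_of_real (c s) * w s i * cnj (w s j) * v k j)"
        using i by (simp add: mv_def Xw sum_distrib_right)
      also have "\<dots> = (\<Sum>s\<in>S. \<Sum>j<n. complex_of_real (c s) * w s i * cnj (w s j) * v k j)"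
        by (rule sum.swap)
      finally show ?thesis
        by (simp add: ip_def sum_distrib_left sum_distrib_right algebra_simps)
    qed
    have "complex_of_real (\<mu> k) = complex_of_real (\<mu> k) * ip n (v k) (v k)"
      using v k by (simp add: orthonormal_def)
    also have "\<dots> = ip n (mv n (\<lambda>i j. X $$ (i, j)) (v k)) (v k)"
      using ev[OF k] by (simp add: ip_scale_left[symmetric] cong: ip_cong)
    also have "\<dots> = ip n (\<lambda>i. \<Sum>s\<in>S. complex_of_real (c s) * ip n (v k) (w s) * w s i) (v k)"
      using m by (intro ip_cong) auto
    also have "\<dots> = (\<Sum>s\<in>S. complex_of_real (c s) * (ip n (w s) (v k) * ip n (v k) (w s)))"
      by (simp add: ip_sum_left ip_scale_left mult.assoc) (simp only: mult.commute)
    also have "\<dots> = complex_of_real (\<Sum>s\<in>S. c s * (cmod (ip n (w s) (v k)))\<^sup>2)"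
      by (simp only: ip_mult_swap of_real_sum of_real_mult)
    finally show ?thesis by (simp only: of_real_eq_iff)
  qed
  have "trace_norm X \<le> (\<Sum>k<n. \<Sum>s\<in>S. \<bar>c s\<bar> * (cmod (ip n (w s) (v k)))\<^sup>2)"
    unfolding tn by (intro sum_mono) (simp add: mu order_trans[OF sum_abs] abs_mult)
  also have "\<dots> = (\<Sum>s\<in>S. \<bar>c s\<bar> * (\<Sum>k<n. (cmod (ip n (w s) (v k)))\<^sup>2))"
    unfolding sum_distrib_left by (rule sum.swap)
  also have "\<dots> = (\<Sum>s\<in>S. \<bar>c s\<bar> * (\<Sum>i<n. (cmod (w s i))\<^sup>2))"
    by (simp add: parseval[OF v])
  finally show ?thesis .
qed

section \<open>Flat vectors and one-site marginals\<close>

text \<open>A uniformly coherent vector of size \<open>k\<close> is a flat vector of weight \<open>k\<close>, divided by \<open>sqrt k\<close>.\<close>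

definition wt :: "nat \<Rightarrow> (nat \<Rightarrow> complex) \<Rightarrow> nat" where
  "wt n u = card {i. i < n \<and> u i \<noteq> 0}"

definition flat :: "nat \<Rightarrow> (nat \<Rightarrow> complex) \<Rightarrow> bool" where
  "flat n u \<longleftrightarrow> (\<forall>i<n. u i = 0 \<or> cmod (u i) = 1)"

lemma wt_sum_of_bool: "real (wt n u) = (\<Sum>i<n. of_bool (u i \<noteq> 0))"
proof -
  have "{i. i < n \<and> u i \<noteq> 0} = {..<n} \<inter> {i. u i \<noteq> 0}" by auto
  then show ?thesis by (simp add: wt_def of_bool_def sum.If_cases)
qed

lemma flat_norm_sum:
  assumes "flat n u"
  shows "(\<Sum>i<n. (cmod (u i))\<^sup>2) = real (wt n u)"
  unfolding wt_sum_of_bool using assms by (intro sum.cong) (auto simp: flat_def)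

lemma sum_lessThan_mult:
  fixes f :: "nat \<Rightarrow> 'a::comm_monoid_add"
  shows "(\<Sum>x<m * d. f x) = (\<Sum>y<m. \<Sum>a<d. f (y * d + a))"
proof (induction m)
  case (Suc m)
  have "(\<Sum>x<k + e. f x) = (\<Sum>x<k. f x) + (\<Sum>a<e. f (k + a))" for k e
    by (induction e) (simp_all add: add.assoc)
  from this[of "m * d" d] Suc show ?case by (simp add: add.commute)
qed simp

lemma sum_lessThan_power_Suc:
  fixes f :: "nat \<Rightarrow> 'a::comm_monoid_add"
  shows "(\<Sum>x<d ^ Suc n. f x) = (\<Sum>y<d ^ n. \<Sum>a<d. f (y * d + a))"
  unfolding power_Suc2 by (rule sum_lessThan_mult)

lemma mult_add_less_power_Suc: "y < d ^ n \<Longrightarrow> a < d \<Longrightarrow> y * d + a < d ^ Suc (n::nat)" for d :: nat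
proof -
  assume *: "y < d ^ n" "a < d"
  then have "y * d + a < (y + 1) * d" by simp
  also have "\<dots> \<le> d ^ n * d" using * by (intro mult_right_mono) auto
  finally show ?thesis by (simp add: mult.commute)
qed

text \<open>Sum over the sites of the partial trace of \<open>X\<close> onto that site; the last site is the least significant
  digit, in base \<open>d\<close>, of an index.\<close>

fun marg :: "nat \<Rightarrow> nat \<Rightarrow> (nat \<Rightarrow> nat \<Rightarrow> complex) \<Rightarrow> nat \<Rightarrow> nat \<Rightarrow> complex" where
  "marg d 0 X a b = 0"
| "marg d (Suc n) X a b = (\<Sum>y<d ^ n. X (y * d + a) (y * d + b)) +
     marg d n (\<lambda>y z. \<Sum>c<d. X (y * d + c) (z * d + c)) a b"

lemma marg_cong:
  assumes "\<And>x y. x < d ^ n \<Longrightarrow> y < d ^ n \<Longrightarrow> X x y = Y x y" "a < d" "b < d"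
  shows "marg d n X a b = marg d n Y a b"
  using assms(1)
proof (induction n arbitrary: X Y)
  case (Suc n)
  have "(\<Sum>c<d. X (y * d + c) (z * d + c)) = (\<Sum>c<d. Y (y * d + c) (z * d + c))"
    if "y < d ^ n" "z < d ^ n" for y z
    using that by (intro sum.cong refl Suc.prems mult_add_less_power_Suc) auto
  from Suc.IH[OF this] have
    "marg d n (\<lambda>y z. \<Sum>c<d. X (y * d + c) (z * d + c)) a b =
     marg d n (\<lambda>y z. \<Sum>c<d. Y (y * d + c) (z * d + c)) a b" .
  moreover have "(\<Sum>y<d ^ n. X (y * d + a) (y * d + b)) = (\<Sum>y<d ^ n. Y (y * d + a) (y * d + b))"
    using assms(2,3) by (intro sum.cong refl Suc.prems mult_add_less_power_Suc) auto
  ultimately show ?case by simp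
qed simp

lemma marg_sum:
  "marg d n (\<lambda>x y. \<Sum>s\<in>S. c s * X s x y) a b = (\<Sum>s\<in>S. c s * marg d n (X s) a b)"
proof (induction n arbitrary: X)
  case (Suc n)
  have "(\<Sum>y<d ^ n. \<Sum>s\<in>S. c s * X s (y * d + a) (y * d + b)) =
      (\<Sum>s\<in>S. c s * (\<Sum>y<d ^ n. X s (y * d + a) (y * d + b)))"
    unfolding sum_distrib_left by (rule sum.swap)
  moreover have "(\<lambda>y z. \<Sum>k<d. \<Sum>s\<in>S. c s * X s (y * d + k) (z * d + k)) =
      (\<lambda>y z. \<Sum>s\<in>S. c s * (\<Sum>k<d. X s (y * d + k) (z * d + k)))"
    unfolding sum_distrib_left by (intro ext sum.swap)
  ultimately show ?case
    by (simp add: Suc.IH sum.distrib ring_distribs)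
qed simp

lemma marg_sum_plain:
  "marg d n (\<lambda>x y. \<Sum>s\<in>S. X s x y) a b = (\<Sum>s\<in>S. marg d n (X s) a b)"
  using marg_sum[of d n "\<lambda>_. 1" X S a b] by simp

lemma marg_diff:
  "marg d n (\<lambda>x y. X x y - Y x y) a b = marg d n X a b - marg d n Y a b"
proof -
  have "marg d n (\<lambda>x y. X x y - Y x y) a b =
      marg d n (\<lambda>x y. \<Sum>s\<in>{True, False}. (if s then 1 else - 1) * (if s then X else Y) x y) a b"
    by simp
  also have "\<dots> = marg d n X a b - marg d n Y a b"
    by (subst marg_sum) simp
  finally show ?thesis .
qed

section \<open>Marginals of tensor powers and their control by the trace norm\<close>

lemma tensor_pow_carrier:
  "\<rho> \<in> carrier_mat d d \<Longrightarrow> tensor_pow \<rho> n \<in> carrier_mat (d ^ n) (d ^ n)"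
  by (induction n) (auto simp: kron_def mult.commute)

lemma tensor_pow_Suc_entry:
  assumes "\<rho> \<in> carrier_mat d d" "y < d ^ n" "z < d ^ n" "a < d" "b < d"
  shows "tensor_pow \<rho> (Suc n) $$ (y * d + a, z * d + b) = tensor_pow \<rho> n $$ (y, z) * \<rho> $$ (a, b)"
proof -
  have "y * d + a < d ^ n * d" "z * d + b < d ^ n * d"
    using assms mult_add_less_power_Suc unfolding power_Suc2[symmetric] by blast+
  then show ?thesis
    using tensor_pow_carrier[OF assms(1), of n] assms by (simp add: kron_def)
qed

lemma tensor_pow_trace:
  assumes "\<rho> \<in> carrier_mat d d" "mtrace \<rho> = 1"
  shows "(\<Sum>x<d ^ n. tensor_pow \<rho> n $$ (x, x)) = 1"
proof (induction n)
  case (Suc n)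
  have tr: "(\<Sum>a<d. \<rho> $$ (a, a)) = 1" using assms by (simp add: mtrace_def)
  have "(\<Sum>x<d ^ Suc n. tensor_pow \<rho> (Suc n) $$ (x, x)) =
      (\<Sum>y<d ^ n. \<Sum>a<d. tensor_pow \<rho> n $$ (y, y) * \<rho> $$ (a, a))"
    unfolding sum_lessThan_power_Suc using assms(1)
    by (intro sum.cong refl tensor_pow_Suc_entry) auto
  also have "\<dots> = 1" using Suc tr by (simp add: sum_distrib_left[symmetric])
  finally show ?case .
qed simp

text \<open>Tracing out the other sites multiplies by powers of \<open>mtrace \<rho> = 1\<close>, so
  each of the \<open>n\<close> sites contributes \<open>\<rho>\<close> itself.\<close>

lemma marg_tensor_pow:
  assumes "\<rho> \<in> carrier_mat d d" "mtrace \<rho> = 1" "a < d" "b < d"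
  shows "marg d n (\<lambda>x y. tensor_pow \<rho> n $$ (x, y)) a b = of_nat n * \<rho> $$ (a, b)"
proof (induction n)
  case (Suc n)
  have tr: "(\<Sum>a<d. \<rho> $$ (a, a)) = 1" using assms by (simp add: mtrace_def)
  let ?T = "\<lambda>n x y. tensor_pow \<rho> n $$ (x, y)"
  have "(\<Sum>y<d ^ n. ?T (Suc n) (y * d + a) (y * d + b)) = (\<Sum>y<d ^ n. ?T n y y * \<rho> $$ (a, b))"
    using assms by (intro sum.cong refl tensor_pow_Suc_entry) auto
  also have "\<dots> = \<rho> $$ (a, b)"
    using tensor_pow_trace[OF assms(1,2)] by (simp add: sum_distrib_right[symmetric])
  finally have 1: "(\<Sum>y<d ^ n. ?T (Suc n) (y * d + a) (y * d + b)) = \<rho> $$ (a, b)" .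
  have "marg d n (\<lambda>y z. \<Sum>c<d. ?T (Suc n) (y * d + c) (z * d + c)) a b = marg d n (?T n) a b"
  proof (rule marg_cong)
    fix x y assume "x < d ^ n" "y < d ^ n"
    then have "(\<Sum>c<d. ?T (Suc n) (x * d + c) (y * d + c)) = (\<Sum>c<d. ?T n x y * \<rho> $$ (c, c))"
      using assms by (intro sum.cong refl tensor_pow_Suc_entry) auto
    then show "(\<Sum>c<d. ?T (Suc n) (x * d + c) (y * d + c)) = ?T n x y"
      using tr by (simp add: sum_distrib_left[symmetric])
  qed (use assms in auto)
  with 1 Suc show ?case by (simp only: marg.simps) (simp add: algebra_simps)
qed simp

text \<open>Each site contributes at most the squared norm of \<open>w\<close>: the
  arithmetic-geometric mean inequality bounds the last site, and tracing that site out cuts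
  \<open>w\<close> into slices whose squared norms add up to the same total.\<close>

lemma marg_rank_one_le:
  assumes "a < d" "b < d"
  shows "cmod (marg d n (\<lambda>x y. w x * cnj (w y)) a b) \<le> real n * (\<Sum>x<d ^ n. (cmod (w x))\<^sup>2)"
proof (induction n arbitrary: w)
  case (Suc n)
  let ?N = "\<Sum>x<d ^ Suc n. (cmod (w x))\<^sup>2"
  have N: "?N = (\<Sum>y<d ^ n. \<Sum>c<d. (cmod (w (y * d + c)))\<^sup>2)" by (rule sum_lessThan_power_Suc)
  have N': "?N = (\<Sum>c<d. \<Sum>y<d ^ n. (cmod (w (y * d + c)))\<^sup>2)" unfolding N by (rule sum.swap)
  have col: "(\<Sum>y<d ^ n. (cmod (w (y * d + c)))\<^sup>2) \<le> ?N" if "c < d" for c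
    unfolding N' using that by (intro member_le_sum) (auto simp: sum_nonneg)
  have "cmod (\<Sum>y<d ^ n. w (y * d + a) * cnj (w (y * d + b)))
      \<le> (\<Sum>y<d ^ n. cmod (w (y * d + a)) * cmod (w (y * d + b)))"
    by (rule order_trans[OF norm_sum]) (simp add: norm_mult)
  also have "\<dots> \<le> (\<Sum>y<d ^ n. ((cmod (w (y * d + a)))\<^sup>2 + (cmod (w (y * d + b)))\<^sup>2) / 2)"
  proof (intro sum_mono)
    fix y
    show "cmod (w (y * d + a)) * cmod (w (y * d + b)) \<le> ((cmod (w (y * d + a)))\<^sup>2 + (cmod (w (y * d + b)))\<^sup>2) / 2"
      using sum_squares_bound[of "cmod (w (y * d + a))" "cmod (w (y * d + b))"] by simp
  qed
  also have "\<dots> = ((\<Sum>y<d ^ n. (cmod (w (y * d + a)))\<^sup>2) + (\<Sum>y<d ^ n. (cmod (w (y * d + b)))\<^sup>2)) / 2"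
    by (simp only: sum_divide_distrib[symmetric] sum.distrib)
  also have "\<dots> \<le> ?N"
  proof -
    have "(A + B) / 2 \<le> N" if "A \<le> N" "B \<le> N" for A B N :: real
      using add_mono[OF that] by (simp add: field_simps)
    from this[OF col[OF assms(1)] col[OF assms(2)]] show ?thesis .
  qed
  finally have 1: "cmod (\<Sum>y<d ^ n. w (y * d + a) * cnj (w (y * d + b))) \<le> ?N" .
  have "marg d n (\<lambda>y z. \<Sum>c<d. w (y * d + c) * cnj (w (z * d + c))) a b =
     (\<Sum>c<d. marg d n (\<lambda>y z. w (y * d + c) * cnj (w (z * d + c))) a b)"
    by (rule marg_sum_plain)
  also have "cmod \<dots> \<le> (\<Sum>c<d. real n * (\<Sum>y<d ^ n. (cmod (w (y * d + c)))\<^sup>2))"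
    by (rule order_trans[OF norm_sum sum_mono]) (rule Suc.IH)
  also have "\<dots> = real n * ?N" unfolding N' by (simp add: sum_distrib_left)
  finally have 2: "cmod (marg d n (\<lambda>y z. \<Sum>c<d. w (y * d + c) * cnj (w (z * d + c))) a b) \<le> real n * ?N" .
  have "cmod (marg d (Suc n) (\<lambda>x y. w x * cnj (w y)) a b) \<le> ?N + real n * ?N"
    unfolding marg.simps using 1 2 by (intro norm_triangle_le add_mono)
  also have "\<dots> = real (Suc n) * ?N" by (simp only: of_nat_Suc ring_distribs mult_1)
  finally show ?case .
qed simp

text \<open>The rank-one bound is applied along an orthonormal eigenbasis. The factor
  \<open>n\<close> counts sites and disappears once the marginals are averaged.\<close>

lemma marg_le_trace_norm:
  assumes "X \<in> carrier_mat (d ^ n) (d ^ n)" "hermitian (d ^ n) (\<lambda>x y. X $$ (x, y))" "a < d" "b < d"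
  shows "cmod (marg d n (\<lambda>x y. X $$ (x, y)) a b) \<le> real n * trace_norm X"
proof -
  obtain v \<mu> where es: "eigensystem (d ^ n) (\<lambda>x y. X $$ (x, y)) v \<mu>"
    and tn: "trace_norm X = (\<Sum>k<d ^ n. \<bar>\<mu> k\<bar>)"
    using trace_norm_spectral[OF assms(1,2)] by blast
  have norm1: "(\<Sum>x<d ^ n. (cmod (v k x))\<^sup>2) = 1" if "k < d ^ n" for k
  proof -
    have "ip (d ^ n) (v k) (v k) = 1" using eigensystemD(1)[OF es] that by (simp add: orthonormal_def)
    then show ?thesis unfolding ip_self by (simp only: of_real_eq_1_iff)
  qed
  have "marg d n (\<lambda>x y. X $$ (x, y)) a b =
      marg d n (\<lambda>x y. \<Sum>k<d ^ n. complex_of_real (\<mu> k) * (v k x * cnj (v k y))) a b"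
    using assms(3,4) by (intro marg_cong) (simp_all add: eigensystemD(3)[OF es] mult.assoc)
  also have "\<dots> = (\<Sum>k<d ^ n. complex_of_real (\<mu> k) * marg d n (\<lambda>x y. v k x * cnj (v k y)) a b)"
    by (rule marg_sum)
  also have "cmod \<dots> \<le> (\<Sum>k<d ^ n. \<bar>\<mu> k\<bar> * real n)"
  proof (rule order_trans[OF norm_sum sum_mono])
    fix k assume "k \<in> {..<d ^ n}"
    then show "cmod (complex_of_real (\<mu> k) * marg d n (\<lambda>x y. v k x * cnj (v k y)) a b) \<le> \<bar>\<mu> k\<bar> * real n"
      using marg_rank_one_le[OF assms(3,4), of n "v k"] norm1 by (simp add: norm_mult mult_left_mono)
  qed
  also have "\<dots> = real n * trace_norm X" by (simp add: tn sum_distrib_left mult.commute)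
  finally show ?thesis .
qed

text \<open>For the indicator \<open>\<xi>\<close> of a finite set this says \<open>H(Y) + H(A) \<ge> H(Y, A)\<close>: subadditivity of
  the entropy of a uniformly distributed pair, with the entropies rewritten in terms of row and column sums.\<close>

lemma entropy_subadditive_uniform:
  fixes \<xi> :: "'y \<Rightarrow> 'a \<Rightarrow> real"
  assumes fin: "finite Y" "finite A" and chi: "\<And>y a. 0 \<le> \<xi> y a" "\<And>y a. \<xi> y a \<le> 1"
  defines "m \<equiv> \<lambda>y. \<Sum>a\<in>A. \<xi> y a" and "c \<equiv> \<lambda>a. \<Sum>y\<in>Y. \<xi> y a" and "N \<equiv> \<Sum>y\<in>Y. \<Sum>a\<in>A. \<xi> y a"
  shows "(\<Sum>y\<in>Y. m y * ln (m y)) + (\<Sum>a\<in>A. c a * ln (c a)) \<le> N * ln N"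
proof (cases "N = 0")
  case True
  have m0: "m y \<ge> 0" for y using chi by (simp add: m_def sum_nonneg)
  have "m y = 0" if "y \<in> Y" for y
    using True m0 fin that unfolding N_def m_def[symmetric] by (simp add: sum_nonneg_eq_0_iff)
  moreover have "c a \<ge> 0" for a using chi by (simp add: c_def sum_nonneg)
  moreover have "N = (\<Sum>a\<in>A. c a)" unfolding N_def c_def by (rule sum.swap)
  ultimately show ?thesis using True fin by (simp add: sum_nonneg_eq_0_iff)
next
  case False
  moreover have "N \<ge> 0" unfolding N_def using chi by (intro sum_nonneg)
  ultimately have N: "N > 0" by simp
  have N2: "N = (\<Sum>a\<in>A. c a)" unfolding N_def c_def by (rule sum.swap)
  have m0: "m y \<ge> 0" and c0: "c a \<ge> 0" for y a using chi by (simp_all add: m_def c_def sum_nonneg)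
  \<comment> \<open>Gibbs' inequality term by term: \<open>ln t \<le> t - 1\<close> at
    \<open>t = m y * c a / N\<close>, after which \<open>\<xi> y a \<le> 1\<close> drops the weight
    of the product term. The right-hand sides sum to \<open>N * N / N - N = 0\<close>.\<close>
  have pt: "\<xi> y a * (ln (m y) + ln (c a) - ln N) \<le> m y * c a / N - \<xi> y a" if ya: "y \<in> Y" "a \<in> A" for y a
  proof (cases "\<xi> y a = 0")
    case True
    then show ?thesis using m0 c0 N by simp
  next
    case False
    then have pos: "\<xi> y a > 0" using chi(1)[of y a] by simp
    have "\<xi> y a \<le> m y" "\<xi> y a \<le> c a"
      unfolding m_def c_def using fin ya chi
      by (auto intro: member_le_sum[of a A "\<xi> y"] member_le_sum[of y Y "\<lambda>y. \<xi> y a"])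
    with pos have mc: "m y > 0" "c a > 0" by linarith+
    have "ln (m y) + ln (c a) - ln N = ln (m y * c a / N)"
      using mc N by (simp add: ln_mult ln_div)
    also have "\<dots> \<le> m y * c a / N - 1"
      using mc N by (intro ln_le_minus_one) simp
    finally have "\<xi> y a * (ln (m y) + ln (c a) - ln N) \<le> \<xi> y a * (m y * c a / N - 1)"
      using pos by (intro mult_left_mono) auto
    also have "\<dots> = \<xi> y a * (m y * c a / N) - \<xi> y a" by (simp add: right_diff_distrib)
    also have "\<xi> y a * (m y * c a / N) \<le> 1 * (m y * c a / N)"
      using chi mc N by (intro mult_right_mono) auto
    finally show ?thesis by simp
  qed
  have "(\<Sum>y\<in>Y. m y * ln (m y)) + (\<Sum>a\<in>A. c a * ln (c a)) - N * ln N =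
      (\<Sum>y\<in>Y. \<Sum>a\<in>A. \<xi> y a * (ln (m y) + ln (c a) - ln N))"
  proof -
    have "(\<Sum>y\<in>Y. m y * ln (m y)) = (\<Sum>y\<in>Y. \<Sum>a\<in>A. \<xi> y a * ln (m y))"
      by (simp add: m_def sum_distrib_right)
    moreover have "(\<Sum>a\<in>A. c a * ln (c a)) = (\<Sum>y\<in>Y. \<Sum>a\<in>A. \<xi> y a * ln (c a))"
      unfolding c_def sum_distrib_right by (rule sum.swap)
    moreover have "N * ln N = (\<Sum>y\<in>Y. \<Sum>a\<in>A. \<xi> y a * ln N)"
      unfolding N_def by (simp add: sum_distrib_right)
    ultimately show ?thesis by (simp add: ring_distribs sum.distrib sum_subtractf)
  qed
  also have "\<dots> \<le> (\<Sum>y\<in>Y. \<Sum>a\<in>A. m y * c a / N - \<xi> y a)" by (intro sum_mono pt)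
  also have "\<dots> = (\<Sum>y\<in>Y. \<Sum>a\<in>A. m y * c a) / N - N"
    by (simp add: sum_subtractf N_def sum_divide_distrib)
  also have "(\<Sum>y\<in>Y. \<Sum>a\<in>A. m y * c a) = (\<Sum>y\<in>Y. m y) * (\<Sum>a\<in>A. c a)"
    by (simp add: sum_product)
  also have "(\<Sum>y\<in>Y. m y) = N" by (simp add: N_def m_def)
  also have "(\<Sum>a\<in>A. c a) = N" by (simp add: N2)
  finally show ?thesis using N by simp
qed

lemma sum_list_concat_upt:
  fixes f :: "'a \<Rightarrow> 'b::comm_monoid_add"
  shows "sum_list (map f (concat (map g [0..<n]))) = (\<Sum>c<n. sum_list (map f (g c)))"
  by (induction n) (simp_all add: add.commute)

lemma sum_list_map_upt:
  fixes f :: "nat \<Rightarrow> 'b::comm_monoid_add"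
  shows "sum_list (map f [0..<n]) = (\<Sum>c<n. f c)"
  by (induction n) (simp_all add: add.commute)

text \<open>Slices of a flat vector are flat, so every one-site marginal is a sum of flat rank-one
  terms. Each site partitions the support, hence total weight \<open>n\<close> times the original;
  the \<open>k * ln k\<close> bound is subadditivity of entropy, iterated over the sites. A list is
  used because slices may coincide, and zero slices are kept.\<close>

lemma marg_flat:
  assumes "flat (d ^ n) w"
  shows "\<exists>us. (\<forall>u\<in>set us. flat d u) \<and>
     (\<forall>a<d. \<forall>b<d. marg d n (\<lambda>x y. w x * cnj (w y)) a b = (\<Sum>u\<leftarrow>us. u a * cnj (u b))) \<and>
     (\<Sum>u\<leftarrow>us. real (wt d u)) = real n * real (wt (d ^ n) w) \<and>
     (\<Sum>u\<leftarrow>us. real (wt d u) * ln (real (wt d u))) \<le> real (wt (d ^ n) w) * ln (real (wt (d ^ n) w))"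
  using assms
proof (induction n arbitrary: w)
  case 0
  have "wt (d ^ 0) w \<le> 1"
    unfolding wt_def using card_mono[of "{0::nat}" "{i. i < d ^ 0 \<and> w i \<noteq> 0}"] by auto
  \<comment> \<open>With no site there are no marginals; the bound still holds because
    \<open>k * ln k\<close> is 0 for \<open>k = 0\<close> and for \<open>k = 1\<close>.\<close>
  then have "wt (d ^ 0) w = 0 \<or> wt (d ^ 0) w = 1" by linarith
  then have "real (wt (d ^ 0) w) * ln (real (wt (d ^ 0) w)) = 0" by auto
  then show ?case by (intro exI[of _ "[]"]) auto
next
  case (Suc n)
  \<comment> \<open>\<open>W c\<close> fixes the last digit and lives on the first \<open>n\<close>
    sites; \<open>V y\<close> fixes all other digits and lives on the last site. The
    \<open>V y\<close> give the marginal of the last site, the \<open>W c\<close> those of the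
    remaining sites by induction.\<close>
  define W where "W = (\<lambda>c y. w (y * d + c))"
  define V where "V = (\<lambda>y c. w (y * d + c))"
  have fl: "w (y * d + c) = 0 \<or> cmod (w (y * d + c)) = 1" if "y < d ^ n" "c < d" for y c
    using Suc.prems mult_add_less_power_Suc[OF that] unfolding flat_def by blast
  have "\<forall>c. \<exists>us. c < d \<longrightarrow> (\<forall>u\<in>set us. flat d u) \<and>
     (\<forall>a<d. \<forall>b<d. marg d n (\<lambda>x y. W c x * cnj (W c y)) a b = (\<Sum>u\<leftarrow>us. u a * cnj (u b))) \<and>
     (\<Sum>u\<leftarrow>us. real (wt d u)) = real n * real (wt (d ^ n) (W c)) \<and>
     (\<Sum>u\<leftarrow>us. real (wt d u) * ln (real (wt d u))) \<le> real (wt (d ^ n) (W c)) * ln (real (wt (d ^ n) (W c)))"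
  proof (intro allI)
    fix c
    show "\<exists>us. c < d \<longrightarrow> (\<forall>u\<in>set us. flat d u) \<and>
     (\<forall>a<d. \<forall>b<d. marg d n (\<lambda>x y. W c x * cnj (W c y)) a b = (\<Sum>u\<leftarrow>us. u a * cnj (u b))) \<and>
     (\<Sum>u\<leftarrow>us. real (wt d u)) = real n * real (wt (d ^ n) (W c)) \<and>
     (\<Sum>u\<leftarrow>us. real (wt d u) * ln (real (wt d u))) \<le> real (wt (d ^ n) (W c)) * ln (real (wt (d ^ n) (W c)))"
    proof (cases "c < d")
      case True
      then have "flat (d ^ n) (W c)" unfolding flat_def W_def using fl by blast
      from Suc.IH[OF this] show ?thesis by blast
    qed simp
  qed
  from choice[OF this] obtain Us where Us: "\<forall>c. c < d \<longrightarrow> (\<forall>u\<in>set (Us c). flat d u) \<and>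
     (\<forall>a<d. \<forall>b<d. marg d n (\<lambda>x y. W c x * cnj (W c y)) a b = (\<Sum>u\<leftarrow>Us c. u a * cnj (u b))) \<and>
     (\<Sum>u\<leftarrow>Us c. real (wt d u)) = real n * real (wt (d ^ n) (W c)) \<and>
     (\<Sum>u\<leftarrow>Us c. real (wt d u) * ln (real (wt d u))) \<le> real (wt (d ^ n) (W c)) * ln (real (wt (d ^ n) (W c)))"
    ..
  define us where "us = map V [0..<d ^ n] @ concat (map Us [0..<d])"
  have sum_us: "(\<Sum>u\<leftarrow>us. f u) = (\<Sum>y<d ^ n. f (V y)) + (\<Sum>c<d. \<Sum>u\<leftarrow>Us c. f u)"
    for f :: "(nat \<Rightarrow> complex) \<Rightarrow> 'b::comm_monoid_add"
    unfolding us_def by (simp add: sum_list_concat_upt sum_list_map_upt comp_def)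
  let ?\<xi> = "\<lambda>y a. of_bool (w (y * d + a) \<noteq> 0) :: real"
  have wV: "real (wt d (V y)) = (\<Sum>a<d. ?\<xi> y a)" for y by (simp add: wt_sum_of_bool V_def)
  have wW: "real (wt (d ^ n) (W c)) = (\<Sum>y<d ^ n. ?\<xi> y c)" for c by (simp add: wt_sum_of_bool W_def)
  have ww: "real (wt (d ^ Suc n) w) = (\<Sum>y<d ^ n. \<Sum>a<d. ?\<xi> y a)"
    unfolding wt_sum_of_bool by (rule sum_lessThan_power_Suc)
  show ?case
  proof (intro exI[of _ us] conjI)
    show "\<forall>u\<in>set us. flat d u"
    proof
      fix u assume "u \<in> set us"
      then consider y where "y < d ^ n" "u = V y" | c where "c < d" "u \<in> set (Us c)"
        by (auto simp: us_def)
      then show "flat d u"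
      proof cases
        case 1
        then show ?thesis using fl unfolding flat_def V_def by blast
      next
        case 2
        then show ?thesis using Us by blast
      qed
    qed
    show "\<forall>a<d. \<forall>b<d. marg d (Suc n) (\<lambda>x y. w x * cnj (w y)) a b = (\<Sum>u\<leftarrow>us. u a * cnj (u b))"
    proof (intro allI impI)
      fix a b assume ab: "a < d" "b < d"
      have "marg d n (\<lambda>y z. \<Sum>c<d. w (y * d + c) * cnj (w (z * d + c))) a b =
          (\<Sum>c<d. marg d n (\<lambda>y z. W c y * cnj (W c z)) a b)"
        unfolding W_def by (rule marg_sum_plain)
      also have "\<dots> = (\<Sum>c<d. \<Sum>u\<leftarrow>Us c. u a * cnj (u b))"
        using Us ab by (intro sum.cong) auto
      finally show "marg d (Suc n) (\<lambda>x y. w x * cnj (w y)) a b = (\<Sum>u\<leftarrow>us. u a * cnj (u b))"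
        unfolding sum_us marg.simps by (simp add: V_def)
    qed
    have "(\<Sum>u\<leftarrow>us. real (wt d u)) =
        (\<Sum>y<d ^ n. \<Sum>a<d. ?\<xi> y a) + (\<Sum>c<d. real n * (\<Sum>y<d ^ n. ?\<xi> y c))"
      unfolding sum_us wV wW[symmetric] using Us by simp
    also have "(\<Sum>c<d. real n * (\<Sum>y<d ^ n. ?\<xi> y c)) = real n * (\<Sum>y<d ^ n. \<Sum>c<d. ?\<xi> y c)"
      by (subst sum.swap) (simp only: sum_distrib_left)
    finally show "(\<Sum>u\<leftarrow>us. real (wt d u)) = real (Suc n) * real (wt (d ^ Suc n) w)"
      unfolding ww by (simp only: of_nat_Suc ring_distribs mult_1)
    have "(\<Sum>u\<leftarrow>us. real (wt d u) * ln (real (wt d u))) \<le>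
        (\<Sum>y<d ^ n. real (wt d (V y)) * ln (real (wt d (V y)))) +
        (\<Sum>c<d. real (wt (d ^ n) (W c)) * ln (real (wt (d ^ n) (W c))))"
      unfolding sum_us using Us by (intro add_left_mono sum_mono) auto
    \<comment> \<open>Row and column sums of the indicator of the support are the weights of the two
      kinds of slices.\<close>
    also have "\<dots> \<le> real (wt (d ^ Suc n) w) * ln (real (wt (d ^ Suc n) w))"
      unfolding wV wW ww by (rule entropy_subadditive_uniform) auto
    finally show "(\<Sum>u\<leftarrow>us. real (wt d u) * ln (real (wt d u))) \<le>
        real (wt (d ^ Suc n) w) * ln (real (wt (d ^ Suc n) w))" .
  qed
qed

section \<open>Physically incoherent operations on maximally coherent states\<close>

text \<open>The usual notation for the inverse function is taken by the group inverse of HOL-Algebra.\<close>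

abbreviation pinv :: "('a \<Rightarrow> 'a) \<Rightarrow> 'a \<Rightarrow> 'a" where
  "pinv \<sigma> \<equiv> inv_into UNIV \<sigma>"

lemma sum_if_eq_inv:
  fixes g :: "nat \<Rightarrow> complex"
  assumes \<sigma>: "\<sigma> permutes {..<D}" and i: "i < D"
  shows "(\<Sum>k<D. (if i = \<sigma> k \<and> P k then g k else 0) * h k) =
    (if P (pinv \<sigma> i) then g (pinv \<sigma> i) * h (pinv \<sigma> i) else 0)"
proof -
  have inv: "pinv \<sigma> i < D" using permutes_in_image[OF permutes_inv[OF \<sigma>], of i] i by simp
  have "i = \<sigma> k \<longleftrightarrow> k = pinv \<sigma> i" for k using permutes_inv_eq[OF \<sigma>, of i k] by auto
  then have "(\<Sum>k<D. (if i = \<sigma> k \<and> P k then g k else 0) * h k) =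
      (\<Sum>k<D. if k = pinv \<sigma> i then (if P k then g k * h k else 0) else 0)"
    by (intro sum.cong) auto
  also have "\<dots> = (if P (pinv \<sigma> i) then g (pinv \<sigma> i) * h (pinv \<sigma> i) else 0)"
    using inv by (simp add: sum.delta)
  finally show ?thesis .
qed

lemma incoherent_unitary_entry:
  assumes \<sigma>: "\<sigma> permutes {..<D}" and "i < D" "k < D"
  shows "(perm_mat D \<sigma> * diag_of D c) $$ (i, k) = (if i = \<sigma> k then c k else 0)"
proof -
  have "(perm_mat D \<sigma> * diag_of D c) $$ (i, k) = (\<Sum>l<D. perm_mat D \<sigma> $$ (i, l) * diag_of D c $$ (l, k))"
    using assms by (intro mat_mult_entries) (auto simp: perm_mat_def diag_of_def)
  also have "\<dots> = (\<Sum>l<D. if l = k then (if i = \<sigma> k then c k else 0) else 0)"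
    using assms by (intro sum.cong) (auto simp: perm_mat_def diag_of_def)
  finally show ?thesis using assms by simp
qed

text \<open>An incoherent unitary only permutes labels and attaches phases, so a measured branch
  pulls the input back along the inverse permutation. Both directions compute with PIOs through this
  formula.\<close>

lemma measured_conjugation_entry:
  fixes c :: "nat \<Rightarrow> complex"
  assumes \<sigma>: "\<sigma> permutes {..<D}" and X: "X \<in> carrier_mat D D" and i: "i < D" and j: "j < D"
  defines "U \<equiv> perm_mat D \<sigma> * diag_of D c"
  shows "(U * incoh_proj D I * X * incoh_proj D I * dagger U) $$ (i, j) =
    (if pinv \<sigma> i \<in> I \<and> pinv \<sigma> j \<in> I
     then c (pinv \<sigma> i) * cnj (c (pinv \<sigma> j)) * X $$ (pinv \<sigma> i, pinv \<sigma> j) else 0)"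
proof -
  let ?P = "incoh_proj D I"
  have U: "U \<in> carrier_mat D D" by (auto simp: U_def perm_mat_def diag_of_def)
  have P: "?P \<in> carrier_mat D D" by (simp add: incoh_proj_def)
  have U': "dagger U \<in> carrier_mat D D" using U by (simp add: dagger_def)
  have UP: "(U * ?P) $$ (r, k) = (if r = \<sigma> k \<and> k \<in> I then c k else 0)" if "r < D" "k < D" for r k
  proof -
    have "(U * ?P) $$ (r, k) = (\<Sum>l<D. U $$ (r, l) * ?P $$ (l, k))"
      using that by (intro mat_mult_entries[OF U P])
    also have "\<dots> = (\<Sum>l<D. if l = k then (if r = \<sigma> k \<and> k \<in> I then c k else 0) else 0)"
      using that by (intro sum.cong refl) (auto simp: U_def incoherent_unitary_entry[OF \<sigma>] incoh_proj_def)
    finally show ?thesis using that by simp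
  qed
  have PU: "(?P * dagger U) $$ (k, r) = (if r = \<sigma> k \<and> k \<in> I then cnj (c k) else 0)" if "r < D" "k < D" for r k
  proof -
    have "(?P * dagger U) $$ (k, r) = (\<Sum>l<D. ?P $$ (k, l) * dagger U $$ (l, r))"
      using that by (intro mat_mult_entries[OF P U'])
    also have "\<dots> = (\<Sum>l<D. if l = k then (if r = \<sigma> k \<and> k \<in> I then cnj (c k) else 0) else 0)"
    proof (intro sum.cong refl)
      fix l assume "l \<in> {..<D}"
      then have l: "l < D" by simp
      have "dagger U $$ (l, r) = cnj (U $$ (r, l))" using U l that by (simp add: dagger_def)
      also have "\<dots> = (if r = \<sigma> l then cnj (c l) else 0)"
        unfolding U_def incoherent_unitary_entry[OF \<sigma> that(1) l] by simp
      finally show "?P $$ (k, l) * dagger U $$ (l, r) = (if l = k then (if r = \<sigma> k \<and> k \<in> I then cnj (c k) else 0) else 0)"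
        using l that by (auto simp: incoh_proj_def)
    qed
    finally show ?thesis using that by simp
  qed
  have assoc: "U * ?P * X * ?P * dagger U = (U * ?P) * (X * (?P * dagger U))"
    using U P U' X by (simp add: assoc_mult_mat[of _ D D _ D _ D])
  have 1: "(X * (?P * dagger U)) $$ (k, j) =
      (if pinv \<sigma> j \<in> I then cnj (c (pinv \<sigma> j)) * X $$ (k, pinv \<sigma> j) else 0)" if k: "k < D" for k
  proof -
    have "(X * (?P * dagger U)) $$ (k, j) = (\<Sum>l<D. X $$ (k, l) * (?P * dagger U) $$ (l, j))"
      by (rule mat_mult_entries[OF X mult_carrier_mat[OF P U'] k j])
    also have "\<dots> = (\<Sum>l<D. (if j = \<sigma> l \<and> l \<in> I then cnj (c l) else 0) * X $$ (k, l))"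
      using j by (intro sum.cong refl) (simp add: PU)
    also have "\<dots> = (if pinv \<sigma> j \<in> I then cnj (c (pinv \<sigma> j)) * X $$ (k, pinv \<sigma> j) else 0)"
      by (rule sum_if_eq_inv[OF \<sigma> j])
    finally show ?thesis .
  qed
  have "((U * ?P) * (X * (?P * dagger U))) $$ (i, j) =
      (\<Sum>k<D. (U * ?P) $$ (i, k) * (X * (?P * dagger U)) $$ (k, j))"
    by (rule mat_mult_entries[OF mult_carrier_mat[OF U P] mult_carrier_mat[OF X mult_carrier_mat[OF P U']] i j])
  also have "\<dots> = (\<Sum>k<D. (if i = \<sigma> k \<and> k \<in> I then c k else 0) *
      (if pinv \<sigma> j \<in> I then cnj (c (pinv \<sigma> j)) * X $$ (k, pinv \<sigma> j) else 0))"
    using i by (intro sum.cong refl) (simp add: UP 1)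
  also have "\<dots> = (if pinv \<sigma> i \<in> I then c (pinv \<sigma> i) *
      (if pinv \<sigma> j \<in> I then cnj (c (pinv \<sigma> j)) * X $$ (pinv \<sigma> i, pinv \<sigma> j) else 0) else 0)"
    by (rule sum_if_eq_inv[OF \<sigma> i])
  finally show ?thesis unfolding assoc by (simp add: mult.assoc)
qed

lemma embed_entry:
  assumes "inj_on \<iota> {..<a}" "\<iota> ` {..<a} \<subseteq> {..<D}" "X \<in> carrier_mat a a"
  shows "x < a \<Longrightarrow> y < a \<Longrightarrow> embed D \<iota> X $$ (\<iota> x, \<iota> y) = X $$ (x, y)"
    and "i < D \<Longrightarrow> j < D \<Longrightarrow> i \<notin> \<iota> ` {..<a} \<or> j \<notin> \<iota> ` {..<a} \<Longrightarrow> embed D \<iota> X $$ (i, j) = 0"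
proof -
  assume "x < a" "y < a"
  moreover from this have "\<iota> x < D" "\<iota> y < D" using assms(2) by auto
  ultimately show "embed D \<iota> X $$ (\<iota> x, \<iota> y) = X $$ (x, y)"
    using assms(1,3) by (simp add: embed_def)
qed (use assms in \<open>auto simp: embed_def\<close>)

lemma embed_carrier: "embed D \<iota> X \<in> carrier_mat D D"
  by (simp add: embed_def)

lemma embed_trace:
  assumes "inj_on \<iota> {..<a}" "\<iota> ` {..<a} \<subseteq> {..<D}" "X \<in> carrier_mat a a"
  shows "(\<Sum>i<D. embed D \<iota> X $$ (i, i)) = (\<Sum>x<a. X $$ (x, x))"
proof -
  have "(\<Sum>i<D. embed D \<iota> X $$ (i, i)) = (\<Sum>i\<in>\<iota> ` {..<a}. embed D \<iota> X $$ (i, i))"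
    using assms(2) by (intro sum.mono_neutral_right) (auto intro!: embed_entry(2)[OF assms])
  also have "\<dots> = (\<Sum>x<a. X $$ (x, x))"
    using assms(1) by (simp add: sum.reindex embed_entry(1)[OF assms])
  finally show ?thesis .
qed

lemma max_coh_carrier: "max_coh m \<in> carrier_mat (2 ^ m) (2 ^ m)"
  by (simp add: max_coh_def proj_vec_def)

lemma max_coh_entry:
  assumes "x < 2 ^ m" "y < 2 ^ m"
  shows "max_coh m $$ (x, y) = complex_of_real (1 / 2 ^ m)"
proof -
  have "max_coh m $$ (x, y) = complex_of_real (1 / sqrt (2 ^ m) * (1 / sqrt (2 ^ m)))"
    using assms unfolding max_coh_def proj_vec_def by (simp only: dim_vec index_mat split index_vec of_real_mult complex_cnj_complex_of_real)
  also have "1 / sqrt (2 ^ m) * (1 / sqrt (2 ^ m)) = 1 / (2::real) ^ m"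
    by simp
  finally show ?thesis .
qed

lemma projectors_complete:
  assumes "mat D D (\<lambda>(i,j). \<Sum>\<beta><(M::nat). incoh_proj D (I \<beta>) $$ (i,j)) = 1\<^sub>m D" "x < D"
  shows "(\<Sum>\<beta><M. if x \<in> I \<beta> then 1 else 0 :: complex) = 1"
proof -
  have "1 = mat D D (\<lambda>(i,j). \<Sum>\<beta><M. incoh_proj D (I \<beta>) $$ (i,j)) $$ (x, x)"
    using assms by simp
  also have "\<dots> = (\<Sum>\<beta><M. if x \<in> I \<beta> then 1 else 0)"
    using assms(2) by (simp add: incoh_proj_def)
  finally show ?thesis by simp
qed

lemma flat_self_product:
  assumes "flat n u"
  shows "(\<Sum>i<n. u i * cnj (u i)) = of_nat (wt n u)"
  using ip_self[of n u] flat_norm_sum[OF assms] by (simp add: ip_def)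

text \<open>Each branch \<open>(\<alpha>, \<beta>)\<close> keeps some labels of a constant vector,
  relabels them and attaches phases, which yields a flat vector whose support injects into the
  \<open>2 ^ m\<close> input labels. The last identity is trace preservation.\<close>

theorem PIO_max_coh_output:
  assumes "PIO (2 ^ m) b \<Lambda>"
  shows "\<Lambda> (max_coh m) \<in> carrier_mat b b \<and> (\<exists>(T :: (nat \<times> nat) set) q w. finite T \<and>
    (\<forall>t\<in>T. q t \<ge> 0 \<and> flat b (w t) \<and> wt b (w t) \<le> 2 ^ m) \<and>
    (\<forall>x<b. \<forall>y<b. \<Lambda> (max_coh m) $$ (x, y) = (\<Sum>t\<in>T. complex_of_real (q t) * (w t x * cnj (w t y)))) \<and>
    (\<Sum>t\<in>T. q t * real (wt b (w t))) = 1)"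
proof -
  let ?M = "2 ^ m :: nat"
  let ?X = "max_coh m"
  from assms obtain D \<iota> \<kappa> \<Phi> where
    \<iota>: "inj_on \<iota> {..<?M}" "\<iota> ` {..<?M} \<subseteq> {..<D}" and
    \<kappa>: "inj_on \<kappa> {..<b}" "\<kappa> ` {..<b} \<subseteq> {..<D}" and
    Phi: "PIO_square D \<Phi>" and
    \<Lambda>: "\<And>X. X \<in> carrier_mat ?M ?M \<Longrightarrow> \<Lambda> X \<in> carrier_mat b b"
       "\<And>X. X \<in> carrier_mat ?M ?M \<Longrightarrow> \<Phi> (embed D \<iota> X) = embed D \<kappa> (\<Lambda> X)"
    unfolding PIO_def by blast
  obtain N M p U I where NM: "(\<forall>\<alpha><(N::nat). p \<alpha> \<ge> (0::real)) \<and> (\<Sum>\<alpha><N. p \<alpha>) = 1 \<and>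
      (\<forall>\<alpha><N. \<forall>\<beta><(M::nat). incoh_unitary D (U \<alpha> \<beta>) \<and> I \<alpha> \<beta> \<subseteq> {..<D}) \<and>
      (\<forall>\<alpha><N. mat D D (\<lambda>(i,j). \<Sum>\<beta><M. incoh_proj D (I \<alpha> \<beta>) $$ (i,j)) = 1\<^sub>m D) \<and>
      (\<forall>X \<in> carrier_mat D D. \<Phi> X = mat D D (\<lambda>(i,j). \<Sum>\<alpha><N. complex_of_real (p \<alpha>) *
          (\<Sum>\<beta><M. (U \<alpha> \<beta> * incoh_proj D (I \<alpha> \<beta>) * X * incoh_proj D (I \<alpha> \<beta>)
                     * dagger (U \<alpha> \<beta>)) $$ (i,j))))"
    using Phi unfolding PIO_square_def by (elim exE) (rule that)
  note p = NM[THEN conjunct1] NM[THEN conjunct2, THEN conjunct1]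
  note UI = NM[THEN conjunct2, THEN conjunct2, THEN conjunct1, rule_format]
  note I1 = NM[THEN conjunct2, THEN conjunct2, THEN conjunct2, THEN conjunct1, rule_format]
  note Phi_eq = NM[THEN conjunct2, THEN conjunct2, THEN conjunct2, THEN conjunct2, rule_format]
  have "\<forall>\<alpha>. \<forall>\<beta>. \<exists>\<sigma> c. \<alpha> < N \<and> \<beta> < M \<longrightarrow> \<sigma> permutes {..<D} \<and> (\<forall>i<D. cmod (c i) = 1) \<and>
      U \<alpha> \<beta> = perm_mat D \<sigma> * diag_of D c"
    using UI unfolding incoh_unitary_def by blast
  then obtain \<sigma> c where \<sigma>c: "\<And>\<alpha> \<beta>. \<alpha> < N \<Longrightarrow> \<beta> < M \<Longrightarrow> \<sigma> \<alpha> \<beta> permutes {..<D}"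
      "\<And>\<alpha> \<beta> i. \<alpha> < N \<Longrightarrow> \<beta> < M \<Longrightarrow> i < D \<Longrightarrow> cmod (c \<alpha> \<beta> i) = 1"
      "\<And>\<alpha> \<beta>. \<alpha> < N \<Longrightarrow> \<beta> < M \<Longrightarrow> U \<alpha> \<beta> = perm_mat D (\<sigma> \<alpha> \<beta>) * diag_of D (c \<alpha> \<beta>)"
    by metis
  define E where "E = embed D \<iota> ?X"
  have Ec: "E \<in> carrier_mat D D" by (simp add: E_def embed_carrier)
  note LX = \<Lambda>(1)[OF max_coh_carrier] \<Lambda>(2)[OF max_coh_carrier]
  have invD: "pinv (\<sigma> \<alpha> \<beta>) i < D" if "\<alpha> < N" "\<beta> < M" "i < D" for \<alpha> \<beta> i
    using permutes_in_image[OF permutes_inv[OF \<sigma>c(1)[OF that(1,2)]], of i] that by simp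
  define tm where "tm = (\<lambda>\<alpha> \<beta> i j. if pinv (\<sigma> \<alpha> \<beta>) i \<in> I \<alpha> \<beta> \<and> pinv (\<sigma> \<alpha> \<beta>) j \<in> I \<alpha> \<beta>
     then c \<alpha> \<beta> (pinv (\<sigma> \<alpha> \<beta>) i) * cnj (c \<alpha> \<beta> (pinv (\<sigma> \<alpha> \<beta>) j)) * E $$ (pinv (\<sigma> \<alpha> \<beta>) i, pinv (\<sigma> \<alpha> \<beta>) j) else 0)"
  have out: "\<Phi> E $$ (i, j) = (\<Sum>\<alpha><N. complex_of_real (p \<alpha>) * (\<Sum>\<beta><M. tm \<alpha> \<beta> i j))"
    if "i < D" "j < D" for i j
  proof -
    have "\<Phi> E $$ (i, j) = (\<Sum>\<alpha><N. complex_of_real (p \<alpha>) *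
          (\<Sum>\<beta><M. (U \<alpha> \<beta> * incoh_proj D (I \<alpha> \<beta>) * E * incoh_proj D (I \<alpha> \<beta>)
                     * dagger (U \<alpha> \<beta>)) $$ (i,j)))"
      unfolding Phi_eq[OF Ec] using that by simp
    also have "\<dots> = (\<Sum>\<alpha><N. complex_of_real (p \<alpha>) * (\<Sum>\<beta><M. tm \<alpha> \<beta> i j))"
    proof (intro sum.cong refl arg_cong2[of _ _ _ _ "(*)"])
      fix \<alpha> \<beta> assume "\<alpha> \<in> {..<N}" "\<beta> \<in> {..<M}"
      then have ab: "\<alpha> < N" "\<beta> < M" by auto
      show "(U \<alpha> \<beta> * incoh_proj D (I \<alpha> \<beta>) * E * incoh_proj D (I \<alpha> \<beta>) * dagger (U \<alpha> \<beta>)) $$ (i,j) = tm \<alpha> \<beta> i j"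
        unfolding \<sigma>c(3)[OF ab] tm_def by (rule measured_conjugation_entry[OF \<sigma>c(1)[OF ab] Ec that])
    qed
    finally show ?thesis .
  qed
  have E_entry: "E $$ (x, y) = (if x \<in> \<iota> ` {..<?M} \<and> y \<in> \<iota> ` {..<?M} then complex_of_real (1 / 2 ^ m) else 0)"
    if "x < D" "y < D" for x y
  proof (cases "x \<in> \<iota> ` {..<?M} \<and> y \<in> \<iota> ` {..<?M}")
    case True
    then obtain x' y' where "x' < ?M" "y' < ?M" "x = \<iota> x'" "y = \<iota> y'" by auto
    then show ?thesis
      using embed_entry(1)[OF \<iota> max_coh_carrier] max_coh_entry unfolding E_def by auto
  next
    case False
    then show ?thesis using embed_entry(2)[OF \<iota> max_coh_carrier that] unfolding E_def by auto
  qed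
  define T where "T = {..<N} \<times> {..<M}"
  \<comment> \<open>\<open>1 / 2 ^ m\<close> is the common entry of the maximally coherent state;
    taking it out leaves each branch vector with unimodular entries.\<close>
  define q where "q = (\<lambda>(\<alpha>, \<beta> :: nat). p \<alpha> / 2 ^ m)"
  define w where "w = (\<lambda>(\<alpha>, \<beta>) z. let x = pinv (\<sigma> \<alpha> \<beta>) (\<kappa> z) in
     if x \<in> I \<alpha> \<beta> \<and> x \<in> \<iota> ` {..<?M} then c \<alpha> \<beta> x else 0)"
  have \<kappa>D: "\<kappa> z < D" if "z < b" for z using \<kappa>(2) that by auto
  have fin: "finite T" by (simp add: T_def)
  have flat: "flat b (w t)" if "t \<in> T" for t
    unfolding flat_def
  proof (intro allI impI)
    fix z assume z: "z < b"
    obtain \<alpha> \<beta> where t: "t = (\<alpha>, \<beta>)" "\<alpha> < N" "\<beta> < M" using \<open>t \<in> T\<close> by (auto simp: T_def)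
    show "w t z = 0 \<or> cmod (w t z) = 1"
      using \<sigma>c(2)[OF t(2,3) invD[OF t(2,3) \<kappa>D[OF z]]] by (simp add: w_def t Let_def)
  qed
  have wt: "wt b (w t) \<le> ?M" if "t \<in> T" for t
  proof -
    obtain \<alpha> \<beta> where t: "t = (\<alpha>, \<beta>)" "\<alpha> < N" "\<beta> < M" using \<open>t \<in> T\<close> by (auto simp: T_def)
    have "inj_on (\<lambda>z. pinv (\<sigma> \<alpha> \<beta>) (\<kappa> z)) {..<b}"
      using \<kappa>(1) inj_on_subset[OF permutes_inj[OF permutes_inv[OF \<sigma>c(1)[OF t(2,3)]]] subset_UNIV]
        comp_inj_on[of \<kappa> "{..<b}" "pinv (\<sigma> \<alpha> \<beta>)"] by (simp add: comp_def)
    then have "inj_on (\<lambda>z. pinv (\<sigma> \<alpha> \<beta>) (\<kappa> z)) {z. z < b \<and> w t z \<noteq> 0}"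
      by (rule inj_on_subset) auto
    moreover have "(\<lambda>z. pinv (\<sigma> \<alpha> \<beta>) (\<kappa> z)) ` {z. z < b \<and> w t z \<noteq> 0} \<subseteq> \<iota> ` {..<?M}"
      by (auto simp: w_def t Let_def split: if_splits)
    ultimately have "card {z. z < b \<and> w t z \<noteq> 0} \<le> card (\<iota> ` {..<?M})"
      by (intro card_inj_on_le) auto
    also have "\<dots> \<le> ?M" using card_image_le[of "{..<?M}" \<iota>] by simp
    finally show ?thesis by (simp add: wt_def)
  qed
  have ent: "\<Lambda> ?X $$ (x, y) = (\<Sum>t\<in>T. complex_of_real (q t) * (w t x * cnj (w t y)))"
    if xy: "x < b" "y < b" for x y
  proof -
    have "\<Lambda> ?X $$ (x, y) = \<Phi> E $$ (\<kappa> x, \<kappa> y)"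
      unfolding E_def LX(2) using embed_entry(1)[OF \<kappa> LX(1) xy] by simp
    also have "\<dots> = (\<Sum>\<alpha><N. \<Sum>\<beta><M. complex_of_real (p \<alpha>) * tm \<alpha> \<beta> (\<kappa> x) (\<kappa> y))"
      unfolding out[OF \<kappa>D[OF xy(1)] \<kappa>D[OF xy(2)]] by (simp add: sum_distrib_left)
    also have "\<dots> = (\<Sum>\<alpha><N. \<Sum>\<beta><M. complex_of_real (q (\<alpha>, \<beta>)) * (w (\<alpha>, \<beta>) x * cnj (w (\<alpha>, \<beta>) y)))"
    proof (intro sum.cong refl)
      fix \<alpha> \<beta> assume "\<alpha> \<in> {..<N}" "\<beta> \<in> {..<M}"
      then have ab: "\<alpha> < N" "\<beta> < M" by auto
      show "complex_of_real (p \<alpha>) * tm \<alpha> \<beta> (\<kappa> x) (\<kappa> y) =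
          complex_of_real (q (\<alpha>, \<beta>)) * (w (\<alpha>, \<beta>) x * cnj (w (\<alpha>, \<beta>) y))"
        using invD[OF ab \<kappa>D[OF xy(1)]] invD[OF ab \<kappa>D[OF xy(2)]]
        by (simp add: tm_def q_def w_def E_entry Let_def)
    qed
    also have "\<dots> = (\<Sum>t\<in>T. complex_of_real (q t) * (w t x * cnj (w t y)))"
      unfolding T_def by (simp only: sum.cartesian_product prod.collapse split_def)
    finally show ?thesis .
  qed
  have q: "q t \<ge> 0" if "t \<in> T" for t using that p by (auto simp: q_def T_def)
  have total: "(\<Sum>t\<in>T. q t * real (wt b (w t))) = 1"
  proof -
    have "complex_of_real (\<Sum>t\<in>T. q t * real (wt b (w t))) =
        (\<Sum>t\<in>T. \<Sum>x<b. complex_of_real (q t) * (w t x * cnj (w t x)))"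
      using flat by (simp add: sum_distrib_left[symmetric] flat_self_product)
    also have "\<dots> = (\<Sum>x<b. \<Lambda> ?X $$ (x, x))"
      by (subst sum.swap) (simp add: ent)
    \<comment> \<open>Restricting to the labels in the range of \<open>\<kappa>\<close> loses no
      trace, because \<open>PIO\<close> requires the whole output to be embedded there.\<close>
    also have "\<dots> = (\<Sum>i<D. \<Phi> E $$ (i, i))"
      unfolding E_def LX(2) using embed_trace[OF \<kappa> LX(1)] by simp
    also have "\<dots> = (\<Sum>i<D. \<Sum>\<alpha><N. complex_of_real (p \<alpha>) * (\<Sum>\<beta><M. tm \<alpha> \<beta> i i))"
      by (intro sum.cong refl out) auto
    also have "\<dots> = (\<Sum>\<alpha><N. complex_of_real (p \<alpha>) * (\<Sum>i<D. \<Sum>\<beta><M. tm \<alpha> \<beta> i i))"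
      by (subst sum.swap) (simp only: sum_distrib_left)
    also have "\<dots> = (\<Sum>\<alpha><N. complex_of_real (p \<alpha>))"
    proof (intro sum.cong refl)
      fix \<alpha> assume "\<alpha> \<in> {..<N}"
      then have a: "\<alpha> < N" by simp
      have "(\<Sum>i<D. \<Sum>\<beta><M. tm \<alpha> \<beta> i i) = (\<Sum>\<beta><M. \<Sum>i<D. tm \<alpha> \<beta> i i)" by (rule sum.swap)
      also have "\<dots> = (\<Sum>\<beta><M. \<Sum>x<D. if x \<in> I \<alpha> \<beta> then E $$ (x, x) else 0)"
      proof (rule sum.cong[OF refl])
        fix \<beta> assume "\<beta> \<in> {..<M}"
        then have b: "\<beta> < M" by simp
        have "(\<Sum>i<D. tm \<alpha> \<beta> i i) = (\<Sum>i<D. (\<lambda>x. if x \<in> I \<alpha> \<beta> then E $$ (x, x) else 0) (pinv (\<sigma> \<alpha> \<beta>) i))"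
        proof (intro sum.cong refl)
          fix i assume "i \<in> {..<D}"
          then have "cmod (c \<alpha> \<beta> (pinv (\<sigma> \<alpha> \<beta>) i)) = 1" using \<sigma>c(2)[OF a b] invD[OF a b] by simp
          then have "c \<alpha> \<beta> (pinv (\<sigma> \<alpha> \<beta>) i) * cnj (c \<alpha> \<beta> (pinv (\<sigma> \<alpha> \<beta>) i)) = 1"
            by (simp add: complex_norm_square[symmetric])
          then show "tm \<alpha> \<beta> i i = (\<lambda>x. if x \<in> I \<alpha> \<beta> then E $$ (x, x) else 0) (pinv (\<sigma> \<alpha> \<beta>) i)"
            by (simp add: tm_def)
        qed
        also have "\<dots> = (\<Sum>x<D. if x \<in> I \<alpha> \<beta> then E $$ (x, x) else 0)"
          by (rule sum.permute[OF permutes_inv[OF \<sigma>c(1)[OF a b]], unfolded comp_def, symmetric])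
        finally show "(\<Sum>i<D. tm \<alpha> \<beta> i i) = (\<Sum>x<D. if x \<in> I \<alpha> \<beta> then E $$ (x, x) else 0)" .
      qed
      \<comment> \<open>The permutation and phases are gone from the trace; completeness of the
        projectors now counts every label once.\<close>
      also have "\<dots> = (\<Sum>x<D. \<Sum>\<beta><M. if x \<in> I \<alpha> \<beta> then E $$ (x, x) else 0)" by (rule sum.swap)
      also have "\<dots> = (\<Sum>x<D. E $$ (x, x) * (\<Sum>\<beta><M. if x \<in> I \<alpha> \<beta> then 1 else 0))"
        by (simp add: sum_distrib_left if_distrib cong: if_cong)
      also have "\<dots> = (\<Sum>x<D. E $$ (x, x))"
        using projectors_complete[OF I1[OF a]] by simp
      also have "\<dots> = (\<Sum>x<?M. ?X $$ (x, x))"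
        unfolding E_def by (rule embed_trace[OF \<iota> max_coh_carrier])
      also have "\<dots> = 1" by (simp add: max_coh_entry)
      finally show "complex_of_real (p \<alpha>) * (\<Sum>i<D. \<Sum>\<beta><M. tm \<alpha> \<beta> i i) = complex_of_real (p \<alpha>)" by simp
    qed
    also have "\<dots> = 1" using p(2) by (simp flip: of_real_sum)
    finally show ?thesis by (simp only: of_real_eq_1_iff)
  qed
  show ?thesis
    by (intro conjI exI[of _ T] exI[of _ q] exI[of _ w] ballI allI impI LX(1) fin q flat wt ent total)
qed

section \<open>Block measurements of the maximally coherent state\<close>

lemma extend_to_permutation:
  assumes fin: "finite S" and A: "A \<subseteq> S" "inj_on g A" "g ` A \<subseteq> S"
  shows "\<exists>\<sigma>. \<sigma> permutes S \<and> (\<forall>x\<in>A. \<sigma> x = g x)"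
proof -
  have "finite A" using fin A(1) by (rule finite_subset[rotated])
  then have "card (S - A) = card (S - g ` A)"
    using fin A by (simp add: card_Diff_subset card_image)
  then obtain h where h: "bij_betw h (S - A) (S - g ` A)"
    using fin by (metis finite_Diff finite_same_card_bij)
  \<comment> \<open>An incoherent unitary must permute all labels, although only its action on one
    block matters; off \<open>A\<close> any bijection between the complements will do.\<close>
  define \<sigma> where "\<sigma> = (\<lambda>x. if x \<in> A then g x else if x \<in> S then h x else x)"
  have "bij_betw \<sigma> A (g ` A)"
    using A(2) by (intro bij_betw_imageI) (auto simp: \<sigma>_def inj_on_def)
  moreover have "bij_betw \<sigma> (S - A) (S - g ` A)"
    using h by (rule bij_betw_cong[THEN iffD1, rotated]) (auto simp: \<sigma>_def)
  ultimately have "bij_betw \<sigma> (A \<union> (S - A)) (g ` A \<union> (S - g ` A))"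
    by (rule bij_betw_combine) auto
  moreover have "A \<union> (S - A) = S" "g ` A \<union> (S - g ` A) = S" using A by auto
  ultimately have "\<sigma> permutes S"
    using A(1) by (intro bij_imp_permutes) (auto simp: \<sigma>_def)
  then show ?thesis by (intro exI[of _ \<sigma>]) (auto simp: \<sigma>_def)
qed

text \<open>Cutting the first \<open>M\<close> basis labels into consecutive blocks of length \<open>K = wt b u\<close> and mapping
  each block onto the support of \<open>u\<close> turns every full block into \<open>u\<close>; the remainder \<open>r\<close> comes
  from the last, incomplete block.\<close>

lemma block_decomposition:
  assumes u: "flat b u" and K: "K = wt b u" "K > 0" and D: "b \<le> D" "M \<le> D"
  shows "\<exists>\<sigma> c r. (\<forall>\<beta>. \<sigma> \<beta> permutes {..<D}) \<and> (\<forall>\<beta> x. cmod (c \<beta> x) = 1) \<and>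
    (\<forall>\<beta> i. b \<le> i \<longrightarrow> i < D \<longrightarrow> pinv (\<sigma> \<beta>) i div K \<noteq> \<beta>) \<and>
    (\<Sum>i<b. (cmod (r i))\<^sup>2) \<le> real (M mod K) \<and>
    (\<forall>i<b. \<forall>j<b. (\<Sum>\<beta><Suc D. (if pinv (\<sigma> \<beta>) i div K = \<beta> \<and> pinv (\<sigma> \<beta>) i < M then c \<beta> (pinv (\<sigma> \<beta>) i) else 0) *
       cnj (if pinv (\<sigma> \<beta>) j div K = \<beta> \<and> pinv (\<sigma> \<beta>) j < M then c \<beta> (pinv (\<sigma> \<beta>) j) else 0)) =
       of_nat (M div K) * (u i * cnj (u j)) + r i * cnj (r j))"
proof -
  define J where "J = {i. i < b \<and> u i \<noteq> 0}"
  have J: "finite J" "card J = K" "J \<subseteq> {..<b}" by (auto simp: J_def K wt_def)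
  obtain e where e: "bij_betw e {..<K} J"
    using ex_bij_betw_nat_finite[OF J(1)] J(2) by (auto simp: lessThan_atLeast0)
  define B where "B = (\<lambda>\<beta>. {x. x < D \<and> x div K = \<beta>})"
  \<comment> \<open>The target label depends only on the position inside the block, so all full
    blocks yield the same vector.\<close>
  define g where "g = (\<lambda>x. e (x mod K))"
  have gJ: "g x \<in> J" for x using bij_betw_apply[OF e] K(2) by (simp add: g_def)
  have inj: "inj_on g (B \<beta>)" for \<beta>
  proof (rule inj_onI)
    fix x y assume xy: "x \<in> B \<beta>" "y \<in> B \<beta>" "g x = g y"
    then have "x mod K = y mod K"
      using bij_betw_imp_inj_on[OF e] K(2) unfolding g_def inj_on_def by simp
    moreover have "x div K = y div K" using xy by (simp add: B_def)
    ultimately show "x = y" by (metis div_mult_mod_eq)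
  qed
  have "\<forall>\<beta>. \<exists>\<sigma>. \<sigma> permutes {..<D} \<and> (\<forall>x\<in>B \<beta>. \<sigma> x = g x)"
  proof
    fix \<beta>
    have "J \<subseteq> {..<D}" using J(3) D(1) by auto
    then have "g ` B \<beta> \<subseteq> {..<D}" using gJ by blast
    then show "\<exists>\<sigma>. \<sigma> permutes {..<D} \<and> (\<forall>x\<in>B \<beta>. \<sigma> x = g x)"
      by (intro extend_to_permutation inj) (auto simp: B_def)
  qed
  from choice[OF this] obtain \<sigma> where \<sigma>: "\<And>\<beta>. \<sigma> \<beta> permutes {..<D}" "\<And>\<beta> x. x \<in> B \<beta> \<Longrightarrow> \<sigma> \<beta> x = g x"
    by blast
  \<comment> \<open>Phases must be unimodular also where \<open>u\<close> vanishes, hence the dummy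
    value 1; no selected label is mapped there.\<close>
  define \<phi> where "\<phi> = (\<lambda>i. if i \<in> J then u i else 1)"
  have \<phi>: "cmod (\<phi> i) = 1" for i using u by (auto simp: \<phi>_def J_def flat_def)
  define c where "c = (\<lambda>\<beta> x. \<phi> (\<sigma> \<beta> x))"
  have invs: "\<sigma> \<beta> (pinv (\<sigma> \<beta>) i) = i" for \<beta> i using permutes_inverses(1)[OF \<sigma>(1)] .
  have invD: "pinv (\<sigma> \<beta>) i < D" if "i < D" for \<beta> i
    using permutes_in_image[OF permutes_inv[OF \<sigma>(1)], of \<beta> i] that by simp
  have inB: "i \<in> J \<and> i = e (pinv (\<sigma> \<beta>) i mod K)" if "i < D" "pinv (\<sigma> \<beta>) i div K = \<beta>" for i \<beta>
  proof -
    have "pinv (\<sigma> \<beta>) i \<in> B \<beta>" using invD that by (simp add: B_def)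
    then have "g (pinv (\<sigma> \<beta>) i) = i" using \<sigma>(2) invs by metis
    then show ?thesis using gJ[of "pinv (\<sigma> \<beta>) i"] by (simp add: g_def)
  qed
  define w where "w = (\<lambda>\<beta> i. if pinv (\<sigma> \<beta>) i div K = \<beta> \<and> pinv (\<sigma> \<beta>) i < M then c \<beta> (pinv (\<sigma> \<beta>) i) else 0)"
  have w_full: "w \<beta> i = u i" if \<beta>: "\<beta> < M div K" and i: "i < b" for \<beta> i
  proof (cases "i \<in> J")
    case True
    then obtain k where k: "k < K" "e k = i" using e unfolding bij_betw_def by auto
    have "Suc \<beta> * K \<le> M div K * K" using \<beta> by (intro mult_right_mono) auto
    also have "\<dots> \<le> M" by simp
    finally have lt: "\<beta> * K + k < M" using k by simp
    have dm: "(\<beta> * K + k) div K = \<beta>" "(\<beta> * K + k) mod K = k" using k(1) by simp_all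
    have "\<sigma> \<beta> (\<beta> * K + k) = i"
      using \<sigma>(2)[of "\<beta> * K + k" \<beta>] lt D(2) dm k(2) by (simp add: B_def g_def)
    then have "pinv (\<sigma> \<beta>) i = \<beta> * K + k" using permutes_inv_eq[OF \<sigma>(1)] by blast
    then show ?thesis using dm lt True invs[of \<beta> i] by (simp add: w_def c_def \<phi>_def)
  next
    case False
    then have "u i = 0" using i by (simp add: J_def)
    moreover have "w \<beta> i = 0" using inB[of i \<beta>] False i D(1) by (auto simp: w_def)
    ultimately show ?thesis by simp
  qed
  \<comment> \<open>Outcomes below \<open>q\<close> are full blocks, outcome \<open>q\<close> is the
    remainder (empty if \<open>K\<close> divides \<open>M\<close>), and later blocks miss the input.
    Since \<open>q \<le> M \<le> D\<close>, outcome \<open>q\<close> is among the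
    \<open>Suc D\<close> outcomes.\<close>
  define q where "q = M div K"
  have w_empty: "w \<beta> i = 0" if "\<beta> > q" for \<beta> i
  proof -
    have "pinv (\<sigma> \<beta>) i div K \<le> q" if "pinv (\<sigma> \<beta>) i < M"
      using that unfolding q_def by (intro div_le_mono) simp
    then show ?thesis using that by (auto simp: w_def)
  qed
  define r where "r = w q"
  have sum_w: "(\<Sum>\<beta><Suc D. w \<beta> i * cnj (w \<beta> j)) = of_nat q * (u i * cnj (u j)) + r i * cnj (r j)"
    if "i < b" "j < b" for i j
  proof -
    have "q \<le> M" by (simp add: q_def)
    then have qD: "q \<le> D" using D(2) by simp
    have "(\<Sum>\<beta><Suc D. w \<beta> i * cnj (w \<beta> j)) = (\<Sum>\<beta><Suc q. w \<beta> i * cnj (w \<beta> j))"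
      using qD w_empty by (intro sum.mono_neutral_right) auto
    also have "\<dots> = (\<Sum>\<beta><q. u i * cnj (u j)) + r i * cnj (r j)"
      using w_full that by (simp add: r_def q_def)
    finally show ?thesis by simp
  qed
  have "(\<Sum>i<b. (cmod (r i))\<^sup>2) \<le> real (M mod K)"
  proof -
    have "\<phi> i \<noteq> 0" for i using \<phi>[of i] by auto
    then have "(\<Sum>i<b. (cmod (r i))\<^sup>2) = (\<Sum>i<b. of_bool (r i \<noteq> 0))"
      using \<phi> by (intro sum.cong) (auto simp: r_def w_def c_def)
    also have "\<dots> = real (wt b r)" by (rule wt_sum_of_bool[symmetric])
    also have "wt b r \<le> M mod K"
    proof -
      \<comment> \<open>The labels below \<open>M\<close> in the incomplete block number
        \<open>M mod K\<close>, which bounds the unimodular entries of \<open>r\<close>.\<close>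
      have "pinv (\<sigma> q) ` {i. i < b \<and> r i \<noteq> 0} \<subseteq> {q * K..<M}"
      proof
        fix x assume "x \<in> pinv (\<sigma> q) ` {i. i < b \<and> r i \<noteq> 0}"
        then have x: "x div K = q" "x < M" by (auto simp: r_def w_def split: if_splits)
        then have "q * K \<le> x" using div_times_less_eq_dividend by blast
        with x show "x \<in> {q * K..<M}" by simp
      qed
      moreover have "inj_on (pinv (\<sigma> q)) {i. i < b \<and> r i \<noteq> 0}"
        using permutes_inj[OF permutes_inv[OF \<sigma>(1)[of q]]] by (rule inj_on_subset) simp
      ultimately have "card {i. i < b \<and> r i \<noteq> 0} \<le> card {q * K..<M}"
        by (intro card_inj_on_le) auto
      also have "\<dots> = M mod K" by (simp add: q_def minus_div_mult_eq_mod)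
      finally show ?thesis by (simp add: wt_def)
    qed
    finally show ?thesis by simp
  qed
  moreover have "pinv (\<sigma> \<beta>) i div K \<noteq> \<beta>" if "b \<le> i" "i < D" for \<beta> i
    using inB[OF that(2)] J(3) that(1) by fastforce
  ultimately show ?thesis
    using \<sigma>(1) \<phi> sum_w unfolding w_def q_def
    by (intro exI[of _ \<sigma>] exI[of _ c] exI[of _ r]) (simp add: c_def)
qed

text \<open>With probability \<open>p \<alpha>\<close> the block measurement for the target
  \<open>u \<alpha>\<close> is performed. The factor 2 arises because the remainder costs
  \<open>(M mod K) / M\<close> twice: as an unwanted term and as weight missing from the
  target.\<close>

theorem block_measurement_PIO:
  fixes u :: "nat \<Rightarrow> nat \<Rightarrow> complex"
  assumes p: "\<And>\<alpha>. \<alpha> < N \<Longrightarrow> p \<alpha> \<ge> 0" "(\<Sum>\<alpha><N. p \<alpha>) = 1"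
    and u: "\<And>\<alpha>. \<alpha> < N \<Longrightarrow> flat b (u \<alpha>)" "\<And>\<alpha>. \<alpha> < N \<Longrightarrow> wt b (u \<alpha>) > 0"
  shows "\<exists>\<Lambda>. PIO (2 ^ m) b \<Lambda> \<and>
    trace_norm (\<Lambda> (max_coh m) - mat b b (\<lambda>(i, j). \<Sum>\<alpha><N. complex_of_real (p \<alpha> / real (wt b (u \<alpha>))) * (u \<alpha> i * cnj (u \<alpha> j))))
      \<le> (\<Sum>\<alpha><N. p \<alpha> * (2 * real (2 ^ m mod wt b (u \<alpha>)) / 2 ^ m))"
proof -
  define M where "M = (2 ^ m :: nat)"
  have M0: "M > 0" and Mr: "real M = 2 ^ m" by (simp_all add: M_def)
  \<comment> \<open>Input and output space are initial segments of one space, so both embeddings are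
    \<open>id\<close>.\<close>
  define D where "D = max M b"
  have D: "b \<le> D" "M \<le> D" by (simp_all add: D_def)
  define K where "K = (\<lambda>\<alpha>. wt b (u \<alpha>))"
  define S where "S = (\<lambda>\<alpha> \<sigma> c r. (\<forall>\<beta>. \<sigma> \<beta> permutes {..<D}) \<and> (\<forall>\<beta> x. cmod (c \<beta> x) = 1) \<and>
    (\<forall>\<beta> i. b \<le> i \<longrightarrow> i < D \<longrightarrow> pinv (\<sigma> \<beta>) i div K \<alpha> \<noteq> \<beta>) \<and>
    (\<Sum>i<b. (cmod (r i))\<^sup>2) \<le> real (M mod K \<alpha>) \<and>
    (\<forall>i<b. \<forall>j<b. (\<Sum>\<beta><Suc D. (if pinv (\<sigma> \<beta>) i div K \<alpha> = \<beta> \<and> pinv (\<sigma> \<beta>) i < M then c \<beta> (pinv (\<sigma> \<beta>) i) else 0) *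
       cnj (if pinv (\<sigma> \<beta>) j div K \<alpha> = \<beta> \<and> pinv (\<sigma> \<beta>) j < M then c \<beta> (pinv (\<sigma> \<beta>) j) else 0)) =
       of_nat (M div K \<alpha>) * (u \<alpha> i * cnj (u \<alpha> j)) + r i * cnj (r j)))"
  have "\<forall>\<alpha>. \<exists>\<sigma> c r. \<alpha> < N \<longrightarrow> S \<alpha> \<sigma> c r"
  proof
    fix \<alpha>
    show "\<exists>\<sigma> c r. \<alpha> < N \<longrightarrow> S \<alpha> \<sigma> c r"
    proof (cases "\<alpha> < N")
      case True
      have "\<exists>\<sigma> c r. S \<alpha> \<sigma> c r"
        unfolding S_def using u True D by (intro block_decomposition) (simp_all add: K_def)
      then show ?thesis by blast
    qed simp
  qed
  then obtain \<sigma> c r where "\<forall>\<alpha><N. S \<alpha> (\<sigma> \<alpha>) (c \<alpha>) (r \<alpha>)" by metis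
  then have \<sigma>: "\<And>\<alpha> \<beta>. \<alpha> < N \<Longrightarrow> \<sigma> \<alpha> \<beta> permutes {..<D}"
    and c: "\<And>\<alpha> \<beta> x. \<alpha> < N \<Longrightarrow> cmod (c \<alpha> \<beta> x) = 1"
    and out: "\<And>\<alpha> \<beta> i. \<alpha> < N \<Longrightarrow> b \<le> i \<Longrightarrow> i < D \<Longrightarrow> pinv (\<sigma> \<alpha> \<beta>) i div K \<alpha> \<noteq> \<beta>"
    and r: "\<And>\<alpha>. \<alpha> < N \<Longrightarrow> (\<Sum>i<b. (cmod (r \<alpha> i))\<^sup>2) \<le> real (M mod K \<alpha>)"
    and sum_w: "\<And>\<alpha> i j. \<alpha> < N \<Longrightarrow> i < b \<Longrightarrow> j < b \<Longrightarrow> (\<Sum>\<beta><Suc D.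
       (if pinv (\<sigma> \<alpha> \<beta>) i div K \<alpha> = \<beta> \<and> pinv (\<sigma> \<alpha> \<beta>) i < M then c \<alpha> \<beta> (pinv (\<sigma> \<alpha> \<beta>) i) else 0) *
       cnj (if pinv (\<sigma> \<alpha> \<beta>) j div K \<alpha> = \<beta> \<and> pinv (\<sigma> \<alpha> \<beta>) j < M then c \<alpha> \<beta> (pinv (\<sigma> \<alpha> \<beta>) j) else 0)) =
       of_nat (M div K \<alpha>) * (u \<alpha> i * cnj (u \<alpha> j)) + r \<alpha> i * cnj (r \<alpha> j)"
    unfolding S_def by simp_all
  define I where "I = (\<lambda>\<alpha> \<beta>. {x. x < D \<and> x div K \<alpha> = \<beta>})"
  define U where "U = (\<lambda>\<alpha> \<beta>. perm_mat D (\<sigma> \<alpha> \<beta>) * diag_of D (c \<alpha> \<beta>))"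
  define \<Phi> where "\<Phi> = (\<lambda>X. mat D D (\<lambda>(i,j). \<Sum>\<alpha><N. complex_of_real (p \<alpha>) *
          (\<Sum>\<beta><Suc D. (U \<alpha> \<beta> * incoh_proj D (I \<alpha> \<beta>) * X * incoh_proj D (I \<alpha> \<beta>)
                     * dagger (U \<alpha> \<beta>)) $$ (i,j))))"
  define \<Lambda> where "\<Lambda> = (\<lambda>X. mat b b (\<lambda>(i,j). \<Phi> (embed D id X) $$ (i, j)))"
  have invD: "pinv (\<sigma> \<alpha> \<beta>) i < D" if "\<alpha> < N" "i < D" for \<alpha> \<beta> i
    using permutes_in_image[OF permutes_inv[OF \<sigma>[OF that(1)]], of \<beta> i] that by simp
  have Phi_entry: "\<Phi> X $$ (i, j) = (\<Sum>\<alpha><N. complex_of_real (p \<alpha>) * (\<Sum>\<beta><Suc D.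
      if pinv (\<sigma> \<alpha> \<beta>) i div K \<alpha> = \<beta> \<and> pinv (\<sigma> \<alpha> \<beta>) j div K \<alpha> = \<beta> then
      c \<alpha> \<beta> (pinv (\<sigma> \<alpha> \<beta>) i) * cnj (c \<alpha> \<beta> (pinv (\<sigma> \<alpha> \<beta>) j)) * X $$ (pinv (\<sigma> \<alpha> \<beta>) i, pinv (\<sigma> \<alpha> \<beta>) j) else 0))"
    if X: "X \<in> carrier_mat D D" and ij: "i < D" "j < D" for X i j
  proof -
    have "\<Phi> X $$ (i, j) = (\<Sum>\<alpha><N. complex_of_real (p \<alpha>) *
          (\<Sum>\<beta><Suc D. (U \<alpha> \<beta> * incoh_proj D (I \<alpha> \<beta>) * X * incoh_proj D (I \<alpha> \<beta>)
                     * dagger (U \<alpha> \<beta>)) $$ (i,j)))"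
      using ij by (simp add: \<Phi>_def)
    also have "\<dots> = (\<Sum>\<alpha><N. complex_of_real (p \<alpha>) * (\<Sum>\<beta><Suc D.
      if pinv (\<sigma> \<alpha> \<beta>) i div K \<alpha> = \<beta> \<and> pinv (\<sigma> \<alpha> \<beta>) j div K \<alpha> = \<beta> then
      c \<alpha> \<beta> (pinv (\<sigma> \<alpha> \<beta>) i) * cnj (c \<alpha> \<beta> (pinv (\<sigma> \<alpha> \<beta>) j)) * X $$ (pinv (\<sigma> \<alpha> \<beta>) i, pinv (\<sigma> \<alpha> \<beta>) j) else 0))"
    proof (intro sum.cong refl arg_cong2[of _ _ _ _ "(*)"])
      fix \<alpha> \<beta> assume "\<alpha> \<in> {..<N}" "\<beta> \<in> {..<Suc D}"
      then have a: "\<alpha> < N" by simp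
      show "(U \<alpha> \<beta> * incoh_proj D (I \<alpha> \<beta>) * X * incoh_proj D (I \<alpha> \<beta>) * dagger (U \<alpha> \<beta>)) $$ (i,j) =
        (if pinv (\<sigma> \<alpha> \<beta>) i div K \<alpha> = \<beta> \<and> pinv (\<sigma> \<alpha> \<beta>) j div K \<alpha> = \<beta> then
        c \<alpha> \<beta> (pinv (\<sigma> \<alpha> \<beta>) i) * cnj (c \<alpha> \<beta> (pinv (\<sigma> \<alpha> \<beta>) j)) * X $$ (pinv (\<sigma> \<alpha> \<beta>) i, pinv (\<sigma> \<alpha> \<beta>) j) else 0)"
        unfolding U_def measured_conjugation_entry[OF \<sigma>[OF a] X ij]
        using invD[OF a] ij by (simp add: I_def)
    qed
    finally show ?thesis .
  qed
  have "PIO_square D \<Phi>"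
  proof -
    have "incoh_unitary D (U \<alpha> \<beta>) \<and> I \<alpha> \<beta> \<subseteq> {..<D}" if "\<alpha> < N" for \<alpha> \<beta>
      unfolding incoh_unitary_def using \<sigma>[OF that] c[OF that]
      by (auto simp: U_def I_def intro!: exI[of _ "\<sigma> \<alpha> \<beta>"] exI[of _ "c \<alpha> \<beta>"])
    moreover have "mat D D (\<lambda>(i,j). \<Sum>\<beta><Suc D. incoh_proj D (I \<alpha> \<beta>) $$ (i,j)) = 1\<^sub>m D" for \<alpha>
    proof (rule eq_matI)
      fix i j assume "i < dim_row (1\<^sub>m D :: complex mat)" "j < dim_col (1\<^sub>m D :: complex mat)"
      then have ij: "i < D" "j < D" by simp_all
      have "i div K \<alpha> < Suc D" using ij by (meson div_le_dividend le_less_trans less_SucI)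
      have "(\<Sum>\<beta><Suc D. incoh_proj D (I \<alpha> \<beta>) $$ (i,j)) =
          (\<Sum>\<beta><Suc D. if \<beta> = i div K \<alpha> then (if i = j then 1 else 0) else 0)"
        using ij by (intro sum.cong) (auto simp: incoh_proj_def I_def)
      also have "\<dots> = (if i = j then 1 else 0)"
        using \<open>i div K \<alpha> < Suc D\<close> by (simp only: sum.delta finite_lessThan lessThan_iff if_True)
      finally show "mat D D (\<lambda>(i,j). \<Sum>\<beta><Suc D. incoh_proj D (I \<alpha> \<beta>) $$ (i,j)) $$ (i, j) = 1\<^sub>m D $$ (i, j)"
        using ij by simp
    qed simp_all
    ultimately show ?thesis
      unfolding PIO_square_def
      by (intro exI[of _ N] exI[of _ "Suc D"] exI[of _ p] exI[of _ U] exI[of _ I] conjI)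
        (use p in \<open>simp_all add: \<Phi>_def\<close>)
  qed
  moreover have emb: "\<Phi> (embed D id X) = embed D id (\<Lambda> X)" for X
  proof (rule eq_matI)
    fix i j assume "i < dim_row (embed D id (\<Lambda> X))" "j < dim_col (embed D id (\<Lambda> X))"
    then have ij: "i < D" "j < D" by (simp_all add: embed_def)
    have Lc: "\<Lambda> X \<in> carrier_mat b b" by (simp add: \<Lambda>_def)
    have id: "inj_on id {..<b}" "id ` {..<b} \<subseteq> {..<D}" using D by auto
    show "\<Phi> (embed D id X) $$ (i, j) = embed D id (\<Lambda> X) $$ (i, j)"
    proof (cases "i < b \<and> j < b")
      case True
      then have "embed D id (\<Lambda> X) $$ (i, j) = \<Lambda> X $$ (i, j)"
        using embed_entry(1)[OF id Lc, of i j] by simp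
      then show ?thesis using True by (simp add: \<Lambda>_def)
    next
      case False
      \<comment> \<open>No block is mapped to a label outside the first \<open>b\<close>, so the
        output has the embedded form that \<open>PIO\<close> demands.\<close>
      have "\<Phi> (embed D id X) $$ (i, j) = (\<Sum>\<alpha><N. complex_of_real (p \<alpha>) * (\<Sum>\<beta><Suc D. 0))"
        unfolding Phi_entry[OF embed_carrier ij]
        using False out ij by (intro sum.cong refl arg_cong2[of _ _ _ _ "(*)"]) (auto simp: not_less)
      moreover have "embed D id (\<Lambda> X) $$ (i, j) = 0"
        using False ij by (intro embed_entry(2)[OF id Lc]) auto
      ultimately show ?thesis by simp
    qed
  qed (simp_all add: \<Phi>_def embed_def)
  ultimately have PIO: "PIO (2 ^ m) b \<Lambda>"
    unfolding PIO_def using D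
    by (intro exI[of _ D] exI[of _ id] exI[of _ \<Phi>]) (auto simp: M_def \<Lambda>_def)
  have idM: "inj_on id {..<2 ^ m}" "id ` {..<2 ^ m} \<subseteq> {..<D}" using D by (auto simp: M_def)
  have E: "embed D id (max_coh m) $$ (x, y) = (if x < M \<and> y < M then complex_of_real (1 / M) else 0)"
    if "x < D" "y < D" for x y
    using embed_entry(1)[OF idM max_coh_carrier, of x y] embed_entry(2)[OF idM max_coh_carrier that]
      max_coh_entry[of x m y] by (auto simp: M_def)
  have Lentry: "\<Lambda> (max_coh m) $$ (i, j) = (\<Sum>\<alpha><N. complex_of_real (p \<alpha> / M) *
      (of_nat (M div K \<alpha>) * (u \<alpha> i * cnj (u \<alpha> j)) + r \<alpha> i * cnj (r \<alpha> j)))"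
    if ij: "i < b" "j < b" for i j
  proof -
    have ijD: "i < D" "j < D" using ij D by auto
    have "\<Lambda> (max_coh m) $$ (i, j) = \<Phi> (embed D id (max_coh m)) $$ (i, j)"
      using ij by (simp add: \<Lambda>_def)
    also have "\<dots> = (\<Sum>\<alpha><N. complex_of_real (p \<alpha> / M) *
      (of_nat (M div K \<alpha>) * (u \<alpha> i * cnj (u \<alpha> j)) + r \<alpha> i * cnj (r \<alpha> j)))"
      unfolding Phi_entry[OF embed_carrier ijD]
    proof (intro sum.cong refl)
      fix \<alpha> assume "\<alpha> \<in> {..<N}"
      then have a: "\<alpha> < N" by simp
      show "complex_of_real (p \<alpha>) * (\<Sum>\<beta><Suc D.
        if pinv (\<sigma> \<alpha> \<beta>) i div K \<alpha> = \<beta> \<and> pinv (\<sigma> \<alpha> \<beta>) j div K \<alpha> = \<beta> then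
        c \<alpha> \<beta> (pinv (\<sigma> \<alpha> \<beta>) i) * cnj (c \<alpha> \<beta> (pinv (\<sigma> \<alpha> \<beta>) j)) *
          embed D id (max_coh m) $$ (pinv (\<sigma> \<alpha> \<beta>) i, pinv (\<sigma> \<alpha> \<beta>) j) else 0) =
        complex_of_real (p \<alpha> / M) * (of_nat (M div K \<alpha>) * (u \<alpha> i * cnj (u \<alpha> j)) + r \<alpha> i * cnj (r \<alpha> j))"
        unfolding sum_w[OF a ij, symmetric] sum_distrib_left
      proof (intro sum.cong refl)
        fix \<beta>
        show "complex_of_real (p \<alpha>) * (if pinv (\<sigma> \<alpha> \<beta>) i div K \<alpha> = \<beta> \<and> pinv (\<sigma> \<alpha> \<beta>) j div K \<alpha> = \<beta> then
          c \<alpha> \<beta> (pinv (\<sigma> \<alpha> \<beta>) i) * cnj (c \<alpha> \<beta> (pinv (\<sigma> \<alpha> \<beta>) j)) *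
          embed D id (max_coh m) $$ (pinv (\<sigma> \<alpha> \<beta>) i, pinv (\<sigma> \<alpha> \<beta>) j) else 0) =
          complex_of_real (p \<alpha> / M) *
          ((if pinv (\<sigma> \<alpha> \<beta>) i div K \<alpha> = \<beta> \<and> pinv (\<sigma> \<alpha> \<beta>) i < M then c \<alpha> \<beta> (pinv (\<sigma> \<alpha> \<beta>) i) else 0) *
          cnj (if pinv (\<sigma> \<alpha> \<beta>) j div K \<alpha> = \<beta> \<and> pinv (\<sigma> \<alpha> \<beta>) j < M then c \<alpha> \<beta> (pinv (\<sigma> \<alpha> \<beta>) j) else 0))"
          unfolding E[OF invD[OF a ijD(1)] invD[OF a ijD(2)]] by simp
      qed
    qed
    finally show ?thesis .
  qed
  let ?R = "mat b b (\<lambda>(i, j). \<Sum>\<alpha><N. complex_of_real (p \<alpha> / real (wt b (u \<alpha>))) * (u \<alpha> i * cnj (u \<alpha> j)))"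
  \<comment> \<open>Two rank-one terms for each \<open>\<alpha>\<close>: the coefficient error of
    the intended vector (\<open>True\<close>) and the remainder (\<open>False\<close>).\<close>
  define co where "co = (\<lambda>(\<alpha>, t). if t then p \<alpha> / M * real (M div K \<alpha>) - p \<alpha> / K \<alpha> else p \<alpha> / M)"
  define ve where "ve = (\<lambda>(\<alpha>, t). if t then u \<alpha> else r \<alpha>)"
  have diff: "(\<Lambda> (max_coh m) - ?R) $$ (i, j) = (\<Sum>s\<in>{..<N} \<times> UNIV. complex_of_real (co s) * ve s i * cnj (ve s j))"
    if ij: "i < b" "j < b" for i j
  proof -
    have "(\<Sum>s\<in>{..<N} \<times> UNIV. complex_of_real (co s) * ve s i * cnj (ve s j)) =
        (\<Sum>\<alpha><N. \<Sum>t\<in>UNIV. complex_of_real (co (\<alpha>, t)) * ve (\<alpha>, t) i * cnj (ve (\<alpha>, t) j))"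
      by (simp only: sum.cartesian_product prod.collapse split_def)
    also have "\<dots> = (\<Sum>\<alpha><N. complex_of_real (p \<alpha> / M) * (of_nat (M div K \<alpha>) * (u \<alpha> i * cnj (u \<alpha> j)) + r \<alpha> i * cnj (r \<alpha> j))
         - complex_of_real (p \<alpha> / real (wt b (u \<alpha>))) * (u \<alpha> i * cnj (u \<alpha> j)))"
      by (intro sum.cong refl) (simp add: UNIV_bool co_def ve_def K_def ring_distribs mult.assoc)
    also have "\<dots> = (\<Lambda> (max_coh m) - ?R) $$ (i, j)"
      using ij Lentry[OF ij] by (simp add: sum_subtractf)
    finally show ?thesis by simp
  qed
  have "trace_norm (\<Lambda> (max_coh m) - ?R) \<le> (\<Sum>s\<in>{..<N} \<times> UNIV. \<bar>co s\<bar> * (\<Sum>i<b. (cmod (ve s i))\<^sup>2))"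
    by (rule trace_norm_sum_rank_one_le[OF _ diff]) (auto simp: \<Lambda>_def intro: minus_carrier_mat)
  also have "\<dots> = (\<Sum>\<alpha><N. \<Sum>t\<in>UNIV. \<bar>co (\<alpha>, t)\<bar> * (\<Sum>i<b. (cmod (ve (\<alpha>, t) i))\<^sup>2))"
    by (simp only: sum.cartesian_product prod.collapse split_def)
  also have "\<dots> \<le> (\<Sum>\<alpha><N. p \<alpha> * (2 * real (2 ^ m mod wt b (u \<alpha>)) / 2 ^ m))"
  proof (intro sum_mono)
    fix \<alpha> assume "\<alpha> \<in> {..<N}"
    then have a: "\<alpha> < N" by simp
    have K0: "K \<alpha> > 0" using u(2)[OF a] by (simp add: K_def)
    have "real M = real (K \<alpha> * (M div K \<alpha>) + M mod K \<alpha>)" by simp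
    then have Msplit: "real M = real (K \<alpha>) * real (M div K \<alpha>) + real (M mod K \<alpha>)"
      by (simp only: of_nat_add of_nat_mult)
    \<comment> \<open>\<open>(M div K) / M\<close> falls short of \<open>1 / K\<close> by
      \<open>(M mod K) / (M * K)\<close>; the squared norm \<open>K\<close> of
      \<open>u \<alpha>\<close> then cancels the \<open>K\<close>.\<close>
    have "co (\<alpha>, True) = - (p \<alpha> * real (M mod K \<alpha>) / (M * K \<alpha>))"
      using M0 K0 Msplit by (simp add: co_def field_simps)
    then have "\<bar>co (\<alpha>, True)\<bar> = p \<alpha> * real (M mod K \<alpha>) / (M * K \<alpha>)"
      using p(1)[OF a] by simp
    then have "\<bar>co (\<alpha>, True)\<bar> * (\<Sum>i<b. (cmod (ve (\<alpha>, True) i))\<^sup>2) = p \<alpha> * real (M mod K \<alpha>) / M"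
      using flat_norm_sum[OF u(1)[OF a]] K0 by (simp add: ve_def K_def)
    moreover have "\<bar>co (\<alpha>, False)\<bar> * (\<Sum>i<b. (cmod (ve (\<alpha>, False) i))\<^sup>2) \<le> p \<alpha> / M * real (M mod K \<alpha>)"
      using p(1)[OF a] r[OF a] by (simp add: co_def ve_def mult_left_mono divide_right_mono)
    moreover have "p \<alpha> * real (M mod K \<alpha>) / M + p \<alpha> / M * real (M mod K \<alpha>) =
        p \<alpha> * (2 * real (2 ^ m mod wt b (u \<alpha>)) / 2 ^ m)"
      by (simp add: M_def K_def)
    ultimately show "(\<Sum>t\<in>UNIV. \<bar>co (\<alpha>, t)\<bar> * (\<Sum>i<b. (cmod (ve (\<alpha>, t) i))\<^sup>2)) \<le>
        p \<alpha> * (2 * real (2 ^ m mod wt b (u \<alpha>)) / 2 ^ m)"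
      by (simp add: UNIV_bool)
  qed
  finally show ?thesis using PIO by blast
qed

section \<open>Decompositions into uniformly coherent states\<close>

definition flat_dec ::
    "nat \<Rightarrow> nat \<Rightarrow> (nat \<Rightarrow> real) \<Rightarrow> (nat \<Rightarrow> nat \<Rightarrow> complex) \<Rightarrow> (nat \<Rightarrow> nat \<Rightarrow> complex) \<Rightarrow> bool" where
  "flat_dec d L p u R \<longleftrightarrow> (\<forall>s<L. p s \<ge> 0 \<and> flat d (u s) \<and> wt d (u s) > 0) \<and> (\<Sum>s<L. p s) = 1 \<and>
     (\<forall>i<d. \<forall>j<d. R i j = (\<Sum>s<L. complex_of_real (p s / real (wt d (u s))) * (u s i * cnj (u s j))))"

definition dec_cost :: "nat \<Rightarrow> nat \<Rightarrow> (nat \<Rightarrow> real) \<Rightarrow> (nat \<Rightarrow> nat \<Rightarrow> complex) \<Rightarrow> real" where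
  "dec_cost d L p u = (\<Sum>s<L. p s * log 2 (real (wt d (u s))))"

lemma complex_sqrt_nat_mult:
  "complex_of_real (sqrt (real k)) * complex_of_real (sqrt (real k)) = of_nat k"
  by (simp flip: of_real_mult)

lemma unif_coherent_flat:
  assumes "unif_coherent d k v"
  shows "\<exists>u. flat d u \<and> wt d u = k \<and> k > 0 \<and> dim_vec v = d \<and>
    (\<forall>i<d. \<forall>j<d. proj_vec v $$ (i, j) = complex_of_real (1 / real k) * (u i * cnj (u j)))"
proof -
  obtain J \<theta> where J: "1 \<le> k" "J \<subseteq> {..<d}" "card J = k" and
    v: "v = vec d (\<lambda>j. if j \<in> J then exp (\<i> * complex_of_real (\<theta> j)) / complex_of_real (sqrt (real k)) else 0)"
    using assms unfolding unif_coherent_def by blast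
  define u where "u = (\<lambda>j. if j \<in> J then exp (\<i> * complex_of_real (\<theta> j)) else 0)"
  have "{i. i < d \<and> u i \<noteq> 0} = J" using J(2) by (auto simp: u_def)
  then have "wt d u = k" using J(3) by (simp add: wt_def)
  moreover have "flat d u" by (simp add: flat_def u_def)
  moreover have "proj_vec v $$ (i, j) = complex_of_real (1 / real k) * (u i * cnj (u j))" if "i < d" "j < d" for i j
  proof -
    have "v $ l = u l / complex_of_real (sqrt (real k))" if "l < d" for l
      using that by (simp add: v u_def)
    then have "proj_vec v $$ (i, j) = u i * cnj (u j) / complex_of_real (sqrt (real k) * sqrt (real k))"
      using that by (simp add: proj_vec_def v complex_sqrt_nat_mult)
    then show ?thesis by simp
  qed
  ultimately show ?thesis using J(1) by (intro exI[of _ u]) (auto simp: v)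
qed

lemma flat_unif_coherent:
  assumes "flat d u" "wt d u > 0"
  shows "\<exists>v. unif_coherent d (wt d u) v \<and>
    (\<forall>i<d. \<forall>j<d. proj_vec v $$ (i, j) = complex_of_real (1 / real (wt d u)) * (u i * cnj (u j)))"
proof -
  define J where "J = {i. i < d \<and> u i \<noteq> 0}"
  have J: "J \<subseteq> {..<d}" "card J = wt d u" by (auto simp: J_def wt_def)
  let ?k = "real (wt d u)"
  define v where "v = vec d (\<lambda>j. if j \<in> J then exp (\<i> * complex_of_real (Arg (u j))) / complex_of_real (sqrt ?k) else 0)"
  have "wt d u \<le> d" using card_mono[OF _ J(1)] J(2) by simp
  then have "unif_coherent d (wt d u) v"
    unfolding unif_coherent_def using assms(2) J by (auto simp: v_def intro!: exI[of _ J] exI[of _ "\<lambda>j. Arg (u j)"])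
  moreover have vu: "v $ l = u l / complex_of_real (sqrt ?k)" if "l < d" for l
  proof (cases "l \<in> J")
    case True
    then have "u l \<noteq> 0" "cmod (u l) = 1" using assms(1) that by (auto simp: J_def flat_def)
    then have "exp (\<i> * complex_of_real (Arg (u l))) = u l"
      using cis_Arg[of "u l"] by (simp add: cis_conv_exp sgn_div_norm)
    then show ?thesis using that True by (simp add: v_def)
  next
    case False
    then show ?thesis using that by (simp add: v_def J_def)
  qed
  have "proj_vec v $$ (i, j) = complex_of_real (1 / ?k) * (u i * cnj (u j))" if "i < d" "j < d" for i j
  proof -
    have "proj_vec v $$ (i, j) = v $ i * cnj (v $ j)" using that by (simp add: proj_vec_def v_def)
    also have "\<dots> = u i * cnj (u j) / complex_of_real (sqrt ?k * sqrt ?k)"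
      using that by (simp add: vu complex_sqrt_nat_mult)
    finally show ?thesis by simp
  qed
  ultimately show ?thesis by blast
qed

lemma unif_cof_le:
  assumes \<rho>: "\<rho> \<in> carrier_mat d d" and dec: "flat_dec d L p u (\<lambda>i j. \<rho> $$ (i, j))"
  shows "unif_cof d \<rho> \<le> ereal (dec_cost d L p u)"
proof -
  have u: "flat d (u s)" "wt d (u s) > 0" "p s \<ge> 0" if "s < L" for s
    using dec that by (auto simp: flat_dec_def)
  have "\<forall>s. \<exists>v. s < L \<longrightarrow> unif_coherent d (wt d (u s)) v \<and>
    (\<forall>i<d. \<forall>j<d. proj_vec v $$ (i, j) = complex_of_real (1 / real (wt d (u s))) * (u s i * cnj (u s j)))"
    using flat_unif_coherent[OF u(1,2)] by blast
  from choice[OF this] obtain \<psi> where \<psi>: "\<And>s. s < L \<Longrightarrow> unif_coherent d (wt d (u s)) (\<psi> s)"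
    "\<And>s i j. s < L \<Longrightarrow> i < d \<Longrightarrow> j < d \<Longrightarrow>
      proj_vec (\<psi> s) $$ (i, j) = complex_of_real (1 / real (wt d (u s))) * (u s i * cnj (u s j))"
    by blast
  have "\<rho> = mat d d (\<lambda>(i,j). \<Sum>\<alpha><L. complex_of_real (p \<alpha>) * proj_vec (\<psi> \<alpha>) $$ (i,j))"
    using \<rho> dec by (intro eq_matI) (auto simp: flat_dec_def \<psi>(2) intro!: sum.cong)
  then show ?thesis
    unfolding unif_cof_def dec_cost_def using u(3) \<psi>(1) dec
    by (intro Inf_lower) (auto simp: flat_dec_def intro!: exI[of _ L] exI[of _ p] exI[of _ "\<lambda>s. wt d (u s)"] exI[of _ \<psi>])
qed

section \<open>Decompositions of bounded length and their limits\<close>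

lemma homogeneous_system_nontrivial_set:
  fixes A :: "'e \<Rightarrow> 'i \<Rightarrow> 'a::field"
  assumes "finite E" "finite S" "card E < card S"
  shows "\<exists>x. (\<exists>j\<in>S. x j \<noteq> 0) \<and> (\<forall>e\<in>E. (\<Sum>j\<in>S. A e j * x j) = 0)"
proof -
  obtain h where h: "bij_betw h {..<card E} E"
    using ex_bij_betw_nat_finite[OF assms(1)] by (auto simp: lessThan_atLeast0)
  obtain x where "\<exists>j\<in>S. x j \<noteq> 0" "\<forall>i<card E. (\<Sum>j\<in>S. A (h i) j * x j) = 0"
    using homogeneous_system_nontrivial[OF assms(2,3), of "\<lambda>i. A (h i)"] by blast
  moreover have "\<exists>i<card E. e = h i" if "e \<in> E" for e
    using h that unfolding bij_betw_def by auto
  ultimately show ?thesis by (intro exI[of _ x]) fastforce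
qed

text \<open>More generators than functionals admit a linear relation; moving along it until a
  coefficient reaches zero discards a generator and changes no value. In this conic form
  normalisation can be imposed as just another functional.\<close>

theorem conic_caratheodory:
  fixes F :: "'e \<Rightarrow> 'i \<Rightarrow> real"
  assumes "finite E" "finite S" "\<And>s. s \<in> S \<Longrightarrow> p s \<ge> 0"
  shows "\<exists>S' p'. S' \<subseteq> S \<and> card S' \<le> card E \<and> (\<forall>s\<in>S'. p' s \<ge> 0) \<and>
    (\<forall>e\<in>E. (\<Sum>s\<in>S'. p' s * F e s) = (\<Sum>s\<in>S. p s * F e s))"
  using assms(2,3)
proof (induction "card S" arbitrary: S p rule: less_induct)
  case less
  show ?case
  proof (cases "card S \<le> card E")
    case True
    then show ?thesis using less.prems by (intro exI[of _ S] exI[of _ p]) auto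
  next
    case False
    then obtain y where y: "\<exists>j\<in>S. y j \<noteq> 0" "\<forall>e\<in>E. (\<Sum>j\<in>S. F e j * y j) = 0"
      using homogeneous_system_nontrivial_set[OF assms(1) less.prems(1), of F] by auto
    \<comment> \<open>Flipping the sign if necessary makes a coordinate positive, so the minimum
      defining the step size exists.\<close>
    obtain x where x: "\<exists>j\<in>S. x j > 0" "\<forall>e\<in>E. (\<Sum>j\<in>S. F e j * x j) = 0"
    proof (cases "\<exists>j\<in>S. y j > 0")
      case True
      then show ?thesis using that y by blast
    next
      case False
      then have "\<exists>j\<in>S. - y j > 0" using y(1) by force
      moreover have "\<forall>e\<in>E. (\<Sum>j\<in>S. F e j * - y j) = 0" using y(2) by (simp add: sum_negf)
      ultimately show ?thesis using that[of "\<lambda>j. - y j"] by blast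
    qed
    define P where "P = {j \<in> S. x j > 0}"
    have P: "finite P" "P \<noteq> {}" using less.prems x(1) by (auto simp: P_def)
    \<comment> \<open>\<open>t\<close> is the largest step that keeps all coefficients nonnegative;
      a minimiser \<open>k\<close> drops to zero.\<close>
    define t where "t = Min ((\<lambda>j. p j / x j) ` P)"
    have "t \<in> (\<lambda>j. p j / x j) ` P" unfolding t_def using P by (intro Min_in) auto
    then obtain k where k: "k \<in> S" "x k > 0" "t = p k / x k" by (auto simp: P_def)
    have t_le: "t \<le> p j / x j" if "j \<in> S" "x j > 0" for j
      unfolding t_def using P that by (intro Min_le) (auto simp: P_def)
    have t0: "t \<ge> 0" using k less.prems by simp
    define p1 where "p1 = (\<lambda>j. p j - t * x j)"
    have p1: "p1 j \<ge> 0" if "j \<in> S" for j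
    proof (cases "x j > 0")
      case True
      then show ?thesis using t_le[OF that] by (simp add: p1_def field_simps)
    next
      case False
      then have "t * x j \<le> 0" using t0 by (simp add: mult_nonneg_nonpos)
      then show ?thesis using less.prems(2)[OF that] by (simp add: p1_def)
    qed
    have pk: "p1 k = 0" using k by (simp add: p1_def)
    have "card (S - {k}) < card S" using k less.prems(1) by (meson card_Diff1_less)
    from less.hyps[OF this, of p1] p1 less.prems(1) obtain S' p' where
      S': "S' \<subseteq> S - {k}" "card S' \<le> card E" "\<forall>s\<in>S'. p' s \<ge> 0"
      "\<forall>e\<in>E. (\<Sum>s\<in>S'. p' s * F e s) = (\<Sum>s\<in>S - {k}. p1 s * F e s)" by auto
    have "(\<Sum>s\<in>S - {k}. p1 s * F e s) = (\<Sum>s\<in>S. p s * F e s)" if "e \<in> E" for e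
    proof -
      have "(\<Sum>s\<in>S. p1 s * F e s) = p1 k * F e k + (\<Sum>s\<in>S - {k}. p1 s * F e s)"
        using k less.prems(1) by (intro sum.remove) auto
      then have "(\<Sum>s\<in>S - {k}. p1 s * F e s) = (\<Sum>s\<in>S. p1 s * F e s)" using pk by simp
      also have "\<dots> = (\<Sum>s\<in>S. p s * F e s) - t * (\<Sum>s\<in>S. F e s * x s)"
        by (simp add: p1_def left_diff_distrib sum_subtractf sum_distrib_left mult.assoc mult.commute[of "x _"])
      finally show ?thesis using x(2) that by simp
    qed
    with S' show ?thesis by (intro exI[of _ S'] exI[of _ p']) auto
  qed
qed

text \<open>Caratheodory with \<open>2 * d * d\<close> functionals for the real and imaginary parts
  of the entries and two more for total probability and cost. The cost is thus preserved exactly,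
  and the length depends on \<open>d\<close> alone.\<close>

lemma finite_family_flat_dec:
  fixes p :: "'i \<Rightarrow> real" and u :: "'i \<Rightarrow> nat \<Rightarrow> complex"
  assumes S: "finite S" and p: "\<And>s. s \<in> S \<Longrightarrow> p s \<ge> 0" "(\<Sum>s\<in>S. p s) = 1"
    and u: "\<And>s. s \<in> S \<Longrightarrow> flat d (u s) \<and> wt d (u s) > 0"
    and R: "\<And>i j. i < d \<Longrightarrow> j < d \<Longrightarrow>
      R i j = (\<Sum>s\<in>S. complex_of_real (p s / real (wt d (u s))) * (u s i * cnj (u s j)))"
  shows "\<exists>p' u'. flat_dec d (2 * d * d + 2) p' u' R \<and>
    dec_cost d (2 * d * d + 2) p' u' = (\<Sum>s\<in>S. p s * log 2 (real (wt d (u s))))"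
proof -
  let ?L = "2 * d * d + 2"
  define K where "K = (\<lambda>s i j. u s i * cnj (u s j) / complex_of_real (real (wt d (u s))))"
  define E :: "((nat \<times> nat \<times> bool) + bool) set" where "E = ({..<d} \<times> {..<d} \<times> UNIV) <+> UNIV"
  have E: "finite E" "card E = ?L" by (simp_all add: E_def card_Plus card_cartesian_product UNIV_bool)
  define F where "F = (\<lambda>e s. case e of Inl (i, j, t) \<Rightarrow> if t then Re (K s i j) else Im (K s i j)
     | Inr t \<Rightarrow> if t then 1 else log 2 (real (wt d (u s))))"
  have "\<exists>S' p'. S' \<subseteq> S \<and> card S' \<le> card E \<and> (\<forall>s\<in>S'. p' s \<ge> 0) \<and>
    (\<forall>e\<in>E. (\<Sum>s\<in>S'. p' s * F e s) = (\<Sum>s\<in>S. p s * F e s))"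
    by (rule conic_caratheodory[OF E(1) S]) (rule p(1))
  then obtain S' p' where S': "S' \<subseteq> S" "card S' \<le> card E" "\<forall>s\<in>S'. p' s \<ge> 0"
    "\<forall>e\<in>E. (\<Sum>s\<in>S'. p' s * F e s) = (\<Sum>s\<in>S. p s * F e s)"
    by (elim exE conjE) (rule that)
  have finS': "finite S'" using S S'(1) by (rule rev_finite_subset)
  have "Inr True \<in> E" "Inr False \<in> E" by (auto simp: E_def)
  with S'(4) have eq: "(\<Sum>s\<in>S'. p' s * F (Inr True) s) = (\<Sum>s\<in>S. p s * F (Inr True) s)"
    "(\<Sum>s\<in>S'. p' s * F (Inr False) s) = (\<Sum>s\<in>S. p s * F (Inr False) s)" by blast+
  have sum1: "(\<Sum>s\<in>S'. p' s) = 1" using eq(1) p(2) by (simp add: F_def)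
  have cost: "(\<Sum>s\<in>S'. p' s * log 2 (real (wt d (u s)))) = (\<Sum>s\<in>S. p s * log 2 (real (wt d (u s))))"
    using eq(2) by (simp add: F_def)
  have ker: "R i j = (\<Sum>s\<in>S'. complex_of_real (p' s) * K s i j)" if ij: "i < d" "j < d" for i j
  proof -
    have "Inl (i, j, True) \<in> E" "Inl (i, j, False) \<in> E" using ij by (auto simp: E_def)
    with S'(4) have "(\<Sum>s\<in>S'. p' s * F (Inl (i, j, True)) s) = (\<Sum>s\<in>S. p s * F (Inl (i, j, True)) s)"
      "(\<Sum>s\<in>S'. p' s * F (Inl (i, j, False)) s) = (\<Sum>s\<in>S. p s * F (Inl (i, j, False)) s)" by blast+
    then have "(\<Sum>s\<in>S'. complex_of_real (p' s) * K s i j) = (\<Sum>s\<in>S. complex_of_real (p s) * K s i j)"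
      by (simp add: F_def complex_eq_iff)
    also have "\<dots> = R i j" unfolding R[OF ij] by (intro sum.cong) (auto simp: K_def)
    finally show ?thesis by simp
  qed
  define N where "N = card S'"
  have N: "N \<le> ?L" using S'(2) E(2) by (simp add: N_def)
  obtain h where h: "bij_betw h {..<N} S'"
    using ex_bij_betw_nat_finite[OF finS'] by (auto simp: lessThan_atLeast0 N_def)
  have "S' \<noteq> {}" using sum1 by auto
  \<comment> \<open>Padding positions have probability zero but still need a flat vector of positive
    weight; \<open>s0\<close> supplies it.\<close>
  then obtain s0 where s0: "s0 \<in> S'" by blast
  define g where "g = (\<lambda>n. if n < N then h n else s0)"
  define p2 where "p2 = (\<lambda>n. if n < N then p' (h n) else 0)"
  have g: "g n \<in> S'" for n using bij_betw_apply[OF h] s0 by (simp add: g_def)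
  have pad: "(\<Sum>n<?L. of_real (p2 n) * G (g n)) = (\<Sum>s\<in>S'. of_real (p' s) * G s)" for G :: "'i \<Rightarrow> 'b::real_field"
  proof -
    have "(\<Sum>n<?L. of_real (p2 n) * G (g n)) = (\<Sum>n<N. of_real (p2 n) * G (g n))"
      using N by (intro sum.mono_neutral_right) (auto simp: p2_def)
    also have "\<dots> = (\<Sum>n<N. of_real (p' (h n)) * G (h n))"
      by (intro sum.cong) (auto simp: p2_def g_def)
    also have "\<dots> = (\<Sum>s\<in>S'. of_real (p' s) * G s)"
      by (rule sum.reindex_bij_betw[OF h])
    finally show ?thesis .
  qed
  have "flat_dec d ?L p2 (\<lambda>n. u (g n)) R"
    unfolding flat_dec_def
  proof (intro conjI allI impI)
    fix s show "p2 s \<ge> 0" using S'(3) bij_betw_apply[OF h] by (simp add: p2_def)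
  next
    fix s show "flat d (u (g s))" "wt d (u (g s)) > 0" using u g S'(1) by blast+
  next
    show "(\<Sum>s<?L. p2 s) = 1" using pad[of "\<lambda>_. 1 :: real"] sum1 by simp
  next
    fix i j assume "i < d" "j < d"
    then show "R i j = (\<Sum>s<?L. complex_of_real (p2 s / real (wt d (u (g s)))) * (u (g s) i * cnj (u (g s) j)))"
      using pad[of "\<lambda>s. K s i j"] by (simp add: ker K_def)
  qed
  moreover have "dec_cost d ?L p2 (\<lambda>n. u (g n)) = (\<Sum>s\<in>S. p s * log 2 (real (wt d (u s))))"
    using pad[of "\<lambda>s. log 2 (real (wt d (u s)))"] cost by (simp add: dec_cost_def)
  ultimately show ?thesis by blast
qed

lemma common_convergent_subsequence:
  fixes f :: "nat \<Rightarrow> 'i \<Rightarrow> 'a::heine_borel"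
  assumes "finite I" "\<And>i. i \<in> I \<Longrightarrow> bounded (range (\<lambda>n. f n i))"
  shows "\<exists>r l. strict_mono r \<and> (\<forall>i\<in>I. (\<lambda>n. f (r n) i) \<longlonglongrightarrow> l i)"
  using assms
proof (induction I)
  case empty
  then show ?case by (auto intro!: exI[of _ id] simp: strict_mono_def)
next
  case (insert j I)
  then obtain r l where r: "strict_mono r" "\<forall>i\<in>I. (\<lambda>n. f (r n) i) \<longlonglongrightarrow> l i" by blast
  have "bounded (range (\<lambda>n. f n j))" using insert.prems by blast
  then have "bounded (range (\<lambda>n. f (r n) j))" by (rule bounded_subset) auto
  then obtain l' r' where r': "strict_mono r'" "((\<lambda>n. f (r n) j) \<circ> r') \<longlonglongrightarrow> l'"
    using bounded_imp_convergent_subsequence by blast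
  have "(\<lambda>n. f ((r \<circ> r') n) i) \<longlonglongrightarrow> (l(j := l')) i" if "i \<in> insert j I" for i
  proof (cases "i = j")
    case True
    then show ?thesis using r'(2) by (simp add: comp_def)
  next
    case False
    then show ?thesis
      using that r(2) LIMSEQ_subseq_LIMSEQ[OF _ r'(1)] by (fastforce simp: comp_def)
  qed
  then show ?case using strict_mono_o[OF r(1) r'(1)] by blast
qed

text \<open>The weight of a flat vector is the sum of its squared moduli, so it is preserved under limits.\<close>

theorem flat_dec_limit:
  assumes dec: "\<And>n. flat_dec d L (p n) (u n) (R n)" and cost: "\<And>n. dec_cost d L (p n) (u n) \<le> c"
    and lim: "\<And>i j. i < d \<Longrightarrow> j < d \<Longrightarrow> (\<lambda>n. R n i j) \<longlonglongrightarrow> R' i j"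
  shows "\<exists>p' u'. flat_dec d L p' u' R' \<and> dec_cost d L p' u' \<le> c"
proof -
  have D: "p n s \<ge> 0" "flat d (u n s)" "wt d (u n s) > 0" if "s < L" for n s
    using dec[of n] that by (auto simp: flat_dec_def)
  have p1: "(\<Sum>s<L. p n s) = 1" for n using dec[of n] by (simp add: flat_dec_def)
  have p_le: "p n s \<le> 1" if "s < L" for n s
    using member_le_sum[of s "{..<L}" "p n"] D(1) that by (simp add: p1)
  have "bounded (range (\<lambda>n. p n s))" if "s \<in> {..<L}" for s
    using D(1) p_le that by (intro boundedI[of _ 1]) auto
  then obtain r1 p' where r1: "strict_mono r1" "\<forall>s\<in>{..<L}. (\<lambda>n. p (r1 n) s) \<longlonglongrightarrow> p' s"
    using common_convergent_subsequence[of "{..<L}" p] by blast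
  have "bounded (range (\<lambda>n. u (r1 n) (fst z) (snd z)))" if "z \<in> {..<L} \<times> {..<d}" for z
  proof (intro boundedI[of _ 1])
    fix x assume "x \<in> range (\<lambda>n. u (r1 n) (fst z) (snd z))"
    then obtain n where "x = u (r1 n) (fst z) (snd z)" by blast
    then show "norm x \<le> 1" using D(2)[of "fst z" "r1 n"] that unfolding flat_def by force
  qed
  then obtain r2 l where r2: "strict_mono r2"
      "\<forall>z\<in>{..<L} \<times> {..<d}. (\<lambda>n. u (r1 (r2 n)) (fst z) (snd z)) \<longlonglongrightarrow> l z"
    using common_convergent_subsequence[of "{..<L} \<times> {..<d}" "\<lambda>n z. u (r1 n) (fst z) (snd z)"] by auto
  define r where "r = (\<lambda>n. r1 (r2 n))"
  define u' where "u' = (\<lambda>s i. l (s, i))"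
  have r: "strict_mono r" using strict_mono_o[OF r1(1) r2(1)] by (simp add: r_def comp_def)
  have pl: "(\<lambda>n. p (r n) s) \<longlonglongrightarrow> p' s" if "s < L" for s
    using LIMSEQ_subseq_LIMSEQ[OF r1(2)[rule_format] r2(1), of s] that by (simp add: r_def comp_def)
  have ul: "(\<lambda>n. u (r n) s i) \<longlonglongrightarrow> u' s i" if "s < L" "i < d" for s i
    using r2(2) that by (auto simp: r_def u'_def)
  have fl: "flat d (u' s)" if s: "s < L" for s
    unfolding flat_def
  proof (intro allI impI)
    fix i assume i: "i < d"
    \<comment> \<open>Flatness written as a polynomial equation in the modulus, so that it passes to
      the limit.\<close>
    have zero: "(\<lambda>n. cmod (u (r n) s i) * (cmod (u (r n) s i) - 1)) = (\<lambda>_. 0)"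
      using D(2)[OF s] i by (auto simp: flat_def fun_eq_iff)
    have "(\<lambda>n. cmod (u (r n) s i) * (cmod (u (r n) s i) - 1)) \<longlonglongrightarrow> cmod (u' s i) * (cmod (u' s i) - 1)"
      by (intro tendsto_intros ul[OF s i])
    then have "cmod (u' s i) * (cmod (u' s i) - 1) = 0"
      unfolding zero by (simp only: LIMSEQ_const_iff)
    then show "u' s i = 0 \<or> cmod (u' s i) = 1" by simp
  qed
  have wl: "(\<lambda>n. real (wt d (u (r n) s))) \<longlonglongrightarrow> real (wt d (u' s))" if s: "s < L" for s
  proof -
    have "(\<lambda>n. \<Sum>i<d. (cmod (u (r n) s i))\<^sup>2) \<longlonglongrightarrow> (\<Sum>i<d. (cmod (u' s i))\<^sup>2)"
      using ul[OF s] by (intro tendsto_sum tendsto_power tendsto_norm) auto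
    then show ?thesis using flat_norm_sum[OF D(2)[OF s]] flat_norm_sum[OF fl[OF s]] by simp
  qed
  have w0: "wt d (u' s) > 0" if s: "s < L" for s
  proof -
    \<comment> \<open>A positive integer weight is at least 1, a bound that survives the limit and
      keeps the quotients and logarithms continuous.\<close>
    have "real (wt d (u (r n) s)) \<ge> 1" for n using D(3)[OF s, of "r n"] by simp
    then have "real (wt d (u' s)) \<ge> 1" using wl[OF s] by (intro LIMSEQ_le_const) auto
    then show ?thesis by simp
  qed
  have "flat_dec d L p' u' R'"
    unfolding flat_dec_def
  proof (intro conjI allI impI)
    fix s assume s: "s < L"
    show "p' s \<ge> 0" using pl[OF s] D(1)[OF s] by (intro LIMSEQ_le_const) auto
    show "flat d (u' s)" "wt d (u' s) > 0" using fl w0 s by auto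
  next
    have "(\<lambda>n. \<Sum>s<L. p (r n) s) \<longlonglongrightarrow> (\<Sum>s<L. p' s)" using pl by (intro tendsto_sum) auto
    then show "(\<Sum>s<L. p' s) = 1" by (simp add: p1 LIMSEQ_const_iff)
  next
    fix i j assume ij: "i < d" "j < d"
    have "(\<lambda>n. \<Sum>s<L. complex_of_real (p (r n) s / real (wt d (u (r n) s))) * (u (r n) s i * cnj (u (r n) s j)))
      \<longlonglongrightarrow> (\<Sum>s<L. complex_of_real (p' s / real (wt d (u' s))) * (u' s i * cnj (u' s j)))"
    proof (intro tendsto_sum)
      fix s assume "s \<in> {..<L}"
      then have s: "s < L" by simp
      have "real (wt d (u' s)) \<noteq> 0" using w0[OF s] by simp
      then show "(\<lambda>n. complex_of_real (p (r n) s / real (wt d (u (r n) s))) * (u (r n) s i * cnj (u (r n) s j)))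
        \<longlonglongrightarrow> complex_of_real (p' s / real (wt d (u' s))) * (u' s i * cnj (u' s j))"
        by (intro tendsto_mult tendsto_of_real tendsto_divide tendsto_cnj pl[OF s] wl[OF s] ul[OF s ij(1)] ul[OF s ij(2)])
    qed
    moreover have "R (r n) i j = (\<Sum>s<L. complex_of_real (p (r n) s / real (wt d (u (r n) s))) * (u (r n) s i * cnj (u (r n) s j)))" for n
      using dec[of "r n"] ij by (simp add: flat_dec_def)
    ultimately have "(\<lambda>n. R (r n) i j) \<longlonglongrightarrow> (\<Sum>s<L. complex_of_real (p' s / real (wt d (u' s))) * (u' s i * cnj (u' s j)))"
      by simp
    moreover have "(\<lambda>n. R (r n) i j) \<longlonglongrightarrow> R' i j"
      using LIMSEQ_subseq_LIMSEQ[OF lim[OF ij] r] by (simp add: comp_def)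
    ultimately show "R' i j = (\<Sum>s<L. complex_of_real (p' s / real (wt d (u' s))) * (u' s i * cnj (u' s j)))"
      using LIMSEQ_unique by blast
  qed
  moreover have "dec_cost d L p' u' \<le> c"
  proof -
    have "(\<lambda>n. dec_cost d L (p (r n)) (u (r n))) \<longlonglongrightarrow> dec_cost d L p' u'"
      unfolding dec_cost_def
    proof (intro tendsto_sum tendsto_mult)
      fix s assume "s \<in> {..<L}"
      then have s: "s < L" by simp
      show "(\<lambda>n. p (r n) s) \<longlonglongrightarrow> p' s" by (rule pl[OF s])
      show "(\<lambda>n. log 2 (real (wt d (u (r n) s)))) \<longlonglongrightarrow> log 2 (real (wt d (u' s)))"
        using w0[OF s] by (intro tendsto_log tendsto_const wl[OF s]) auto
    qed
    then show ?thesis using cost by (intro LIMSEQ_le_const2) auto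
  qed
  ultimately show ?thesis by blast
qed

text \<open>A slice \<open>v\<close> of \<open>w t\<close> gets probability
  \<open>q t * wt v / n\<close>; these sum to 1 because the slices of \<open>w t\<close> have total
  weight \<open>n\<close> times its own. The entropy bound and \<open>wt \<le> 2 ^ m\<close> reduce
  the cost to \<open>m / n\<close>.\<close>

theorem one_site_decomposition:
  assumes "PIO (2 ^ m) (d ^ n) \<Lambda>" "n > 0"
  shows "\<exists>p u. flat_dec d (2 * d * d + 2) p u (\<lambda>a b. marg d n (\<lambda>x y. \<Lambda> (max_coh m) $$ (x, y)) a b / of_nat n) \<and>
    dec_cost d (2 * d * d + 2) p u \<le> real m / real n"
proof -
  obtain T :: "(nat \<times> nat) set" and q w where T: "finite T"
    "\<And>t. t \<in> T \<Longrightarrow> q t \<ge> 0 \<and> flat (d ^ n) (w t) \<and> wt (d ^ n) (w t) \<le> 2 ^ m"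
    "\<And>x y. x < d ^ n \<Longrightarrow> y < d ^ n \<Longrightarrow>
        \<Lambda> (max_coh m) $$ (x, y) = (\<Sum>t\<in>T. complex_of_real (q t) * (w t x * cnj (w t y)))"
    "(\<Sum>t\<in>T. q t * real (wt (d ^ n) (w t))) = 1"
    using PIO_max_coh_output[OF assms(1)] by blast
  let ?g = "\<lambda>k. real k * ln (real k)"
  have "\<forall>t. \<exists>us. t \<in> T \<longrightarrow> (\<forall>u\<in>set us. flat d u) \<and>
     (\<forall>a<d. \<forall>b<d. marg d n (\<lambda>x y. w t x * cnj (w t y)) a b = (\<Sum>u\<leftarrow>us. u a * cnj (u b))) \<and>
     (\<Sum>u\<leftarrow>us. real (wt d u)) = real n * real (wt (d ^ n) (w t)) \<and>
     (\<Sum>u\<leftarrow>us. ?g (wt d u)) \<le> ?g (wt (d ^ n) (w t))"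
    using marg_flat T(2) by blast
  from choice[OF this] obtain us where us: "\<And>t u. t \<in> T \<Longrightarrow> u \<in> set (us t) \<Longrightarrow> flat d u"
     "\<And>t a b. t \<in> T \<Longrightarrow> a < d \<Longrightarrow> b < d \<Longrightarrow>
        marg d n (\<lambda>x y. w t x * cnj (w t y)) a b = (\<Sum>u\<leftarrow>us t. u a * cnj (u b))"
     "\<And>t. t \<in> T \<Longrightarrow> (\<Sum>u\<leftarrow>us t. real (wt d u)) = real n * real (wt (d ^ n) (w t))"
     "\<And>t. t \<in> T \<Longrightarrow> (\<Sum>u\<leftarrow>us t. ?g (wt d u)) \<le> ?g (wt (d ^ n) (w t))"
    by blast
  \<comment> \<open>Slices of weight zero contribute nothing and are dropped, since
    \<open>flat_dec\<close> needs positive weights.\<close>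
  define A where "A = (\<lambda>t. {s. s < length (us t) \<and> wt d (us t ! s) > 0})"
  define S where "S = Sigma T A"
  define u where "u = (\<lambda>(t, s). us t ! s)"
  define p where "p = (\<lambda>(t, s). q t * real (wt d (us t ! s)) / real n)"
  have finA: "finite (A t)" for t by (simp add: A_def)
  have finS: "finite S" unfolding S_def using T(1) finA by blast
  have sum_S: "(\<Sum>z\<in>S. G z) = (\<Sum>t\<in>T. \<Sum>s\<in>A t. G (t, s))" for G :: "(nat \<times> nat) \<times> nat \<Rightarrow> 'b::comm_monoid_add"
    unfolding S_def using T(1) finA by (simp add: sum.Sigma)
  have sum_A: "(\<Sum>s\<in>A t. G (us t ! s)) = (\<Sum>v\<leftarrow>us t. G v)" if "\<And>v. v \<in> set (us t) \<Longrightarrow> wt d v = 0 \<Longrightarrow> G v = 0"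
    for G :: "(nat \<Rightarrow> complex) \<Rightarrow> 'b::comm_monoid_add" and t
  proof -
    have "(\<Sum>v\<leftarrow>us t. G v) = (\<Sum>s<length (us t). G (us t ! s))"
      by (simp add: sum_list_sum_nth lessThan_atLeast0)
    also have "\<dots> = (\<Sum>s\<in>A t. G (us t ! s))"
      using that by (intro sum.mono_neutral_right) (auto simp: A_def)
    finally show ?thesis by simp
  qed
  have p0: "p z \<ge> 0" if "z \<in> S" for z using that T(2) by (auto simp: S_def p_def)
  have n: "real n > 0" using assms(2) by simp
  have p1: "(\<Sum>z\<in>S. p z) = 1"
  proof -
    have "(\<Sum>z\<in>S. p z) = (\<Sum>t\<in>T. q t / real n * (\<Sum>s\<in>A t. real (wt d (us t ! s))))"
      unfolding sum_S by (simp add: p_def sum_distrib_left)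
    also have "\<dots> = (\<Sum>t\<in>T. q t / real n * (\<Sum>v\<leftarrow>us t. real (wt d v)))"
      using sum_A[of _ "\<lambda>v. real (wt d v)"] by simp
    also have "\<dots> = (\<Sum>t\<in>T. q t * real (wt (d ^ n) (w t)))"
      using n by (intro sum.cong) (auto simp: us(3))
    finally show ?thesis using T(4) by simp
  qed
  have u: "flat d (u z) \<and> wt d (u z) > 0" if "z \<in> S" for z
    using that us(1) by (auto simp: S_def A_def u_def)
  have ker: "marg d n (\<lambda>x y. \<Lambda> (max_coh m) $$ (x, y)) a b / of_nat n =
      (\<Sum>z\<in>S. complex_of_real (p z / real (wt d (u z))) * (u z a * cnj (u z b)))" if ab: "a < d" "b < d" for a b
  proof -
    have vz: "v a * cnj (v b) = 0" if "wt d v = 0" for v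
    proof -
      have "v a = 0" using that ab by (auto simp: wt_def)
      then show ?thesis by simp
    qed
    have "marg d n (\<lambda>x y. \<Lambda> (max_coh m) $$ (x, y)) a b =
        marg d n (\<lambda>x y. \<Sum>t\<in>T. complex_of_real (q t) * (w t x * cnj (w t y))) a b"
      by (rule marg_cong[OF T(3) ab])
    also have "\<dots> = (\<Sum>t\<in>T. complex_of_real (q t) * (\<Sum>v\<leftarrow>us t. v a * cnj (v b)))"
      unfolding marg_sum using us(2) ab by (intro sum.cong) auto
    also have "\<dots> = (\<Sum>t\<in>T. complex_of_real (q t) * (\<Sum>s\<in>A t. (us t ! s) a * cnj ((us t ! s) b)))"
      using sum_A[of _ "\<lambda>v. v a * cnj (v b)"] vz by simp
    finally have "marg d n (\<lambda>x y. \<Lambda> (max_coh m) $$ (x, y)) a b / of_nat n =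
       (\<Sum>t\<in>T. \<Sum>s\<in>A t. complex_of_real (q t) * ((us t ! s) a * cnj ((us t ! s) b)) / of_nat n)"
      by (simp add: sum_divide_distrib sum_distrib_left)
    also have "\<dots> = (\<Sum>t\<in>T. \<Sum>s\<in>A t. complex_of_real (p (t, s) / real (wt d (u (t, s)))) * (u (t, s) a * cnj (u (t, s) b)))"
      by (intro sum.cong refl) (simp add: A_def p_def u_def)
    finally show ?thesis unfolding sum_S .
  qed
  have cost: "(\<Sum>z\<in>S. p z * log 2 (real (wt d (u z)))) \<le> real m / real n"
  proof -
    have "(\<Sum>z\<in>S. p z * log 2 (real (wt d (u z)))) =
        (\<Sum>t\<in>T. q t / (real n * ln 2) * (\<Sum>s\<in>A t. ?g (wt d (us t ! s))))"
      unfolding sum_S by (simp add: p_def u_def sum_distrib_left log_def mult.assoc)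
    also have "\<dots> = (\<Sum>t\<in>T. q t / (real n * ln 2) * (\<Sum>v\<leftarrow>us t. ?g (wt d v)))"
      using sum_A[of _ "\<lambda>v. ?g (wt d v)"] by simp
    also have "\<dots> \<le> (\<Sum>t\<in>T. q t / (real n * ln 2) * (real (wt (d ^ n) (w t)) * (real m * ln 2)))"
    proof (intro sum_mono mult_left_mono)
      fix t assume t: "t \<in> T"
      show "q t / (real n * ln 2) \<ge> 0" using T(2)[OF t] by simp
      have "?g (wt (d ^ n) (w t)) \<le> real (wt (d ^ n) (w t)) * (real m * ln 2)"
      proof (cases "wt (d ^ n) (w t) = 0")
        case False
        have "real (wt (d ^ n) (w t)) \<le> real (2 ^ m)" using T(2)[OF t] by (simp only: of_nat_le_iff)
        then have "ln (real (wt (d ^ n) (w t))) \<le> ln (2 ^ m)" using False by simp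
        also have "\<dots> = real m * ln 2" by (simp add: ln_realpow)
        finally show ?thesis by (simp add: mult_left_mono)
      qed simp
      with us(4)[OF t] show "(\<Sum>v\<leftarrow>us t. ?g (wt d v)) \<le> real (wt (d ^ n) (w t)) * (real m * ln 2)" by linarith
    qed
    also have "\<dots> = (\<Sum>t\<in>T. q t * real (wt (d ^ n) (w t))) * (real m / real n)"
      unfolding sum_distrib_right by (intro sum.cong) (auto simp: field_simps)
    finally show ?thesis using T(4) by simp
  qed
  let ?R = "\<lambda>a b. marg d n (\<lambda>x y. \<Lambda> (max_coh m) $$ (x, y)) a b / of_nat n"
  have "\<exists>p' u'. flat_dec d (2 * d * d + 2) p' u' ?R \<and>
    dec_cost d (2 * d * d + 2) p' u' = (\<Sum>z\<in>S. p z * log 2 (real (wt d (u z))))"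
    by (rule finite_family_flat_dec[OF finS p0 p1 u ker])
  then obtain p' u' where "flat_dec d (2 * d * d + 2) p' u' ?R"
    and "dec_cost d (2 * d * d + 2) p' u' = (\<Sum>z\<in>S. p z * log 2 (real (wt d (u z))))"
    by (elim exE conjE) (rule that)
  with cost show ?thesis
    by (intro exI[of _ p'] exI[of _ u'] conjI) (simp_all only:)
qed

section \<open>Coherence cost\<close>

definition pio_errors :: "nat \<Rightarrow> complex mat \<Rightarrow> nat \<Rightarrow> nat \<Rightarrow> real set" where
  "pio_errors d \<rho> m n = {trace_norm (\<Lambda> (max_coh m) - tensor_pow \<rho> n) | \<Lambda>. PIO (2 ^ m) (d ^ n) \<Lambda>}"

lemma density_hermitian:
  "density d \<rho> \<Longrightarrow> \<rho> \<in> carrier_mat d d \<and> hermitian d (\<lambda>i j. \<rho> $$ (i, j)) \<and> mtrace \<rho> = 1"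
  unfolding density_def psd_iff_psdf using psdf_hermitian by blast

lemma density_dim_pos:
  assumes "density d \<rho>"
  shows "d > 0"
proof (rule ccontr)
  assume "\<not> d > 0"
  then have "mtrace \<rho> = 0" using density_hermitian[OF assms] by (auto simp: mtrace_def)
  then show False using density_hermitian[OF assms] by simp
qed

lemma power_Suc_digits:
  assumes "x < d ^ Suc n"
  obtains y a where "x = y * d + a" "y < d ^ n" "a < (d::nat)"
proof
  have "d > 0" using assms by (cases "d = 0") auto
  then show "x mod d < d" by simp
  show "x = x div d * d + x mod d" by simp
  show "x div d < d ^ n" using assms by (simp add: less_mult_imp_div_less mult.commute)
qed

lemma tensor_pow_hermitian:
  assumes "\<rho> \<in> carrier_mat d d" "hermitian d (\<lambda>i j. \<rho> $$ (i, j))"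
  shows "hermitian (d ^ n) (\<lambda>i j. tensor_pow \<rho> n $$ (i, j))"
proof (induction n)
  case 0
  then show ?case by (simp add: hermitian_def)
next
  case (Suc n)
  show ?case
    unfolding hermitian_def
  proof (intro allI impI)
    fix i j assume "i < d ^ Suc n" "j < d ^ Suc n"
    then obtain y a z b where i: "i = y * d + a" "y < d ^ n" "a < d" and j: "j = z * d + b" "z < d ^ n" "b < d"
      by (metis power_Suc_digits)
    have "tensor_pow \<rho> n $$ (y, z) = cnj (tensor_pow \<rho> n $$ (z, y))" "\<rho> $$ (a, b) = cnj (\<rho> $$ (b, a))"
      using Suc assms(2) i j unfolding hermitian_def by blast+
    then have "tensor_pow \<rho> n $$ (y, z) * \<rho> $$ (a, b) = cnj (tensor_pow \<rho> n $$ (z, y) * \<rho> $$ (b, a))"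
      by (metis complex_cnj_mult)
    then show "tensor_pow \<rho> (Suc n) $$ (i, j) = cnj (tensor_pow \<rho> (Suc n) $$ (j, i))"
      using tensor_pow_Suc_entry[OF assms(1)] i j by simp
  qed
qed

lemma pio_difference_hermitian:
  assumes "density d \<rho>" "PIO (2 ^ m) (d ^ n) \<Lambda>"
  shows "\<Lambda> (max_coh m) - tensor_pow \<rho> n \<in> carrier_mat (d ^ n) (d ^ n)"
    and "hermitian (d ^ n) (\<lambda>i j. (\<Lambda> (max_coh m) - tensor_pow \<rho> n) $$ (i, j))"
proof -
  note \<rho> = density_hermitian[OF assms(1)]
  have T: "tensor_pow \<rho> n \<in> carrier_mat (d ^ n) (d ^ n)" using \<rho> tensor_pow_carrier by blast
  have HT: "hermitian (d ^ n) (\<lambda>i j. tensor_pow \<rho> n $$ (i, j))" using \<rho> tensor_pow_hermitian by blast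
  note out = PIO_max_coh_output[OF assms(2)]
  have Lc: "\<Lambda> (max_coh m) \<in> carrier_mat (d ^ n) (d ^ n)" using out by blast
  obtain T' :: "(nat \<times> nat) set" and q w where
    ent: "\<And>x y. x < d ^ n \<Longrightarrow> y < d ^ n \<Longrightarrow>
        \<Lambda> (max_coh m) $$ (x, y) = (\<Sum>t\<in>T'. complex_of_real (q t) * (w t x * cnj (w t y)))"
    using out by blast
  show "\<Lambda> (max_coh m) - tensor_pow \<rho> n \<in> carrier_mat (d ^ n) (d ^ n)"
    using T by (rule minus_carrier_mat)
  show "hermitian (d ^ n) (\<lambda>i j. (\<Lambda> (max_coh m) - tensor_pow \<rho> n) $$ (i, j))"
    unfolding hermitian_def
  proof (intro allI impI)
    fix i j assume ij: "i < d ^ n" "j < d ^ n"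
    have "\<Lambda> (max_coh m) $$ (i, j) = cnj (\<Lambda> (max_coh m) $$ (j, i))"
      using ij by (simp add: ent mult.commute)
    moreover have "tensor_pow \<rho> n $$ (i, j) = cnj (tensor_pow \<rho> n $$ (j, i))"
      using HT ij unfolding hermitian_def by blast
    ultimately show "(\<Lambda> (max_coh m) - tensor_pow \<rho> n) $$ (i, j) = cnj ((\<Lambda> (max_coh m) - tensor_pow \<rho> n) $$ (j, i))"
      using ij T Lc by simp
  qed
qed

lemma pio_errors_nonneg:
  assumes "density d \<rho>" "x \<in> pio_errors d \<rho> m n"
  shows "x \<ge> 0"
proof -
  obtain \<Lambda> where \<Lambda>: "PIO (2 ^ m) (d ^ n) \<Lambda>" and x: "x = trace_norm (\<Lambda> (max_coh m) - tensor_pow \<rho> n)"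
    using assms(2) by (auto simp: pio_errors_def)
  show ?thesis
    unfolding x by (rule trace_norm_nonneg[OF pio_difference_hermitian[OF assms(1) \<Lambda>]])
qed

text \<open>An infimum of reals is informative only over a nonempty set bounded below. A block
  measurement targeting the first basis state provides an operation for all \<open>m\<close> and
  \<open>n\<close>.\<close>

lemma pio_errors_nonempty:
  assumes "d > 0"
  shows "pio_errors d \<rho> m n \<noteq> {}"
proof -
  define u where "u = (\<lambda>(\<alpha>::nat) (i::nat). if i = 0 then 1 else (0::complex))"
  have "{i. i < d ^ n \<and> u \<alpha> i \<noteq> 0} = {0}" for \<alpha> using assms by (auto simp: u_def)
  then have "wt (d ^ n) (u \<alpha>) > 0" for \<alpha> by (simp add: wt_def)
  moreover have "flat (d ^ n) (u \<alpha>)" for \<alpha> by (simp add: flat_def u_def)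
  ultimately have "\<exists>\<Lambda>. PIO (2 ^ m) (d ^ n) \<Lambda>"
    using block_measurement_PIO[of 1 "\<lambda>_. 1" "d ^ n" u m] by auto
  then show ?thesis by (auto simp: pio_errors_def)
qed

theorem unif_cof_le_of_achievable:
  assumes \<rho>: "density d \<rho>" and r: "r \<ge> 0"
    and lim: "(\<lambda>n. Inf (pio_errors d \<rho> (nat \<lfloor>r * real n\<rfloor>) n)) \<longlonglongrightarrow> 0"
  shows "unif_cof d \<rho> \<le> ereal r"
proof -
  define m where "m = (\<lambda>n. nat \<lfloor>r * real n\<rfloor>)"
  have m: "real (m n) \<le> r * real n" for n using r by (simp add: m_def)
  note d = density_dim_pos[OF \<rho>]
  note \<rho>' = density_hermitian[OF \<rho>]
  \<comment> \<open>The infimum over operations need not be attained; the vanishing slack picks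
    near-optimal ones.\<close>
  let ?e = "\<lambda>n. Inf (pio_errors d \<rho> (m n) n) + 1 / real (Suc n)"
  have "\<forall>n. \<exists>\<Lambda>. PIO (2 ^ m n) (d ^ n) \<Lambda> \<and> trace_norm (\<Lambda> (max_coh (m n)) - tensor_pow \<rho> n) < ?e n"
  proof
    fix n
    have "Inf (pio_errors d \<rho> (m n) n) < ?e n" by simp
    then obtain x where "x \<in> pio_errors d \<rho> (m n) n" "x < ?e n"
      using cInf_lessD[OF pio_errors_nonempty[OF d]] by blast
    then show "\<exists>\<Lambda>. PIO (2 ^ m n) (d ^ n) \<Lambda> \<and> trace_norm (\<Lambda> (max_coh (m n)) - tensor_pow \<rho> n) < ?e n"
      by (auto simp: pio_errors_def)
  qed
  from choice[OF this] obtain \<Lambda> where \<Lambda>: "\<And>n. PIO (2 ^ m n) (d ^ n) (\<Lambda> n)"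
    "\<And>n. trace_norm (\<Lambda> n (max_coh (m n)) - tensor_pow \<rho> n) < ?e n" by blast
  \<comment> \<open>Indexing by \<open>Suc n\<close> avoids the average over zero sites.\<close>
  define R where "R = (\<lambda>n a b. marg d (Suc n) (\<lambda>x y. \<Lambda> (Suc n) (max_coh (m (Suc n))) $$ (x, y)) a b / of_nat (Suc n))"
  let ?L = "2 * d * d + 2"
  have "\<forall>n. \<exists>pu. flat_dec d ?L (fst pu) (snd pu) (R n) \<and> dec_cost d ?L (fst pu) (snd pu) \<le> r"
  proof
    fix n
    obtain p u where "flat_dec d ?L p u (R n)" "dec_cost d ?L p u \<le> real (m (Suc n)) / real (Suc n)"
      using one_site_decomposition[OF \<Lambda>(1)[of "Suc n"]] unfolding R_def by blast
    moreover have "real (m (Suc n)) / real (Suc n) \<le> r"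
      using m[of "Suc n"] by (simp add: divide_le_eq del: of_nat_Suc)
    ultimately show "\<exists>pu. flat_dec d ?L (fst pu) (snd pu) (R n) \<and> dec_cost d ?L (fst pu) (snd pu) \<le> r"
      by (intro exI[of _ "(p, u)"]) simp
  qed
  from choice[OF this] obtain pu where
    pu: "\<And>n. flat_dec d ?L (fst (pu n)) (snd (pu n)) (R n)" "\<And>n. dec_cost d ?L (fst (pu n)) (snd (pu n)) \<le> r"
    by blast
  have "(\<lambda>n. R n a b) \<longlonglongrightarrow> \<rho> $$ (a, b)" if ab: "a < d" "b < d" for a b
  proof -
    \<comment> \<open>The summed marginals of the tensor power are \<open>Suc n\<close> copies of
      \<open>\<rho>\<close>, so the one-site error is at most the trace-norm error of the whole
      block.\<close>
    have bound: "norm (R n a b - \<rho> $$ (a, b)) \<le> ?e (Suc n)" for n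
    proof -
      let ?X = "\<Lambda> (Suc n) (max_coh (m (Suc n)))" and ?T = "tensor_pow \<rho> (Suc n)"
      have T: "?T \<in> carrier_mat (d ^ Suc n) (d ^ Suc n)" using \<rho>' tensor_pow_carrier by blast
      have X: "?X \<in> carrier_mat (d ^ Suc n) (d ^ Suc n)" using PIO_max_coh_output[OF \<Lambda>(1)] by blast
      have "marg d (Suc n) (\<lambda>x y. (?X - ?T) $$ (x, y)) a b =
          marg d (Suc n) (\<lambda>x y. ?X $$ (x, y) - ?T $$ (x, y)) a b"
        using X T by (intro marg_cong ab) auto
      also have "\<dots> = marg d (Suc n) (\<lambda>x y. ?X $$ (x, y)) a b - of_nat (Suc n) * \<rho> $$ (a, b)"
        unfolding marg_diff using marg_tensor_pow[of \<rho> d a b "Suc n"] \<rho>' ab by simp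
      finally have "R n a b - \<rho> $$ (a, b) = marg d (Suc n) (\<lambda>x y. (?X - ?T) $$ (x, y)) a b / of_nat (Suc n)"
        unfolding R_def by (simp add: field_simps del: of_nat_Suc marg.simps tensor_pow.simps)
      then have "norm (R n a b - \<rho> $$ (a, b)) = norm (marg d (Suc n) (\<lambda>x y. (?X - ?T) $$ (x, y)) a b) / real (Suc n)"
        by (simp only: norm_divide norm_of_nat)
      also have "\<dots> \<le> real (Suc n) * trace_norm (?X - ?T) / real (Suc n)"
        by (intro divide_right_mono marg_le_trace_norm pio_difference_hermitian[OF \<rho> \<Lambda>(1)] ab) simp
      also have "\<dots> = trace_norm (?X - ?T)" by (simp del: of_nat_Suc)
      also have "\<dots> \<le> ?e (Suc n)" using \<Lambda>(2)[of "Suc n"] by (rule less_imp_le)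
      finally show ?thesis .
    qed
    have "?e \<longlonglongrightarrow> 0 + 0"
      using lim by (intro tendsto_add LIMSEQ_Suc[OF lim_1_over_n]) (simp only: m_def)
    then have "(\<lambda>n. ?e (Suc n)) \<longlonglongrightarrow> 0" using LIMSEQ_Suc by fastforce
    then have "(\<lambda>n. R n a b - \<rho> $$ (a, b)) \<longlonglongrightarrow> 0"
      by (rule Lim_null_comparison[rotated]) (use bound in auto)
    then show ?thesis by (simp only: LIM_zero_iff)
  qed
  from flat_dec_limit[OF pu this] obtain p' u' where
    "flat_dec d ?L p' u' (\<lambda>a b. \<rho> $$ (a, b))" "dec_cost d ?L p' u' \<le> r" by blast
  then show ?thesis
    using unif_cof_le \<rho>' by (meson ereal_less_eq(3) order_trans)
qed

section \<open>Product decompositions and achievability\<close>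

lemma sum_div_mod:
  fixes f :: "nat \<Rightarrow> nat \<Rightarrow> 'a::comm_monoid_add"
  shows "(\<Sum>t<N * L. f (t div L) (t mod L)) = (\<Sum>y<N. \<Sum>s<L. f y s)"
  unfolding sum_lessThan_mult by (intro sum.cong refl) simp

lemma wt_product:
  "wt (d ^ Suc n) (\<lambda>x. w (x div d) * u (x mod d)) = wt (d ^ n) w * wt d u"
proof -
  have "real (wt (d ^ Suc n) (\<lambda>x. w (x div d) * u (x mod d))) =
      (\<Sum>y<d ^ n. \<Sum>a<d. of_bool (w y \<noteq> 0) * of_bool (u a \<noteq> 0))"
    unfolding wt_sum_of_bool sum_lessThan_power_Suc by (intro sum.cong refl) simp
  also have "\<dots> = real (wt (d ^ n) w * wt d u)"
    by (simp only: of_nat_mult wt_sum_of_bool sum_product)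
  finally show ?thesis by (simp only: of_nat_eq_iff)
qed

text \<open>Weights multiply under tensor products, so \<open>log 2\<close> of the weight is a sum
  of independent copies: its mean and its variance both grow linearly in \<open>n\<close>.\<close>

lemma tensor_pow_flat_dec:
  assumes \<rho>: "\<rho> \<in> carrier_mat d d" and dec: "flat_dec d L p u (\<lambda>i j. \<rho> $$ (i, j))"
  defines "\<mu> \<equiv> dec_cost d L p u" and "V \<equiv> \<Sum>s<L. p s * (log 2 (real (wt d (u s))) - dec_cost d L p u)\<^sup>2"
  shows "\<exists>N q w. flat_dec (d ^ n) N q w (\<lambda>i j. tensor_pow \<rho> n $$ (i, j)) \<and>
    dec_cost (d ^ n) N q w = real n * \<mu> \<and>
    (\<Sum>t<N. q t * (log 2 (real (wt (d ^ n) (w t))) - real n * \<mu>)\<^sup>2) = real n * V"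
proof (induction n)
  case 0
  have wt1: "wt (d ^ 0) (\<lambda>_. 1) = 1" by (simp add: wt_def)
  show ?case
    by (intro exI[of _ 1] exI[of _ "\<lambda>_. 1"] exI[of _ "\<lambda>_ _. 1"])
      (use wt1 in \<open>simp add: flat_dec_def dec_cost_def flat_def\<close>)
next
  case (Suc n)
  then obtain N q w where IH: "flat_dec (d ^ n) N q w (\<lambda>i j. tensor_pow \<rho> n $$ (i, j))"
    "dec_cost (d ^ n) N q w = real n * \<mu>"
    "(\<Sum>t<N. q t * (log 2 (real (wt (d ^ n) (w t))) - real n * \<mu>)\<^sup>2) = real n * V" by blast
  have Q: "q t \<ge> 0" "flat (d ^ n) (w t)" "wt (d ^ n) (w t) > 0" if "t < N" for t
    using IH(1) that by (auto simp: flat_dec_def)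
  have P: "p s \<ge> 0" "flat d (u s)" "wt d (u s) > 0" if "s < L" for s
    using dec that by (auto simp: flat_dec_def)
  have q1: "(\<Sum>t<N. q t) = 1" and p1: "(\<Sum>s<L. p s) = 1" using IH(1) dec by (auto simp: flat_dec_def)
  \<comment> \<open>An index below \<open>N * L\<close> encodes a pair: the quotient selects the
    term for the first \<open>n\<close> sites, the remainder the term for the new one.\<close>
  define q' where "q' = (\<lambda>t. q (t div L) * p (t mod L))"
  define w' where "w' = (\<lambda>t x. w (t div L) (x div d) * u (t mod L) (x mod d))"
  have wt': "wt (d ^ Suc n) (w' t) = wt (d ^ n) (w (t div L)) * wt d (u (t mod L))" for t
    unfolding w'_def by (rule wt_product)
  have idx: "t div L < N \<and> t mod L < L" if "t < N * L" for t
  proof -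
    have "L > 0" using that by (cases "L = 0") auto
    then show ?thesis using that by (simp add: less_mult_imp_div_less)
  qed
  let ?l = "\<lambda>t. log 2 (real (wt (d ^ n) (w t))) - real n * \<mu>"
  let ?k = "\<lambda>s. log 2 (real (wt d (u s))) - \<mu>"
  have logw: "log 2 (real (wt (d ^ Suc n) (w' t))) - real (Suc n) * \<mu> = ?l (t div L) + ?k (t mod L)"
    if "t < N * L" for t
    using Q(3) P(3) idx[OF that] unfolding wt' by (simp add: log_mult algebra_simps)
  \<comment> \<open>Both deviations are centred, which removes the cross term of the
    variance.\<close>
  have l0: "(\<Sum>t<N. q t * ?l t) = 0"
    using IH(2) q1 by (simp add: dec_cost_def right_diff_distrib sum_subtractf flip: sum_distrib_right)
  have k0: "(\<Sum>s<L. p s * ?k s) = 0"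
    using p1 by (simp add: \<mu>_def dec_cost_def right_diff_distrib sum_subtractf flip: sum_distrib_right)
  have q'1: "(\<Sum>t<N * L. q' t) = 1"
    unfolding q'_def sum_div_mod[of "\<lambda>y s. q y * p s"] using q1 p1 by (simp flip: sum_product)
  show ?case
  proof (intro exI[of _ "N * L"] exI[of _ q'] exI[of _ w'] conjI)
    show "flat_dec (d ^ Suc n) (N * L) q' w' (\<lambda>i j. tensor_pow \<rho> (Suc n) $$ (i, j))"
      unfolding flat_dec_def
    proof (intro conjI allI impI q'1)
      fix t assume t: "t < N * L"
      show "q' t \<ge> 0" using Q(1) P(1) idx[OF t] by (simp add: q'_def)
      show "wt (d ^ Suc n) (w' t) > 0" unfolding wt' using Q(3) P(3) idx[OF t] by simp
      show "flat (d ^ Suc n) (w' t)"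
        unfolding flat_def
      proof (intro allI impI)
        fix x assume "x < d ^ Suc n"
        then have "x div d < d ^ n" "x mod d < d"
          by (metis power_Suc_digits div_mult_self3 div_less add.right_neutral less_nat_zero_code mod_less_divisor
                not_gr_zero mult_0_right less_mult_imp_div_less power_Suc2)+
        then show "w' t x = 0 \<or> cmod (w' t x) = 1"
          using Q(2) P(2) idx[OF t] unfolding flat_def w'_def by (metis mult_eq_0_iff norm_mult mult_1)
      qed
    next
      fix i j assume "i < d ^ Suc n" "j < d ^ Suc n"
      then obtain y a z b where i: "i = y * d + a" "y < d ^ n" "a < d" and j: "j = z * d + b" "z < d ^ n" "b < d"
        by (metis power_Suc_digits)
      have "tensor_pow \<rho> (Suc n) $$ (i, j) = tensor_pow \<rho> n $$ (y, z) * \<rho> $$ (a, b)"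
        unfolding i(1) j(1) by (rule tensor_pow_Suc_entry[OF \<rho> i(2) j(2) i(3) j(3)])
      also have "\<dots> = (\<Sum>t<N. complex_of_real (q t / real (wt (d ^ n) (w t))) * (w t y * cnj (w t z))) *
          (\<Sum>s<L. complex_of_real (p s / real (wt d (u s))) * (u s a * cnj (u s b)))"
        using IH(1) dec i j by (simp add: flat_dec_def)
      also have "\<dots> = (\<Sum>t<N. \<Sum>s<L. (\<lambda>t s. complex_of_real (q t / real (wt (d ^ n) (w t))) * (w t y * cnj (w t z)) *
          (complex_of_real (p s / real (wt d (u s))) * (u s a * cnj (u s b)))) t s)"
        by (simp only: sum_product)
      also have "\<dots> = (\<Sum>t<N * L. complex_of_real (q' t / real (wt (d ^ Suc n) (w' t))) * (w' t i * cnj (w' t j)))"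
        unfolding sum_div_mod[symmetric] wt'
      proof (intro sum.cong refl)
        fix t
        have dm: "i div d = y" "i mod d = a" "j div d = z" "j mod d = b" using i j by simp_all
        show "complex_of_real (q (t div L) / real (wt (d ^ n) (w (t div L)))) * (w (t div L) y * cnj (w (t div L) z)) *
          (complex_of_real (p (t mod L) / real (wt d (u (t mod L)))) * (u (t mod L) a * cnj (u (t mod L) b))) =
          complex_of_real (q' t / real (wt (d ^ n) (w (t div L)) * wt d (u (t mod L)))) * (w' t i * cnj (w' t j))"
          unfolding q'_def w'_def dm by simp
      qed
      finally show "tensor_pow \<rho> (Suc n) $$ (i, j) =
          (\<Sum>t<N * L. complex_of_real (q' t / real (wt (d ^ Suc n) (w' t))) * (w' t i * cnj (w' t j)))" .
    qed
    have mean: "(\<Sum>t<N * L. q' t * (log 2 (real (wt (d ^ Suc n) (w' t))) - real (Suc n) * \<mu>)) = 0"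
    proof -
      have "(\<Sum>t<N * L. q' t * (log 2 (real (wt (d ^ Suc n) (w' t))) - real (Suc n) * \<mu>)) =
          (\<Sum>t<N * L. (\<lambda>y s. q y * p s * (?l y + ?k s)) (t div L) (t mod L))"
        using logw by (intro sum.cong) (auto simp: q'_def)
      also have "\<dots> = (\<Sum>y<N. \<Sum>s<L. q y * p s * (?l y + ?k s))"
        by (rule sum_div_mod[of "\<lambda>y s. q y * p s * (?l y + ?k s)"])
      also have "\<dots> = (\<Sum>y<N. \<Sum>s<L. q y * ?l y * p s + q y * (p s * ?k s))"
        by (intro sum.cong refl) (simp add: algebra_simps)
      also have "\<dots> = (\<Sum>y<N. q y * ?l y) * (\<Sum>s<L. p s) + (\<Sum>y<N. q y) * (\<Sum>s<L. p s * ?k s)"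
        by (simp only: sum.distrib sum_product)
      finally show ?thesis by (simp only: l0 k0 mult_zero_left mult_zero_right add_0)
    qed
    then show "dec_cost (d ^ Suc n) (N * L) q' w' = real (Suc n) * \<mu>"
      using q'1 by (simp add: dec_cost_def right_diff_distrib sum_subtractf del: power_Suc of_nat_Suc flip: sum_distrib_right)
    have square_expand: "a * b * (x + y)\<^sup>2 = a * x\<^sup>2 * b + 2 * (a * x * (b * y)) + a * (b * y\<^sup>2)"
      for a b x y :: real by (simp add: power2_eq_square algebra_simps)
    have "(\<Sum>t<N * L. q' t * (log 2 (real (wt (d ^ Suc n) (w' t))) - real (Suc n) * \<mu>)\<^sup>2) =
        (\<Sum>t<N * L. (\<lambda>y s. q y * p s * (?l y + ?k s)\<^sup>2) (t div L) (t mod L))"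
      using logw by (intro sum.cong) (auto simp: q'_def)
    also have "\<dots> = (\<Sum>y<N. \<Sum>s<L. q y * p s * (?l y + ?k s)\<^sup>2)"
      by (rule sum_div_mod[of "\<lambda>y s. q y * p s * (?l y + ?k s)\<^sup>2"])
    also have "\<dots> = (\<Sum>y<N. \<Sum>s<L. q y * (?l y)\<^sup>2 * p s + 2 * (q y * ?l y * (p s * ?k s)) + q y * (p s * (?k s)\<^sup>2))"
      by (intro sum.cong refl square_expand)
    also have "\<dots> = (\<Sum>y<N. q y * (?l y)\<^sup>2) * (\<Sum>s<L. p s) +
        2 * ((\<Sum>y<N. q y * ?l y) * (\<Sum>s<L. p s * ?k s)) + (\<Sum>y<N. q y) * (\<Sum>s<L. p s * (?k s)\<^sup>2)"
      by (simp only: sum.distrib sum_product sum_distrib_left[of "2 :: real"])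
    also have "\<dots> = real n * V + V"
      unfolding l0 IH(3) q1 p1 by (simp add: V_def \<mu>_def)
    finally show "(\<Sum>t<N * L. q' t * (log 2 (real (wt (d ^ Suc n) (w' t))) - real (Suc n) * \<mu>)\<^sup>2) = real (Suc n) * V"
      by (simp add: ring_distribs del: power_Suc)
  qed
qed

text \<open>Chebyshev: \<open>log K\<close> concentrates at \<open>n \<mu>\<close>, and where it does the remainder \<open>M mod K \<le> K\<close> is
  exponentially smaller than \<open>M\<close>.\<close>

lemma remainder_ratio_le:
  assumes K: "K > 0" and \<delta>: "\<delta> > 0" and m: "real m \<ge> real n * (\<mu> + 2 * \<delta>) - 1" and n: "n > 0"
  shows "real (2 ^ m mod K) / 2 ^ m \<le> 2 powr (1 - real n * \<delta>) + (log 2 (real K) - real n * \<mu>)\<^sup>2 / (real n * \<delta>)\<^sup>2"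
proof (cases "log 2 (real K) \<le> real n * (\<mu> + \<delta>)")
  case True
  \<comment> \<open>Typical case: \<open>log K - m\<close> is at most
    \<open>n * (\<mu> + \<delta>) - n * (\<mu> + 2 * \<delta>) + 1\<close>; the final 1 pays for
    rounding the rate down.\<close>
  have "real (2 ^ m mod K) \<le> real K" using K by (simp add: less_imp_le)
  also have "real K = 2 powr (log 2 (real K))" using K by simp
  finally have "real (2 ^ m mod K) / 2 ^ m \<le> 2 powr (log 2 (real K)) / 2 powr (real m)"
    by (simp add: powr_realpow divide_right_mono)
  also have "\<dots> = 2 powr (log 2 (real K) - real m)" by (simp only: powr_diff)
  also have "\<dots> \<le> 2 powr (1 - real n * \<delta>)"
    using True m by (intro powr_mono) (auto simp: algebra_simps)
  finally show ?thesis by (simp add: add_increasing2)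
next
  case False
  then have "real n * \<delta> \<le> log 2 (real K) - real n * \<mu>" by (simp add: algebra_simps)
  \<comment> \<open>Atypical case: the quadratic term alone is at least 1, which dominates the
    trivial bound on the ratio.\<close>
  then have "(real n * \<delta>)\<^sup>2 \<le> (log 2 (real K) - real n * \<mu>)\<^sup>2" using \<delta> by (intro power_mono) auto
  then have "1 \<le> (log 2 (real K) - real n * \<mu>)\<^sup>2 / (real n * \<delta>)\<^sup>2" using \<delta> n by simp
  moreover have "real (2 ^ m mod K) / 2 ^ m \<le> 1"
  proof -
    have "real (2 ^ m mod K) \<le> real (2 ^ m)" by (simp only: of_nat_le_iff mod_less_eq_dividend)
    then show ?thesis by simp
  qed
  moreover have "2 powr (1 - real n * \<delta>) \<ge> 0" by simp
  ultimately show ?thesis by linarith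
qed

text \<open>Averaging the remainder bound over the product decomposition replaces the squared
  deviation by the variance \<open>n * V\<close>, so the error is of order
  \<open>2 powr (- n * \<delta>) + V / (n * \<delta>^2)\<close>.\<close>

theorem achievable_of_flat_dec:
  assumes \<rho>: "density d \<rho>" and dec: "flat_dec d L p u (\<lambda>i j. \<rho> $$ (i, j))" and r: "r > dec_cost d L p u"
  shows "(\<lambda>n. Inf (pio_errors d \<rho> (nat \<lfloor>r * real n\<rfloor>) n)) \<longlonglongrightarrow> 0"
proof -
  note d = density_dim_pos[OF \<rho>]
  have \<rho>c: "\<rho> \<in> carrier_mat d d" using density_hermitian[OF \<rho>] by blast
  define \<mu> where "\<mu> = dec_cost d L p u"
  define V where "V = (\<Sum>s<L. p s * (log 2 (real (wt d (u s))) - dec_cost d L p u)\<^sup>2)"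
  define \<delta> where "\<delta> = (r - \<mu>) / 2"
  have "2 * \<delta> = r - \<mu>" by (simp add: \<delta>_def)
  then have \<delta>: "\<delta> > 0" "r = \<mu> + 2 * \<delta>" using r by (simp_all add: \<mu>_def)
  let ?b = "\<lambda>n. 2 * (2 powr (1 - real n * \<delta>) + V / (real n * \<delta>\<^sup>2))"
  let ?e = "\<lambda>n. Inf (pio_errors d \<rho> (nat \<lfloor>r * real n\<rfloor>) n)"
  have low: "0 \<le> ?e n" for n
    using pio_errors_nonneg[OF \<rho>] by (intro cInf_greatest pio_errors_nonempty[OF d])
  have up: "?e n \<le> ?b n" if n: "n > 0" for n
  proof -
    define m where "m = nat \<lfloor>r * real n\<rfloor>"
    have "real m \<ge> r * real n - 1" unfolding m_def by linarith
    then have m: "real m \<ge> real n * (\<mu> + 2 * \<delta>) - 1" by (simp add: \<delta>(2) mult.commute)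
    obtain N q w where dn: "flat_dec (d ^ n) N q w (\<lambda>i j. tensor_pow \<rho> n $$ (i, j))"
      and var: "(\<Sum>t<N. q t * (log 2 (real (wt (d ^ n) (w t))) - real n * \<mu>)\<^sup>2) = real n * V"
      using tensor_pow_flat_dec[OF \<rho>c dec, of n] unfolding \<mu>_def V_def by blast
    have Q: "q t \<ge> 0" "flat (d ^ n) (w t)" "wt (d ^ n) (w t) > 0" if "t < N" for t
      using dn that by (auto simp: flat_dec_def)
    have q1: "(\<Sum>t<N. q t) = 1" using dn by (simp add: flat_dec_def)
    have T: "tensor_pow \<rho> n = mat (d ^ n) (d ^ n)
        (\<lambda>(i, j). \<Sum>t<N. complex_of_real (q t / real (wt (d ^ n) (w t))) * (w t i * cnj (w t j)))"
      using tensor_pow_carrier[OF \<rho>c, of n] dn by (intro eq_matI) (auto simp: flat_dec_def)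
    have "\<exists>\<Lambda>. PIO (2 ^ m) (d ^ n) \<Lambda> \<and> trace_norm (\<Lambda> (max_coh m) - tensor_pow \<rho> n)
        \<le> (\<Sum>t<N. q t * (2 * real (2 ^ m mod wt (d ^ n) (w t)) / 2 ^ m))"
      unfolding T by (rule block_measurement_PIO) (use Q q1 in auto)
    then obtain \<Lambda> where \<Lambda>: "PIO (2 ^ m) (d ^ n) \<Lambda>" "trace_norm (\<Lambda> (max_coh m) - tensor_pow \<rho> n)
        \<le> (\<Sum>t<N. q t * (2 * real (2 ^ m mod wt (d ^ n) (w t)) / 2 ^ m))"
      by blast
    have "?e n \<le> trace_norm (\<Lambda> (max_coh m) - tensor_pow \<rho> n)"
      unfolding m_def[symmetric] using \<Lambda>(1) pio_errors_nonneg[OF \<rho>]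
      by (intro cInf_lower) (auto simp: pio_errors_def intro!: bdd_belowI[of _ 0])
    also note \<Lambda>(2)
    also have "(\<Sum>t<N. q t * (2 * real (2 ^ m mod wt (d ^ n) (w t)) / 2 ^ m)) \<le>
        (\<Sum>t<N. q t * (2 * (2 powr (1 - real n * \<delta>) +
           (log 2 (real (wt (d ^ n) (w t))) - real n * \<mu>)\<^sup>2 / (real n * \<delta>)\<^sup>2)))"
    proof (intro sum_mono mult_left_mono)
      fix t assume "t \<in> {..<N}"
      then show "2 * real (2 ^ m mod wt (d ^ n) (w t)) / 2 ^ m \<le> 2 * (2 powr (1 - real n * \<delta>) +
           (log 2 (real (wt (d ^ n) (w t))) - real n * \<mu>)\<^sup>2 / (real n * \<delta>)\<^sup>2)"
        using remainder_ratio_le[OF Q(3) \<delta>(1) m n, of t] by simp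
    qed (use Q(1) in auto)
    also have "\<dots> = 2 * (2 powr (1 - real n * \<delta>)) * (\<Sum>t<N. q t) +
        2 * (\<Sum>t<N. q t * (log 2 (real (wt (d ^ n) (w t))) - real n * \<mu>)\<^sup>2) / (real n * \<delta>)\<^sup>2"
    proof -
      have "(\<Sum>t<N. q t * (2 * (A + v t / B))) = 2 * A * (\<Sum>t<N. q t) + 2 * (\<Sum>t<N. q t * v t) / B"
        for A B :: real and v
        by (simp add: ring_distribs sum.distrib sum_distrib_left sum_divide_distrib mult_ac)
      then show ?thesis .
    qed
    also have "\<dots> = ?b n"
      unfolding q1 var using n \<delta>(1) by (simp add: power2_eq_square)
    finally show ?thesis .
  qed
  show ?thesis
  proof (rule tendsto_sandwich)
    show "\<forall>\<^sub>F n in sequentially. 0 \<le> ?e n" using low by simp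
    show "\<forall>\<^sub>F n in sequentially. ?e n \<le> ?b n"
      using up by (intro eventually_sequentiallyI[of 1]) simp
    show "?b \<longlonglongrightarrow> 0" using \<delta>(1) by real_asymp
  qed simp
qed

lemma unif_cof_elem_flat_dec:
  assumes p: "\<forall>\<alpha><N. p \<alpha> \<ge> 0" "(\<Sum>\<alpha><N. p \<alpha>) = 1" and \<psi>: "\<forall>\<alpha><N. unif_coherent d (k \<alpha>) (\<psi> \<alpha>)"
    and \<rho>: "\<rho> = mat d d (\<lambda>(i,j). \<Sum>\<alpha><N. complex_of_real (p \<alpha>) * proj_vec (\<psi> \<alpha>) $$ (i,j))"
  shows "\<exists>u. flat_dec d N p u (\<lambda>i j. \<rho> $$ (i, j)) \<and> dec_cost d N p u = (\<Sum>\<alpha><N. p \<alpha> * log 2 (real (k \<alpha>)))"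
proof -
  have "\<forall>\<alpha>. \<exists>u. \<alpha> < N \<longrightarrow> flat d u \<and> wt d u = k \<alpha> \<and> k \<alpha> > 0 \<and>
    (\<forall>i<d. \<forall>j<d. proj_vec (\<psi> \<alpha>) $$ (i, j) = complex_of_real (1 / real (k \<alpha>)) * (u i * cnj (u j)))"
    using \<psi> unif_coherent_flat by blast
  from choice[OF this] obtain u where u: "\<And>\<alpha>. \<alpha> < N \<Longrightarrow> flat d (u \<alpha>)" "\<And>\<alpha>. \<alpha> < N \<Longrightarrow> wt d (u \<alpha>) = k \<alpha>"
    "\<And>\<alpha>. \<alpha> < N \<Longrightarrow> k \<alpha> > 0"
    "\<And>\<alpha> i j. \<alpha> < N \<Longrightarrow> i < d \<Longrightarrow> j < d \<Longrightarrow>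
        proj_vec (\<psi> \<alpha>) $$ (i, j) = complex_of_real (1 / real (k \<alpha>)) * (u \<alpha> i * cnj (u \<alpha> j))"
    by blast
  have "flat_dec d N p u (\<lambda>i j. \<rho> $$ (i, j))"
    unfolding flat_dec_def using p u by (auto simp: \<rho> intro!: sum.cong)
  moreover have "dec_cost d N p u = (\<Sum>\<alpha><N. p \<alpha> * log 2 (real (k \<alpha>)))"
    using u(2) by (simp add: dec_cost_def)
  ultimately show ?thesis by blast
qed

theorem theorem2:
  fixes d :: nat and \<rho> :: "complex mat"
  assumes "density d \<rho>"
  shows "coh_cost_PIO d \<rho> = unif_cof d \<rho>"
proof (rule antisym)
  have cost: "coh_cost_PIO d \<rho> = Inf (ereal ` {r. r \<ge> 0 \<and>
      (\<lambda>n. Inf (pio_errors d \<rho> (nat \<lfloor>r * real n\<rfloor>) n)) \<longlonglongrightarrow> 0})"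
    by (simp only: coh_cost_PIO_def pio_errors_def)
  show "unif_cof d \<rho> \<le> coh_cost_PIO d \<rho>"
    unfolding cost using unif_cof_le_of_achievable[OF assms] by (intro Inf_greatest) auto
  show "coh_cost_PIO d \<rho> \<le> unif_cof d \<rho>"
    unfolding unif_cof_def
  \<comment> \<open>If there is no decomposition, the set is empty, its infimum is infinite and
    nothing has to be shown.\<close>
  proof (rule Inf_greatest)
    fix z
    assume "z \<in> {ereal (\<Sum>\<alpha><(N::nat). p \<alpha> * log 2 (real (k \<alpha>))) | N p k \<psi>.
      (\<forall>\<alpha><N. p \<alpha> \<ge> 0) \<and> (\<Sum>\<alpha><N. p \<alpha>) = 1 \<and>
      (\<forall>\<alpha><N. unif_coherent d (k \<alpha>) (\<psi> \<alpha>)) \<and>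
      \<rho> = mat d d (\<lambda>(i,j). \<Sum>\<alpha><N. complex_of_real (p \<alpha>) * proj_vec (\<psi> \<alpha>) $$ (i,j))}"
    then obtain N :: nat and p k \<psi> where z: "z = ereal (\<Sum>\<alpha><N. p \<alpha> * log 2 (real (k \<alpha>)))"
      and p: "\<forall>\<alpha><N. 0 \<le> p \<alpha>" "(\<Sum>\<alpha><N. p \<alpha>) = 1"
      and \<psi>: "\<forall>\<alpha><N. unif_coherent d (k \<alpha>) (\<psi> \<alpha>)"
      and \<rho>: "\<rho> = mat d d (\<lambda>(i,j). \<Sum>\<alpha><N. complex_of_real (p \<alpha>) * proj_vec (\<psi> \<alpha>) $$ (i,j))"
      by (elim CollectE exE conjE) (rule that, assumption+)
    obtain u where u: "flat_dec d N p u (\<lambda>i j. \<rho> $$ (i, j))"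
      "dec_cost d N p u = (\<Sum>\<alpha><N. p \<alpha> * log 2 (real (k \<alpha>)))"
      using unif_cof_elem_flat_dec[OF p \<psi> \<rho>] by blast
    \<comment> \<open>Admissible rates are nonnegative by definition, so rates above the cost must
      be known to qualify.\<close>
    have pos: "dec_cost d N p u \<ge> 0"
      unfolding dec_cost_def using u(1)
      by (intro sum_nonneg mult_nonneg_nonneg) (auto simp: flat_dec_def Suc_le_eq)
    have "coh_cost_PIO d \<rho> \<le> ereal r" if "r > dec_cost d N p u" for r
      unfolding cost using that pos achievable_of_flat_dec[OF assms u(1) that]
      by (intro Inf_lower) auto
    note above = this
    have "coh_cost_PIO d \<rho> \<le> ereal (dec_cost d N p u)"
    \<comment> \<open>Achievability holds strictly above the cost of a decomposition; the cost
      itself is reached as an infimum.\<close>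
    proof (rule ereal_le_epsilon2)
      fix e :: real assume "e > 0"
      then show "coh_cost_PIO d \<rho> \<le> ereal (dec_cost d N p u) + ereal e"
        using above[of "dec_cost d N p u + e"] by simp
    qed
    then show "coh_cost_PIO d \<rho> \<le> z"
      by (simp only: u(2) z)
  qed
qed

end
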